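(* In the weighted Indian buffet model described in the context, suppose $\beta\in[0,1)$ and, for some constant $r$, \[ \overline{R}_n:=\frac1n\sum_{i=1}^nR_i\longrightarrow r\ \text{ a.s.}\qquad\text{and}\qquad \frac{\sum_{j=1}^n j^{\beta-1}E|\overline{R}_j-r|}{\sqrt{a_n(\beta)}}\longrightarrow0. \] Let $L_n=\mathrm{card}(S_n)$. Then \[ \sqrt{a_n(\beta)}\Bigl\{\frac{L_n}{a_n(\beta)}-\lambda(\beta)\Bigr\}\longrightarrow\mathcal{N}\bigl(0,\lambda(\beta)\bigr)\quad\text{stably}, \] where $a_n(\beta)=\log n$ and $\lambda(\beta)=\alpha c/r$ if $\beta=0$, while $a_n(\beta)=n^\beta$ and $\lambda(\beta)=\frac{\alpha\Gamma(c+1)}{\Gamma(c+\beta)}\frac{1}{\beta r^{1-\beta}}$ if $\beta\in(0,1)$.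
   Context: Let $\mathcal{X}$ be a separable metric space with Borel $\sigma$-field $\mathcal{B}$, and let $\mathcal{M}$ be the set of finite positive measures on $\mathcal{B}$; $\mu\in\mathcal{M}$ is diffuse if $\mu\{x\}=0$ for all $x$. All random quantities live on a probability space $(\Omega,\mathcal{A},P)$. A random measure (r.m.) is a map $M:\Omega\to\mathcal{M}$ such that $\omega\mapsto M(\omega)(B)$ is measurable for each $B\in\mathcal{B}$. A Poisson r.m. with intensity $\nu\in\mathcal{M}$ is an r.m. $M$ with $M(B_1),\dots,M(B_k)$ independent for pairwise disjoint $B_j$ and $M(B)\sim\mathrm{Poi}(\nu(B))$ for all $B$ (with $\mathrm{Poi}(0)=\delta_0$). Each $\nu\in\mathcal{M}$ is uniquely $\nu=\nu_c+\nu_d$, $\nu_c$ diffuse, $\nu_d=\sum_j\gamma_j\delta_{x_j}$. $M\sim\mathrm{BeP}(\nu)$ (Bernoulli r.m. with hazard measure $\nu$) means $M=M_1+M_2$ with $M_1,M_2$ independent, $M_1$ Poisson with intensity $\nu_c$, $M_2=\sum_jV_j\delta_{x_j}$ with independent indicators $V_j$, $P(V_j=1)=\gamma_j$. "$X\mid\mathcal{G}\sim Y\mid\mathcal{G}$" means $P(X\in A\mid\mathcal{G})=P(Y\in A\mid\mathcal{G})$ a.s. for all measurable $A$. Model: fix a diffuse probability measure $m$ on $\mathcal{B}$ and reals $\alpha>0$, $\beta<1$, $c>-\beta$. $(M_n)_{n\ge1}$ are r.m.'s and $(R_n)_{n\ge1}$ real random variables such that for each $n\ge1$, $R_n$ is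 independent of $(M_1,\dots,M_n,R_1,\dots,R_{n-1})$ and $R_n\ge u$ for a constant $u>\max(\beta,0)$; and $M_{n+1}\mid\mathcal{F}_n\sim\mathrm{BeP}(\nu_n)$ for all $n\ge0$, where $\mathcal{F}_0=\{\varnothing,\Omega\}$, $\mathcal{F}_n=\sigma(M_1,\dots,M_n,R_1,\dots,R_n)$, $S_n=\{x: M_i\{x\}=1\text{ for some } i\le n\}$, $\nu_0=\alpha m$ and for $n\ge1$ \[ \nu_n=\sum_{x\in S_n}\frac{\sum_{i=1}^nR_iM_i\{x\}-\beta}{\sum_{i=1}^nR_i+c}\,\delta_x+\Lambda_n\, m,\qquad \Lambda_0=\alpha,\ \ \Lambda_n=\alpha\frac{\Gamma(c+1)\Gamma(c+\beta+\sum_{i=1}^nR_i)}{\Gamma(c+\beta)\Gamma(c+1+\sum_{i=1}^nR_i)}. \] Stable convergence: a kernel is an r.m. $K$ with $K(\omega)(\mathbb{R})=1$ for all $\omega$ (here on $\mathbb R$). Real random variables $X_n$ converge stably to $K$ if $E\{K(f)\mid H\}=\lim_nE\{f(X_n)\mid H\}$ for all $H\in\mathcal{A}$ with $P(H)>0$ and all bounded continuous $f$, where $K(f)=\int f\,dK$. $\mathcal{N}(0,a)$ denotes the Gaussian law with mean $0$ and variance $a\ge0$ (with $\mathcal N(0,0)=\delta_0$), viewed as a constant kernel. *)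

theory Defs
  imports "HOL-Probability.Probability"
begin

definition fm_space :: "('x::topological_space) measure measure" where
  "fm_space = sigma {\<mu>. sets \<mu> = sets (borel :: 'x measure)}
     {{\<mu>. sets \<mu> = sets (borel :: 'x measure) \<and> emeasure \<mu> B \<in> A} | B A.
        B \<in> sets (borel :: 'x measure) \<and> A \<in> sets (borel :: ennreal measure)}"

definition rand_meas :: "'w measure \<Rightarrow> ('w \<Rightarrow> ('x::topological_space) measure) \<Rightarrow> bool" where
  "rand_meas P X \<longleftrightarrow>
     (\<forall>\<omega>\<in>space P. sets (X \<omega>) = sets (borel :: 'x measure) \<and> finite_measure (X \<omega>)) \<and>
     (\<forall>B\<in>sets (borel :: 'x measure). (\<lambda>\<omega>. emeasure (X \<omega>) B) \<in> borel_measurable P)"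

definition poi :: "real \<Rightarrow> nat pmf" where
  "poi t = (if t = 0 then return_pmf 0 else poisson_pmf t)"

definition is_poisson_law :: "(('x::topological_space) set \<Rightarrow> real) \<Rightarrow> 'x measure measure \<Rightarrow> bool" where
  "is_poisson_law lam Q \<longleftrightarrow> prob_space Q \<and> sets Q = sets fm_space \<and>
     (\<forall>B\<in>sets (borel :: 'x measure).
        distr Q (borel :: ennreal measure) (\<lambda>\<mu>. emeasure \<mu> B)
        = distr (measure_pmf (poi (lam B))) (borel :: ennreal measure) (\<lambda>k. of_nat k)) \<and>
     (\<forall>(I :: nat set) B. finite I \<longrightarrow> (\<forall>i\<in>I. B i \<in> sets (borel :: 'x measure)) \<longrightarrow>
        disjoint_family_on B I \<longrightarrow>
        prob_space.indep_vars Q (\<lambda>_. borel :: ennreal measure) (\<lambda>i \<mu>. emeasure \<mu> (B i)) I)"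

definition poisson_law :: "(('x::topological_space) set \<Rightarrow> real) \<Rightarrow> 'x measure measure" where
  "poisson_law lam = (THE Q. is_poisson_law lam Q)"

definition atoms :: "'x measure \<Rightarrow> 'x set" where
  "atoms \<nu> = {x. measure \<nu> {x} > 0}"

definition diffuse_part :: "'x measure \<Rightarrow> 'x set \<Rightarrow> real" where
  "diffuse_part \<nu> B = measure \<nu> B - infsum (\<lambda>x. measure \<nu> {x}) (atoms \<nu> \<inter> B)"

definition add_points :: "('x::topological_space) measure \<Rightarrow> 'x set \<Rightarrow> 'x measure" where
  "add_points \<mu> S = measure_of UNIV (sets (borel :: 'x measure))
      (\<lambda>B. emeasure \<mu> B + emeasure (count_space UNIV) (B \<inter> S))"

definition BeP :: "('x::topological_space) measure \<Rightarrow> 'x measure measure" where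
  "BeP \<nu> = distr
     (pair_measure (poisson_law (diffuse_part \<nu>))
        (PiM (atoms \<nu>) (\<lambda>x. measure_pmf (bernoulli_pmf (measure \<nu> {x})))))
     fm_space
     (\<lambda>(\<mu>, v). add_points \<mu> {x\<in>atoms \<nu>. v x})"

definition genF :: "'w measure \<Rightarrow> (nat \<Rightarrow> 'w \<Rightarrow> ('x::topological_space) measure) \<Rightarrow>
    (nat \<Rightarrow> 'w \<Rightarrow> real) \<Rightarrow> nat set \<Rightarrow> nat set \<Rightarrow> 'w measure" where
  "genF P M R Is Js = sigma (space P)
     ((\<Union>i\<in>Is. {M i -` A \<inter> space P | A. A \<in> sets (fm_space :: 'x measure measure)}) \<union>
      (\<Union>j\<in>Js. {R j -` A \<inter> space P | A. A \<in> sets (borel :: real measure)}))"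

definition Sset :: "(nat \<Rightarrow> 'w \<Rightarrow> 'x measure) \<Rightarrow> nat \<Rightarrow> 'w \<Rightarrow> 'x set" where
  "Sset M n \<omega> = {x. \<exists>i\<in>{1..n}. emeasure (M i \<omega>) {x} = 1}"

definition Lam :: "real \<Rightarrow> real \<Rightarrow> real \<Rightarrow> (nat \<Rightarrow> 'w \<Rightarrow> real) \<Rightarrow> nat \<Rightarrow> 'w \<Rightarrow> real" where
  "Lam \<alpha> \<beta> c R n \<omega> = \<alpha> * (Gamma (c + 1) * Gamma (c + \<beta> + (\<Sum>i=1..n. R i \<omega>))) /
      (Gamma (c + \<beta>) * Gamma (c + 1 + (\<Sum>i=1..n. R i \<omega>)))"

text \<open>The hazard measure nu_n (for n = 0 this reduces to alpha m).\<close>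
definition nu :: "('x::topological_space) measure \<Rightarrow> real \<Rightarrow> real \<Rightarrow> real \<Rightarrow>
    (nat \<Rightarrow> 'w \<Rightarrow> 'x measure) \<Rightarrow> (nat \<Rightarrow> 'w \<Rightarrow> real) \<Rightarrow> nat \<Rightarrow> 'w \<Rightarrow> 'x measure" where
  "nu m \<alpha> \<beta> c M R n \<omega> = measure_of UNIV (sets (borel :: 'x measure))
     (\<lambda>B. (\<integral>\<^sup>+x. indicator (Sset M n \<omega> \<inter> B) x *
              ennreal (((\<Sum>i=1..n. R i \<omega> * measure (M i \<omega>) {x}) - \<beta>) /
                       ((\<Sum>i=1..n. R i \<omega>) + c)) \<partial>count_space UNIV)
          + ennreal (Lam \<alpha> \<beta> c R n \<omega>) * emeasure m B)"

definition stably_conv :: "'w measure \<Rightarrow> (nat \<Rightarrow> 'w \<Rightarrow> real) \<Rightarrow> ('w \<Rightarrow> real measure) \<Rightarrow> bool" where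
  "stably_conv P X K \<longleftrightarrow>
     (\<forall>\<omega>\<in>space P. prob_space (K \<omega>) \<and> sets (K \<omega>) = sets (borel :: real measure)) \<and>
     (\<forall>B\<in>sets (borel :: real measure). (\<lambda>\<omega>. emeasure (K \<omega>) B) \<in> borel_measurable P) \<and>
     (\<forall>H\<in>sets P. measure P H > 0 \<longrightarrow>
       (\<forall>f :: real \<Rightarrow> real. continuous_on UNIV f \<and> bounded (range f) \<longrightarrow>
          ((\<lambda>n. (\<integral>\<omega>. f (X n \<omega>) * indicator H \<omega> \<partial>P) / measure P H)
             \<longlonglongrightarrow> (\<integral>\<omega>. (\<integral>x. f x \<partial>K \<omega>) * indicator H \<omega> \<partial>P) / measure P H)))"

definition gauss :: "real \<Rightarrow> real measure" where
  "gauss a = (if a = 0 then return borel 0 else density lborel (normal_density 0 (sqrt a)))"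

definition a_seq :: "real \<Rightarrow> nat \<Rightarrow> real" where
  "a_seq \<beta> n = (if \<beta> = 0 then ln (real n) else real n powr \<beta>)"

definition lam_const :: "real \<Rightarrow> real \<Rightarrow> real \<Rightarrow> real \<Rightarrow> real" where
  "lam_const \<alpha> \<beta> c r = (if \<beta> = 0 then \<alpha> * c / r
     else \<alpha> * Gamma (c + 1) / Gamma (c + \<beta>) * (1 / (\<beta> * r powr (1 - \<beta>))))"

end

theory Submission
  imports Defs
begin

text \<open>
  Given the past, the number of new dishes tried by customer \<open>n + 1\<close> is Poisson with the random
  mean \<open>\<Lambda>\<^sub>n\<close>. Hence, with \<open>V\<^sub>n = \<Lambda>\<^sub>0 + \<dots> + \<Lambda>\<^sub>n\<^sub>-\<^sub>1\<close>, the process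
  \<open>exp (i s L\<^sub>n - (exp (i s) - 1) V\<^sub>n)\<close> is a martingale for every real \<open>s\<close>, so its
  expectation over an event of the past does not depend on \<open>n\<close>. Take \<open>s = t / sqrt a\<^sub>n\<close>.
  Since \<open>R\<^sub>n \<ge> u\<close>, the quotient \<open>V\<^sub>n / a\<^sub>n\<close> is bounded by a constant, so
  this exponential is bounded, and the rate condition together with
  \<open>\<Gamma>(x + \<beta>) / \<Gamma>(x + 1) = x\<^bsup>\<beta>-1\<^esup> (1 + O(1/x))\<close> gives \<open>E |V\<^sub>n - \<lambda> a\<^sub>n| = o(sqrt a\<^sub>n)\<close>. The compensator
  therefore converges to the Gaussian exponent, and the characteristic functions of the
  normalised counts converge on every event of the filtration. A Dynkin argument and conditioning on the
  generated \<open>\<sigma>\<close>-algebra extend this to all events.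

  The Poisson law of the hazard measure is realised as the law of \<open>N\<close> independent points drawn
  from \<open>m\<close> with \<open>N\<close> Poisson; almost surely these points are distinct and miss the finite set \<open>S\<^sub>n\<close>.
\<close>

text \<open>Two obstacles come before the martingale. \<open>poisson_law\<close> is a definite
  description, so \<open>BeP\<close> carries no information until a Poisson law has been shown to
  exist and to be unique. And the hypothesis on the next customer speaks of fixed sets of measures,
  while new dishes are counted off the random set \<open>Sset M n w\<close>; the conditional law has
  to be evaluated at sections of a set in a product space. This requires the count to be measurable
  jointly in the outcome and the measure, which is why it is written as the mass of a measurable
  set. The frequency \<open>t / sqrt (a n)\<close> moves with \<open>n\<close>, so each
  \<open>n\<close> has its own martingale. For an event of \<open>F k\<close> its expectation is
  brought back to the fixed time \<open>k\<close>, where the frequency tends to 0 and the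
  expectation to the probability of the event. Since \<open>U\<close> has modulus at least 1, its
  uniform bound comes from the fact that 1 - cos s is at most half the square of s. All estimates of
  the intensities start from the lower bound \<open>u\<close> of the weights: it puts the partial
  sums above \<open>real n * u\<close> and the limit \<open>r\<close> above \<open>u\<close>, so
  that the error terms have deterministic constants.\<close>

lemma space_fm_space: "space (fm_space :: 'x::topological_space measure measure) = {\<mu>. sets \<mu> = sets borel}"
  unfolding fm_space_def by (rule space_measure_of) auto

lemma sets_fm_space:
  "sets (fm_space :: 'x::topological_space measure measure) = sigma_sets {\<mu>. sets \<mu> = sets borel}
     {{\<mu>. sets \<mu> = sets (borel :: 'x measure) \<and> emeasure \<mu> B \<in> A} | B A.
        B \<in> sets (borel :: 'x measure) \<and> A \<in> sets (borel :: ennreal measure)}"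
  unfolding fm_space_def by (rule sets_measure_of) auto

lemma measurable_emeasure_fm_space [measurable]:
  fixes B :: "'x::topological_space set"
  assumes "B \<in> sets borel"
  shows "(\<lambda>\<mu>. emeasure \<mu> B) \<in> borel_measurable fm_space"
proof (rule measurableI)
  fix A :: "ennreal set" assume "A \<in> sets borel"
  moreover have "(\<lambda>\<mu>. emeasure \<mu> B) -` A \<inter> space fm_space = {\<mu>. sets \<mu> = sets borel \<and> emeasure \<mu> B \<in> A}"
    by (auto simp: space_fm_space)
  ultimately show "(\<lambda>\<mu>. emeasure \<mu> B) -` A \<inter> space fm_space \<in> sets fm_space"
    unfolding sets_fm_space using assms by auto
qed auto

lemma measurable_into_fm_space:
  fixes X :: "'w \<Rightarrow> 'x::topological_space measure"
  assumes "\<And>w. w \<in> space N \<Longrightarrow> sets (X w) = sets borel"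
    and "\<And>B. B \<in> sets borel \<Longrightarrow> (\<lambda>w. emeasure (X w) B) \<in> borel_measurable N"
  shows "X \<in> N \<rightarrow>\<^sub>M fm_space"
  unfolding fm_space_def
proof (rule measurable_measure_of)
  show "X \<in> space N \<rightarrow> {\<mu>. sets \<mu> = sets borel}"
    using assms(1) by auto
next
  fix D assume "D \<in> {{\<mu>. sets \<mu> = sets (borel :: 'x measure) \<and> emeasure \<mu> B \<in> A} | B A.
        B \<in> sets (borel :: 'x measure) \<and> A \<in> sets (borel :: ennreal measure)}"
  then obtain B A where D: "D = {\<mu>. sets \<mu> = sets (borel :: 'x measure) \<and> emeasure \<mu> B \<in> A}"
    and [measurable]: "B \<in> sets (borel :: 'x measure)" "A \<in> sets (borel :: ennreal measure)" by auto
  have "X -` D \<inter> space N = (\<lambda>w. emeasure (X w) B) -` A \<inter> space N"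
    using assms(1) by (auto simp: D)
  also have "\<dots> \<in> sets N"
    using assms(2)[of B] by measurable
  finally show "X -` D \<inter> space N \<in> sets N" .
qed auto

section \<open>Poisson random measures\<close>

text \<open>Multinomial probability of \<open>k i\<close> hits in cell \<open>i\<close> among
  \<open>n\<close> independent draws, the other draws falling into one further cell of probability
  \<open>q\<close>. The case distinction guards the truncated subtraction
  \<open>n - sum k I\<close>.\<close>

definition multinomial_weight :: "'i set \<Rightarrow> ('i \<Rightarrow> real) \<Rightarrow> real \<Rightarrow> nat \<Rightarrow> ('i \<Rightarrow> nat) \<Rightarrow> real" where
  "multinomial_weight I p q n k = (if sum k I \<le> n
     then fact n * (\<Prod>i\<in>I. p i ^ k i / fact (k i)) * q ^ (n - sum k I) / fact (n - sum k I) else 0)"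

text \<open>Conditioning on one draw. Each contribution is a multiple of \<open>?z\<close>: cell
  \<open>i\<close> gives \<open>k i\<close> copies, the further cell gives \<open>d\<close>, and for
  \<open>s \<le> Suc n\<close> these add up to \<open>Suc n\<close>, which turns
  \<open>fact n\<close> into \<open>fact (Suc n)\<close>.\<close>

lemma multinomial_weight_Suc:
  assumes I: "finite I"
  shows "multinomial_weight I p q (Suc n) k =
    (\<Sum>i\<in>I. if k i = 0 then 0 else p i * multinomial_weight I p q n (k(i := k i - 1)))
      + q * multinomial_weight I p q n k"
proof -
  let ?w = "multinomial_weight I p q"
  let ?k = "\<lambda>i. k(i := k i - 1)"
  let ?Q = "\<lambda>i. \<Prod>l\<in>I. p l ^ ?k i l / fact (?k i l)"
  define W where "W = (\<Prod>i\<in>I. p i ^ k i / fact (k i))"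
  define s where "s = sum k I"
  define d where "d = Suc n - s"
  let ?z = "fact n * W * q ^ d / fact d"
  have step: "(if k i = 0 then 0 else p i * ?w n (?k i))
      = (if s \<le> Suc n then real (k i) * ?z else 0)" if i: "i \<in> I" for i
  proof (cases "k i")
    case 0 then show ?thesis by simp
  next
    case (Suc j)
    have s1: "sum (?k i) I = s - 1" and sp: "s \<ge> 1"
    proof -
      have "sum k I = k i + sum k (I - {i})" using I i by (rule sum.remove)
      moreover have "sum (?k i) I = (k i - 1) + sum (?k i) (I - {i})"
        using I i by (subst sum.remove[of I i]) auto
      moreover have "sum (?k i) (I - {i}) = sum k (I - {i})"
        by (rule sum.cong) auto
      ultimately show "sum (?k i) I = s - 1" "s \<ge> 1"
        using Suc by (auto simp: s_def)
    qed
    have W1: "p i * ?Q i = real (k i) * W"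
    proof -
      have 1: "?Q i
          = p i ^ j / fact j * (\<Prod>l\<in>I - {i}. p l ^ k l / fact (k l))"
        using I i Suc by (subst prod.remove[of I i]) (auto intro!: prod.cong)
      have 2: "W = p i ^ Suc j / fact (Suc j) * (\<Prod>l\<in>I - {i}. p l ^ k l / fact (k l))"
        unfolding W_def using I i Suc by (subst prod.remove[of I i]) auto
      show ?thesis unfolding 1 2 using Suc by (simp add: field_simps del: of_nat_Suc)
    qed
    have le: "s - 1 \<le> n \<longleftrightarrow> s \<le> Suc n" and dd: "n - (s - 1) = d"
      using sp by (auto simp: d_def)
    have "p i * ?w n (?k i)
        = (if s \<le> Suc n then fact n * (p i * ?Q i) * q ^ d / fact d else 0)"
      unfolding multinomial_weight_def s1 le dd by simp
    also have "\<dots> = (if s \<le> Suc n then real (k i) * ?z else 0)"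
      unfolding W1 by simp
    finally show ?thesis using Suc by simp
  qed
  \<comment> \<open>In the borderline case \<open>s = Suc n\<close> the left side vanishes because
    \<open>s\<close> exceeds \<open>n\<close>, the right side because \<open>d = 0\<close>.\<close>
  have q: "q * ?w n k = (if s \<le> Suc n then real d * ?z else 0)"
  proof (cases "s \<le> n")
    case True
    then have "d = Suc (n - s)" by (auto simp: d_def)
    then show ?thesis using True
      unfolding multinomial_weight_def s_def[symmetric] W_def[symmetric]
      by (simp add: field_simps del: of_nat_Suc)
  next
    case False
    then show ?thesis
      unfolding multinomial_weight_def s_def[symmetric] by (auto simp: d_def)
  qed
  have "(\<Sum>i\<in>I. if k i = 0 then 0 else p i * ?w n (?k i))
     = (if s \<le> Suc n then real s * ?z else 0)"
    by (subst sum.cong[OF refl step]) (auto simp: s_def sum_distrib_right sum_divide_distrib)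
  moreover have "real s + real d = real (Suc n)" if "s \<le> Suc n"
    using that by (auto simp: d_def)
  then have "s \<le> Suc n \<Longrightarrow> real s * Z + real d * Z = real (Suc n) * Z" for Z
    by (metis distrib_right)
  moreover have "?w (Suc n) k
      = (if s \<le> Suc n then real (Suc n) * ?z else 0)"
    unfolding multinomial_weight_def s_def[symmetric] W_def[symmetric] d_def[symmetric]
    by (simp del: of_nat_Suc)
  ultimately show ?thesis
    unfolding q by (simp del: of_nat_Suc times_divide_eq_right)
qed

lemma measurable_count_below:
  assumes "B \<in> sets m"
  shows "(\<lambda>X. card {j. j < n \<and> X j \<in> B}) \<in> (\<Pi>\<^sub>M i\<in>(UNIV::nat set). m) \<rightarrow>\<^sub>M count_space UNIV"
proof -
  note [measurable] = assms
  have "(\<lambda>X. \<Sum>j<n. if X j \<in> B then 1 else 0 :: nat) \<in> (\<Pi>\<^sub>M i\<in>(UNIV::nat set). m) \<rightarrow>\<^sub>M count_space UNIV"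
    by measurable
  moreover have "(\<Sum>j<n. if X j \<in> B then 1 else 0 :: nat) = card {j. j < n \<and> X j \<in> B}" for X
    by (simp add: sum.If_cases Int_def)
  ultimately show ?thesis by (simp only:)
qed

text \<open>Induction on \<open>n\<close>. \<open>PiM_iter\<close> splits off the first coordinate,
  whose cell decides which count is lowered by one; integrating over it reproduces the recursion
  \<open>multinomial_weight_Suc\<close>.\<close>

lemma (in sequence_space) measure_counts_eq_multinomial:
  assumes I: "finite I" and B: "\<And>i. i \<in> I \<Longrightarrow> B i \<in> sets M" and disj: "disjoint_family_on B I"
  shows "measure S {X \<in> space S. \<forall>i\<in>I. card {j. j < n \<and> X j \<in> B i} = k i}
    = multinomial_weight I (\<lambda>i. measure M (B i)) (1 - (\<Sum>i\<in>I. measure M (B i))) n k"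
proof (induction n arbitrary: k)
  case 0
  have "sum k I = 0 \<longleftrightarrow> (\<forall>i\<in>I. k i = 0)" using I by simp
  moreover have "{X \<in> space S. \<forall>i\<in>I. (0::nat) = k i} = (if \<forall>i\<in>I. k i = 0 then space S else {})"
    by auto
  ultimately show ?case
    by (auto simp: multinomial_weight_def P.prob_space intro!: prod.neutral)
next
  case (Suc n)
  note [measurable] = B
  let ?E = "\<lambda>n k. {X \<in> space S. \<forall>i\<in>I. card {j. j < n \<and> X j \<in> B i} = k i}"
  have cm [measurable]: "(\<lambda>X. card {j. j < n \<and> X j \<in> B i}) \<in> S \<rightarrow>\<^sub>M count_space UNIV" if "i \<in> I" for i n
    by (rule measurable_count_below[OF B[OF that]])
  have E [measurable]: "?E n k \<in> sets S" for n k
    using I by measurable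
  \<comment> \<open>The further cell: a first coordinate in \<open>U\<close> leaves every required
    count unchanged.\<close>
  define U where "U = space M - (\<Union>i\<in>I. B i)"
  have [measurable]: "U \<in> sets M" unfolding U_def using I B by (intro sets.Diff sets.finite_UN) auto
  have cS: "card {j. j < Suc n \<and> case_nat x X j \<in> B i} = (if x \<in> B i then 1 else 0) + card {j. j < n \<and> X j \<in> B i}" for x X i
  proof -
    have "{j. j < Suc n \<and> case_nat x X j \<in> B i} = (if x \<in> B i then {0} else {}) \<union> Suc ` {j. j < n \<and> X j \<in> B i}"
    proof (rule set_eqI)
      fix j
      show "j \<in> {j. j < Suc n \<and> case_nat x X j \<in> B i} \<longleftrightarrow>
          j \<in> (if x \<in> B i then {0} else {}) \<union> Suc ` {j. j < n \<and> X j \<in> B i}"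
        by (cases j) auto
    qed
    then show ?thesis by (auto simp: card_insert_if card_image)
  qed
  let ?e = "\<lambda>i. if k i = 0 then 0 else measure S (?E n (k(i := k i - 1)))"
  let ?g = "\<lambda>x. \<Sum>i\<in>I. indicator (B i) x * ?e i"
  \<comment> \<open>By disjointness at most one summand of \<open>?g x\<close> survives. Hitting
    \<open>B i\<close> when \<open>k i = 0\<close> makes the section empty, hence the value 0 in
    \<open>?e\<close>.\<close>
  have slice: "measure S (Pair x -` ((\<lambda>(s, w). case_nat s w) -` ?E (Suc n) k \<inter> space (M \<Otimes>\<^sub>M S)))
      = ?g x + indicator U x * measure S (?E n k)" if x: "x \<in> space M" for x
  proof -
    have sl: "Pair x -` ((\<lambda>(s, w). case_nat s w) -` ?E (Suc n) k \<inter> space (M \<Otimes>\<^sub>M S))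
      = {X \<in> space S. \<forall>i\<in>I. (if x \<in> B i then 1 else 0) + card {j. j < n \<and> X j \<in> B i} = k i}"
      using x by (auto simp: space_pair_measure cS space_PiM PiE_iff split: nat.splits)
    show ?thesis
    proof (cases "\<exists>i\<in>I. x \<in> B i")
      case True
      then obtain i where i: "i \<in> I" "x \<in> B i" by auto
      have ni: "x \<notin> B l" if "l \<in> I" "l \<noteq> i" for l
        using disj that i by (auto simp: disjoint_family_on_def)
      have "?g x = indicator (B i) x * ?e i
          + (\<Sum>l\<in>I - {i}. indicator (B l) x * ?e l)"
        using I i(1) by (rule sum.remove)
      also have "(\<Sum>l\<in>I - {i}. indicator (B l) x * ?e l) = 0"
        using ni by (intro sum.neutral) auto
      finally have g: "?g x = ?e i"
        using i by simp
      have U: "indicator U x = (0::real)" using i by (auto simp: U_def indicator_def)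
      have eq: "{X \<in> space S. \<forall>l\<in>I. (if x \<in> B l then 1 else 0) + card {j. j < n \<and> X j \<in> B l} = k l}
        = (if k i = 0 then {} else ?E n (k(i := k i - 1)))"
      proof -
        have "(if x \<in> B l then 1 else 0) + f l = k l \<longleftrightarrow>
            (if l = i then k i \<noteq> 0 \<and> f l = k i - 1 else f l = k l)" if "l \<in> I" for l f
          using i ni[OF that] by (cases "l = i") auto
        then have "(\<forall>l\<in>I. (if x \<in> B l then 1 else 0) + f l = k l) \<longleftrightarrow>
            k i \<noteq> 0 \<and> (\<forall>l\<in>I. f l = (k(i := k i - 1)) l)" for f
          using i(1) by (auto split: if_splits)
        then show ?thesis by auto
      qed
      show ?thesis unfolding sl eq g U by simp
    next
      case False
      then have "indicator U x = (1::real)" "?g x = 0"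
        using x by (auto simp: U_def intro!: sum.neutral)
      moreover have "{X \<in> space S. \<forall>i\<in>I. (if x \<in> B i then 1 else 0) + card {j. j < n \<and> X j \<in> B i} = k i} = ?E n k"
        using False by auto
      ultimately show ?thesis unfolding sl by simp
    qed
  qed
  have gen: "(\<integral>\<^sup>+x. ennreal ((\<Sum>i\<in>I. indicator (B i) x * e i) + indicator U x * w) \<partial>M)
      = ennreal ((\<Sum>i\<in>I. measure M (B i) * e i) + measure M U * w)"
    if "\<And>i. 0 \<le> e i" "0 \<le> w" for e :: "'b \<Rightarrow> real" and w :: real
  proof -
    have int: "integrable M (\<lambda>x. indicator (B i) x * e i)" if "i \<in> I" for i
      using B[OF that] by (intro integrable_mult_left) (simp add: less_top[symmetric])
    have "integrable M (\<lambda>x. (\<Sum>i\<in>I. indicator (B i) x * e i) + indicator U x * w)"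
      by (intro Bochner_Integration.integrable_add Bochner_Integration.integrable_sum int integrable_mult_left) (simp_all add: less_top[symmetric])
    then have "(\<integral>\<^sup>+x. ennreal ((\<Sum>i\<in>I. indicator (B i) x * e i) + indicator U x * w) \<partial>M)
        = ennreal (\<integral>x. (\<Sum>i\<in>I. indicator (B i) x * e i) + indicator U x * w \<partial>M)"
      using that by (intro nn_integral_eq_integral AE_I2 add_nonneg_nonneg sum_nonneg) auto
    also have "(\<integral>x. (\<Sum>i\<in>I. indicator (B i) x * e i) + indicator U x * w \<partial>M)
        = (\<integral>x. (\<Sum>i\<in>I. indicator (B i) x * e i) \<partial>M) + (\<integral>x. indicator U x * w \<partial>M)"
      by (intro Bochner_Integration.integral_add Bochner_Integration.integrable_sum int integrable_mult_left) (simp_all add: less_top[symmetric])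
    also have "(\<integral>x. (\<Sum>i\<in>I. indicator (B i) x * e i) \<partial>M) = (\<Sum>i\<in>I. measure M (B i) * e i)"
      using B by (subst Bochner_Integration.integral_sum[OF int]) (auto intro!: sum.cong)
    finally show ?thesis by simp
  qed
  have "emeasure S (?E (Suc n) k) = emeasure (distr (M \<Otimes>\<^sub>M S) S (\<lambda>(s, w). case_nat s w)) (?E (Suc n) k)"
    unfolding PiM_iter ..
  also have "\<dots> = emeasure (M \<Otimes>\<^sub>M S) ((\<lambda>(s, w). case_nat s w) -` ?E (Suc n) k \<inter> space (M \<Otimes>\<^sub>M S))"
    by (rule emeasure_distr) measurable
  also have "\<dots> = (\<integral>\<^sup>+x. emeasure S (Pair x -` ((\<lambda>(s, w). case_nat s w) -` ?E (Suc n) k \<inter> space (M \<Otimes>\<^sub>M S))) \<partial>M)"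
    by (rule P.emeasure_pair_measure_alt) measurable
  also have "\<dots> = (\<integral>\<^sup>+x. ennreal (?g x + indicator U x * measure S (?E n k)) \<partial>M)"
    by (intro nn_integral_cong) (simp only: P.emeasure_eq_measure slice)
  also have "\<dots> = ennreal ((\<Sum>i\<in>I. measure M (B i) * ?e i) + measure M U * measure S (?E n k))"
    by (rule gen) auto
  also have "measure M U = 1 - (\<Sum>i\<in>I. measure M (B i))"
    unfolding U_def using I B disj
    by (subst M.finite_measure_compl) (auto simp: M.prob_space intro!: M.finite_measure_finite_Union)
  finally have eq: "emeasure S (?E (Suc n) k) = ennreal ((\<Sum>i\<in>I. measure M (B i) * ?e i)
     + (1 - (\<Sum>i\<in>I. measure M (B i))) * measure S (?E n k))" .
  have "(\<Sum>i\<in>I. measure M (B i)) = measure M (\<Union>i\<in>I. B i)"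
    using I B disj by (intro M.finite_measure_finite_Union[symmetric]) auto
  then have "(\<Sum>i\<in>I. measure M (B i)) \<le> 1" by simp
  with eq have "measure S (?E (Suc n) k) = (\<Sum>i\<in>I. measure M (B i) * ?e i)
     + (1 - (\<Sum>i\<in>I. measure M (B i))) * measure S (?E n k)"
    by (intro measure_eq_emeasure_eq_ennreal add_nonneg_nonneg sum_nonneg mult_nonneg_nonneg) auto
  also have "\<dots> = multinomial_weight I (\<lambda>i. measure M (B i)) (1 - (\<Sum>i\<in>I. measure M (B i))) (Suc n) k"
    unfolding multinomial_weight_Suc[OF I] Suc.IH
    by (intro arg_cong2[where f="(+)"] sum.cong) auto
  finally show ?case .
qed

text \<open>One formula covers the degenerate case \<open>t = 0\<close> as well, because
  \<open>0 ^ 0 = 1\<close>.\<close>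

lemma pmf_poi: "0 \<le> t \<Longrightarrow> pmf (poi t) n = t ^ n / fact n * exp (- t)"
  by (auto simp: poi_def power_0_left)

text \<open>Poisson splitting. Terms with \<open>n < s\<close> vanish; after a shift by
  \<open>s\<close> the rest is the exponential series of \<open>t * q\<close>, and the exponential
  of \<open>t * q - t\<close> factors over \<open>I\<close>.\<close>

lemma poisson_mixture_multinomial_sums:
  assumes I: "finite I" and t: "0 \<le> t"
  shows "(\<lambda>n. pmf (poi t) n * multinomial_weight I p (1 - sum p I) n k)
    sums (\<Prod>i\<in>I. (t * p i) ^ k i / fact (k i) * exp (- (t * p i)))"
proof -
  define s where "s = sum k I"
  define q where "q = 1 - sum p I"
  define W where "W = (\<Prod>i\<in>I. p i ^ k i / fact (k i))"
  have "(\<lambda>n. (t * q) ^ n / fact n) sums exp (t * q)"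
    using exp_converges[of "t * q"] by (simp add: field_simps)
  then have "(\<lambda>n. exp (- t) * t ^ s * W * ((t * q) ^ n / fact n)) sums (exp (- t) * t ^ s * W * exp (t * q))"
    by (rule sums_mult)
  moreover have "pmf (poi t) (n + s) * multinomial_weight I p q (n + s) k
      = exp (- t) * t ^ s * W * ((t * q) ^ n / fact n)" for n
    unfolding multinomial_weight_def s_def[symmetric] W_def[symmetric]
    using t by (simp add: pmf_poi power_add field_simps)
  ultimately have "(\<lambda>n. pmf (poi t) (n + s) * multinomial_weight I p q (n + s) k)
      sums (exp (- t) * t ^ s * W * exp (t * q))" by simp
  moreover have "pmf (poi t) n * multinomial_weight I p q n k = 0" if "n < s" for n
    using that by (simp add: multinomial_weight_def s_def)
  ultimately have "(\<lambda>n. pmf (poi t) n * multinomial_weight I p q n k) sums (exp (- t) * t ^ s * W * exp (t * q))"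
    by (subst (asm) sums_zero_iff_shift) auto
  moreover have "exp (- t) * t ^ s * W * exp (t * q) = (\<Prod>i\<in>I. (t * p i) ^ k i / fact (k i) * exp (- (t * p i)))"
  proof -
    have "(\<Prod>i\<in>I. (t * p i) ^ k i / fact (k i) * exp (- (t * p i)))
       = (\<Prod>i\<in>I. t ^ k i) * W * (\<Prod>i\<in>I. exp (- (t * p i)))"
      unfolding W_def prod.distrib[symmetric] by (intro prod.cong) (auto simp: power_mult_distrib)
    also have "(\<Prod>i\<in>I. t ^ k i) = t ^ s" unfolding s_def by (rule power_sum[symmetric])
    also have "(\<Prod>i\<in>I. exp (- (t * p i))) = exp (- t) * exp (t * q)"
      using I unfolding exp_sum[symmetric, OF I] exp_add[symmetric] q_def
      by (simp add: sum_negf sum_distrib_left algebra_simps)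
    finally show ?thesis by simp
  qed
  ultimately show ?thesis unfolding q_def by simp
qed

text \<open>The sum of the Dirac measures at \<open>X 0, ..., X (n - 1)\<close>, with multiplicity.
  As an image of counting measure it is a measure without further proof.\<close>

definition point_measure_upto :: "nat \<Rightarrow> (nat \<Rightarrow> 'x::topological_space) \<Rightarrow> 'x measure" where
  "point_measure_upto n X = distr (count_space {..<n}) borel X"

lemma sets_point_measure_upto [simp]: "sets (point_measure_upto n X) = sets borel"
  by (simp add: point_measure_upto_def)

lemma emeasure_point_measure_upto:
  "B \<in> sets borel \<Longrightarrow> emeasure (point_measure_upto n X) B = of_nat (card {j. j < n \<and> X j \<in> B})"
proof -
  assume "B \<in> sets borel"
  then have "emeasure (point_measure_upto n X) B = emeasure (count_space {..<n}) (X -` B \<inter> {..<n})"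
    unfolding point_measure_upto_def by (subst emeasure_distr) auto
  also have "X -` B \<inter> {..<n} = {j. j < n \<and> X j \<in> B}" by auto
  also have "emeasure (count_space {..<n}) \<dots> = of_nat (card {j. j < n \<and> X j \<in> B})"
    by (subst emeasure_count_space_finite) auto
  finally show ?thesis .
qed

text \<open>Sample space of the mixed binomial process. An infinite sequence of locations is drawn,
  of which the first \<open>fst w\<close> are used, so that number and locations sit on a plain
  product.\<close>

definition mixed_binomial :: "real \<Rightarrow> 'x measure \<Rightarrow> (nat \<times> (nat \<Rightarrow> 'x)) measure" where
  "mixed_binomial t m = measure_pmf (poi t) \<Otimes>\<^sub>M (\<Pi>\<^sub>M i\<in>(UNIV::nat set). m)"

lemma prob_space_mixed_binomial: "prob_space m \<Longrightarrow> prob_space (mixed_binomial t m)"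
  unfolding mixed_binomial_def by (intro prob_space_pair prob_space_PiM prob_space_measure_pmf)

lemma measurable_count_upto:
  assumes "B \<in> sets m"
  shows "(\<lambda>w. card {j. j < fst w \<and> snd w j \<in> B}) \<in> mixed_binomial t m \<rightarrow>\<^sub>M count_space UNIV"
proof -
  show ?thesis
    unfolding mixed_binomial_def
    by (intro measurable_compose_countable[where f="\<lambda>n w. card {j. j < n \<and> snd w j \<in> B}" and g=fst]
        measurable_compose[OF measurable_snd] measurable_count_below assms) auto
qed

lemma measurable_point_measure_upto:
  assumes "sets m = sets (borel :: 'x::topological_space measure)"
  shows "(\<lambda>w. point_measure_upto (fst w) (snd w)) \<in> mixed_binomial t m \<rightarrow>\<^sub>M fm_space"
proof (rule measurable_into_fm_space)
  fix B :: "'x set" assume B: "B \<in> sets borel"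
  then have [measurable]: "B \<in> sets m" using assms by simp
  have "(\<lambda>w. of_nat (card {j. j < fst w \<and> snd w j \<in> B}) :: ennreal) \<in> borel_measurable (mixed_binomial t m)"
    by (rule measurable_compose[OF measurable_count_upto]) auto
  then show "(\<lambda>w. emeasure (point_measure_upto (fst w) (snd w)) B) \<in> borel_measurable (mixed_binomial t m)"
    unfolding emeasure_point_measure_upto[OF B] .
qed auto

text \<open>Fubini over the number of points reduces this to a Poisson mixture of multinomial
  weights. The product form holds both defining properties of a Poisson random measure: the marginal
  law (one index) and independence on disjoint sets.\<close>

lemma measure_mixed_binomial_counts:
  assumes m: "prob_space m" and t: "0 \<le> t"
    and I: "finite I" and B: "\<And>i. i \<in> I \<Longrightarrow> B i \<in> sets m" and disj: "disjoint_family_on B I"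
  shows "measure (mixed_binomial t m) {w \<in> space (mixed_binomial t m). \<forall>i\<in>I. card {j. j < fst w \<and> snd w j \<in> B i} = k i}
    = (\<Prod>i\<in>I. pmf (poi (t * measure m (B i))) (k i))"
proof -
  let ?mb = "mixed_binomial t m"
  interpret prob_space m by fact
  interpret sequence_space m ..
  interpret mb: prob_space ?mb by (rule prob_space_mixed_binomial) fact
  let ?E = "{w \<in> space ?mb. \<forall>i\<in>I. card {j. j < fst w \<and> snd w j \<in> B i} = k i}"
  let ?w = "\<lambda>n. multinomial_weight I (\<lambda>i. measure m (B i)) (1 - (\<Sum>i\<in>I. measure m (B i))) n k"
  have E: "?E \<in> sets ?mb"
  proof (rule sets.sets_Collect_finite_All[OF _ I])
    fix i assume "i \<in> I"
    from measurable_sets[OF measurable_count_upto[OF B[OF this], of t], of "{k i}"]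
    show "{w \<in> space ?mb. card {j. j < fst w \<and> snd w j \<in> B i} = k i} \<in> sets ?mb"
      by (simp add: vimage_def Int_def conj_commute)
  qed
  have w0: "0 \<le> ?w n" for n
    by (rule order_trans[OF measure_nonneg eq_refl[OF measure_counts_eq_multinomial[OF I B disj]]])
  have "emeasure ?mb ?E = (\<integral>\<^sup>+n. emeasure S (Pair n -` ?E) \<partial>measure_pmf (poi t))"
    using E unfolding mixed_binomial_def by (rule P.emeasure_pair_measure_alt)
  also have "\<dots> = (\<integral>\<^sup>+n. ennreal (?w n) \<partial>measure_pmf (poi t))"
  proof (intro nn_integral_cong)
    fix n
    have "Pair n -` ?E = {X \<in> space S. \<forall>i\<in>I. card {j. j < n \<and> X j \<in> B i} = k i}"
      by (auto simp: mixed_binomial_def space_pair_measure)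
    then show "emeasure S (Pair n -` ?E) = ennreal (?w n)"
      by (simp add: P.emeasure_eq_measure measure_counts_eq_multinomial[OF I B disj])
  qed
  also have "\<dots> = (\<Sum>n. ennreal (pmf (poi t) n * ?w n))"
    by (simp add: nn_integral_measure_pmf nn_integral_count_space_nat ennreal_mult w0)
  also have "\<dots> = ennreal (\<Prod>i\<in>I. (t * measure m (B i)) ^ k i / fact (k i) * exp (- (t * measure m (B i))))"
    using poisson_mixture_multinomial_sums[OF I t, of "\<lambda>i. measure m (B i)" k] w0
    by (intro suminf_ennreal_eq) auto
  finally have "measure ?mb ?E = (\<Prod>i\<in>I. (t * measure m (B i)) ^ k i / fact (k i) * exp (- (t * measure m (B i))))"
    using t by (simp add: mb.emeasure_eq_measure prod_nonneg)
  then show ?thesis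
    using t by (simp add: pmf_poi)
qed

definition poisson_points :: "real \<Rightarrow> 'x::topological_space measure \<Rightarrow> 'x measure measure" where
  "poisson_points t m = distr (mixed_binomial t m) fm_space (\<lambda>w. point_measure_upto (fst w) (snd w))"

text \<open>Existence of the Poisson law. Marginals and independence are proved for the integer
  counts on the sample space and then carried to \<open>emeasure\<close>, which takes the same
  values in \<open>ennreal\<close>.\<close>

lemma is_poisson_law_poisson_points:
  fixes m :: "'x::topological_space measure"
  assumes m: "prob_space m" and ms: "sets m = sets borel" and t: "0 \<le> t"
    and lam: "\<And>B. B \<in> sets borel \<Longrightarrow> lam B = t * measure m B"
  shows "is_poisson_law lam (poisson_points t m)"
proof -
  let ?mb = "mixed_binomial t m"
  interpret mb: prob_space "?mb" by (rule prob_space_mixed_binomial) fact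
  note [measurable] = measurable_point_measure_upto[OF ms, of t]
  interpret Q: prob_space "poisson_points t m"
    unfolding poisson_points_def by (rule mb.prob_space_distr[OF measurable_point_measure_upto[OF ms]])
  let ?C = "\<lambda>B w. card {j. j < fst w \<and> snd w j \<in> B}"
  let ?N = "\<lambda>B w. of_nat (?C B w) :: ennreal"
  let ?D = "\<lambda>B. distr ?mb (count_space UNIV) (?C B)"
  have eval: "distr (poisson_points t m) borel (\<lambda>\<mu>. emeasure \<mu> B) = distr ?mb borel (\<lambda>w. of_nat (?C B w))"
    if "B \<in> sets borel" for B
    unfolding poisson_points_def using that
    by (subst distr_distr) (auto intro!: distr_cong simp: emeasure_point_measure_upto)
  have C [measurable]: "?C B \<in> ?mb \<rightarrow>\<^sub>M count_space UNIV" if "B \<in> sets borel" for B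
    using that ms by (intro measurable_count_upto) auto
  \<comment> \<open>The joint count formula for the one-element family indexed by 0.\<close>
  have distrC: "?D B = measure_pmf (poi (lam B))" if B: "B \<in> sets borel" for B
  proof (rule measure_eqI_countable[where A=UNIV])
    fix a :: nat
    have "measure ?mb {w \<in> space ?mb. \<forall>i\<in>{0::nat}. ?C ((\<lambda>_. B) i) w = (\<lambda>_. a) i}
        = (\<Prod>i\<in>{0::nat}. pmf (poi (t * measure m ((\<lambda>_. B) i))) ((\<lambda>_. a) i))"
      using B ms by (intro measure_mixed_binomial_counts m t) (auto simp: disjoint_family_on_def)
    then have "measure ?mb {w \<in> space ?mb. ?C B w = a} = pmf (poi (lam B)) a"
      using B by (simp add: lam)
    moreover have "?C B -` {a} \<inter> space ?mb = {w \<in> space ?mb. ?C B w = a}" by auto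
    ultimately show "emeasure (?D B) {a} = emeasure (measure_pmf (poi (lam B))) {a}"
      using B by (simp add: emeasure_distr mb.emeasure_eq_measure emeasure_pmf_single)
  qed auto
  have indep: "Q.indep_vars (\<lambda>_. borel) (\<lambda>i \<mu>. emeasure \<mu> (B i)) I"
    if I: "finite I" and B: "\<forall>i\<in>I. B i \<in> sets borel" and disj: "disjoint_family_on B I" for I :: "nat set" and B
  proof (cases "I = {}")
    case True
    then show ?thesis by (simp add: Q.indep_vars_def Q.indep_sets_def)
  next
    case False
    \<comment> \<open>Count vectors over the finite set \<open>I\<close> form a countable space, so
      both laws need comparing at single points alone.\<close>
    have joint: "distr ?mb (\<Pi>\<^sub>M i\<in>I. count_space UNIV) (\<lambda>w. \<lambda>i\<in>I. ?C (B i) w)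
       = (\<Pi>\<^sub>M i\<in>I. ?D (B i))" (is "?L = ?R")
    proof (rule measure_eqI_countable')
      have sR: "sets ?R = sets (\<Pi>\<^sub>M i\<in>I. count_space (UNIV::nat set))" by (intro sets_PiM_cong) auto
      show "space ?L = (\<Pi>\<^sub>E i\<in>I. UNIV)" "space ?R = (\<Pi>\<^sub>E i\<in>I. UNIV)" by (auto simp: space_PiM)
      show "countable (\<Pi>\<^sub>E i\<in>I. (UNIV::nat set))" using I by (intro countable_PiE) auto
      show s: "{x} \<in> sets ?L" if "x \<in> (\<Pi>\<^sub>E i\<in>I. UNIV)" for x
        using that I by (simp add: count_space_PiM_finite)
      show "{x} \<in> sets ?R" if "x \<in> (\<Pi>\<^sub>E i\<in>I. UNIV)" for x
        using s[OF that] sR by simp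
      fix k :: "nat \<Rightarrow> nat" assume k: "k \<in> (\<Pi>\<^sub>E i\<in>I. UNIV)"
      have meas: "(\<lambda>w. \<lambda>i\<in>I. ?C (B i) w) \<in> ?mb \<rightarrow>\<^sub>M (\<Pi>\<^sub>M i\<in>I. count_space UNIV)"
        using B by (intro measurable_restrict C) auto
      have "(\<lambda>w. \<lambda>i\<in>I. ?C (B i) w) -` {k} \<inter> space ?mb
          = {w \<in> space ?mb. \<forall>i\<in>I. ?C (B i) w = k i}"
        using k by (auto simp: PiE_iff extensional_def fun_eq_iff restrict_def)
      then have "emeasure ?L {k} = ennreal (\<Prod>i\<in>I. pmf (poi (lam (B i))) (k i))"
        using s[OF k] B ms measure_mixed_binomial_counts[OF m t I _ disj, of k]
        by (simp add: emeasure_distr[OF meas] mb.emeasure_eq_measure lam)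
      also have "\<dots> = (\<Prod>i\<in>I. emeasure (measure_pmf (poi (lam (B i)))) {k i})"
        by (simp add: emeasure_pmf_single prod_ennreal)
      also have "\<dots> = (\<Prod>i\<in>I. emeasure (?D (B i)) {k i})"
        using B by (intro prod.cong) (auto simp: distrC)
      also have "\<dots> = emeasure ?R (\<Pi>\<^sub>E i\<in>I. {k i})"
      proof -
        \<comment> \<open>Outside \<open>I\<close> a point mass is filled in:
          \<open>product_prob_space\<close> asks for a probability measure at every index, while
          \<open>B i\<close> is known to be measurable for \<open>i\<close> in
          \<open>I\<close>.\<close>
        define DD where "DD = (\<lambda>i. if i \<in> I then ?D (B i) else return (count_space UNIV) 0)"
        interpret D: product_prob_space DD UNIV
          unfolding DD_def product_prob_space_def product_prob_space_axioms_def product_sigma_finite_def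
          using B by (auto intro!: mb.prob_space_distr C prob_space_imp_sigma_finite prob_space_return)
        have "?R = PiM I DD" by (intro PiM_cong) (auto simp: DD_def)
        moreover have "emeasure (PiM I DD) (\<Pi>\<^sub>E i\<in>I. {k i}) = (\<Prod>i\<in>I. emeasure (DD i) {k i})"
          using I by (intro D.emeasure_PiM) (auto simp: DD_def)
        moreover have "\<dots> = (\<Prod>i\<in>I. emeasure (?D (B i)) {k i})"
          by (intro prod.cong) (simp_all add: DD_def)
        ultimately show ?thesis by (simp only:)
      qed
      also have "(\<Pi>\<^sub>E i\<in>I. {k i}) = {k}"
        using k by (intro PiE_singleton) (auto simp: PiE_iff)
      finally show "emeasure ?L {k} = emeasure ?R {k}" .
    qed
    have "mb.indep_vars (\<lambda>_. count_space UNIV) (\<lambda>i. ?C (B i)) I"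
      using B by (subst mb.indep_vars_iff_distr_eq_PiM'[OF False]) (auto intro!: C joint)
    then have ind: "mb.indep_vars (\<lambda>_. borel) (\<lambda>i w. ?N (B i) w) I"
      by (rule mb.indep_vars_compose2) auto
    have mC: "(\<lambda>w. ?N (B i) w) \<in> borel_measurable ?mb" if "i \<in> I" for i
      using B that by (intro measurable_compose[OF C, where g=of_nat]) auto
    have *: "distr ?mb (\<Pi>\<^sub>M i\<in>I. borel) (\<lambda>w. \<lambda>i\<in>I. ?N (B i) w)
       = (\<Pi>\<^sub>M i\<in>I. distr ?mb borel (\<lambda>w. ?N (B i) w))"
      by (rule iffD1[OF mb.indep_vars_iff_distr_eq_PiM'[OF False] ind], rule mC)
    have mf: "(\<lambda>\<mu>. emeasure \<mu> (B i)) \<in> borel_measurable (poisson_points t m)" if "i \<in> I" for i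
      using B that unfolding poisson_points_def by auto
    show ?thesis
    proof (subst Q.indep_vars_iff_distr_eq_PiM'[OF False mf], assumption)
      have "distr (poisson_points t m) (\<Pi>\<^sub>M i\<in>I. borel) (\<lambda>\<mu>. \<lambda>i\<in>I. emeasure \<mu> (B i))
        = distr ?mb (\<Pi>\<^sub>M i\<in>I. borel) (\<lambda>w. \<lambda>i\<in>I. ?N (B i) w)"
        unfolding poisson_points_def
      proof (subst distr_distr[OF _ measurable_point_measure_upto[OF ms]])
        show "(\<lambda>\<mu>. \<lambda>i\<in>I. emeasure \<mu> (B i)) \<in> fm_space \<rightarrow>\<^sub>M (\<Pi>\<^sub>M i\<in>I. borel)"
          by (rule measurable_restrict) (use B in simp)
      qed (rule distr_cong[OF refl refl], use B in \<open>auto simp: fun_eq_iff restrict_def emeasure_point_measure_upto\<close>)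
      also have "\<dots> = (\<Pi>\<^sub>M i\<in>I. distr ?mb borel (\<lambda>w. ?N (B i) w))"
        by (rule *)
      also have "\<dots> = (\<Pi>\<^sub>M i\<in>I. distr (poisson_points t m) borel (\<lambda>\<mu>. emeasure \<mu> (B i)))"
        using B by (intro PiM_cong) (auto simp: eval)
      finally show "distr (poisson_points t m) (\<Pi>\<^sub>M i\<in>I. borel) (\<lambda>\<mu>. \<lambda>i\<in>I. emeasure \<mu> (B i))
         = (\<Pi>\<^sub>M i\<in>I. distr (poisson_points t m) borel (\<lambda>\<mu>. emeasure \<mu> (B i)))" .
    qed
  qed
  show ?thesis
    unfolding is_poisson_law_def
  proof (intro conjI ballI allI impI)
    show "prob_space (poisson_points t m)" by (rule Q.prob_space_axioms)
    show "sets (poisson_points t m) = sets fm_space" by (simp add: poisson_points_def)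
    show "distr (poisson_points t m) borel (\<lambda>\<mu>. emeasure \<mu> B) = distr (measure_pmf (poi (lam B))) borel of_nat"
      if B: "B \<in> sets borel" for B
    proof -
      have "distr (measure_pmf (poi (lam B))) borel (of_nat :: nat \<Rightarrow> ennreal)
        = distr (?D B) borel of_nat"
        using distrC[OF B] by simp
      also have "\<dots> = distr ?mb borel (\<lambda>w. of_nat (?C B w))"
        using B by (subst distr_distr) (auto simp: comp_def)
      finally show ?thesis using eval[OF B] by simp
    qed
  qed (rule indep)
qed

text \<open>Cylinders given by finitely many conditions on values at Borel sets form an
  intersection-stable generator. Sets in a cylinder may overlap, so their values are written as sums
  over the disjoint atoms of the finite algebra they generate; on those atoms the law is a product
  of Poisson laws determined by \<open>lam\<close>.\<close>

lemma is_poisson_law_unique: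
  fixes Q Q' :: "'x::topological_space measure measure"
  assumes Q: "is_poisson_law lam Q" and Q': "is_poisson_law lam Q'"
  shows "Q = Q'"
proof -
  let ?S = "space (fm_space :: 'x measure measure)"
  define cyl where "cyl C = {\<mu> \<in> ?S. \<forall>(B, A)\<in>C. emeasure \<mu> B \<in> A}" for C
  define E where "E = cyl ` {C. finite C \<and> C \<subseteq> sets borel \<times> sets borel}"
  have cyl_eq: "emeasure Q (cyl C) = emeasure Q' (cyl C)"
    if C: "finite C" "C \<subseteq> sets borel \<times> sets borel" for C
  proof -
    define F where "F = fst ` C"
    have F: "finite F" "\<And>B. B \<in> F \<Longrightarrow> B \<in> sets borel" using C by (auto simp: F_def)
    \<comment> \<open>Subsets of \<open>F\<close> are numbered by naturals because
      \<open>is_poisson_law\<close> states independence for families indexed by \<open>nat\<close>.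
      The empty subset of \<open>F\<close> keeps \<open>I\<close> nonempty.\<close>
    define I where "I = {0..<card (Pow F)}"
    obtain e where e: "bij_betw e I (Pow F)"
      using ex_bij_betw_nat_finite[of "Pow F"] F unfolding I_def by auto
    have I: "finite I" "I \<noteq> {}" using F by (auto simp: I_def card_gt_0_iff)
    \<comment> \<open>Atom of the finite algebra generated by \<open>F\<close>: the points lying in
      exactly the members of \<open>e i\<close>.\<close>
    define D where "D i = {x. \<forall>B\<in>F. x \<in> B \<longleftrightarrow> B \<in> e i}" for i
    have D: "D i \<in> sets borel" for i
    proof -
      have "{x \<in> space (borel :: 'x measure). x \<in> B \<longleftrightarrow> B \<in> e i} \<in> sets borel" if "B \<in> F" for B
        using F(2)[OF that] by (cases "B \<in> e i") auto
      then have "{x \<in> space (borel :: 'x measure). \<forall>B\<in>F. x \<in> B \<longleftrightarrow> B \<in> e i} \<in> sets borel"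
        using F(1) by (rule sets.sets_Collect_finite_All)
      then show ?thesis by (simp add: D_def)
    qed
    have disj: "disjoint_family_on D I"
      unfolding disjoint_family_on_def
    proof safe
      fix i j x assume ij: "i \<in> I" "j \<in> I" "i \<noteq> j" "x \<in> D i" "x \<in> D j"
      then have "e i \<subseteq> F" "e j \<subseteq> F" using e by (auto simp: bij_betw_def)
      then have "e i = e j" using ij by (auto simp: D_def)
      then show "x \<in> {}" using ij e by (auto simp: bij_betw_def inj_on_def)
    qed
    have B_eq: "emeasure \<mu> B = (\<Sum>i\<in>{i\<in>I. B \<in> e i}. emeasure \<mu> (D i))" if "\<mu> \<in> ?S" "B \<in> F" for \<mu> B
    proof -
      have "B = (\<Union>i\<in>{i\<in>I. B \<in> e i}. D i)"
      proof safe
        fix x assume "x \<in> B"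
        then obtain i where "i \<in> I" "e i = {B\<in>F. x \<in> B}"
          using e unfolding bij_betw_def by (metis (no_types, lifting) Pow_iff imageE mem_Collect_eq subsetI)
        then show "x \<in> (\<Union>i\<in>{i\<in>I. B \<in> e i}. D i)" using \<open>x \<in> B\<close> \<open>B \<in> F\<close> by (auto simp: D_def)
      qed (use \<open>B \<in> F\<close> in \<open>auto simp: D_def\<close>)
      moreover have "(\<Sum>i\<in>{i\<in>I. B \<in> e i}. emeasure \<mu> (D i)) = emeasure \<mu> (\<Union>i\<in>{i\<in>I. B \<in> e i}. D i)"
        using I D that disj by (intro sum_emeasure) (auto simp: space_fm_space disjoint_family_on_def)
      ultimately show ?thesis by simp
    qed
    define T where "T \<mu> = (\<lambda>i\<in>I. emeasure \<mu> (D i))" for \<mu> :: "'x measure"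
    \<comment> \<open>The cylinder expressed in the coordinates of the atoms: each condition on a
      set becomes a condition on the sum over the atoms it contains.\<close>
    define Y where "Y = {y \<in> space (\<Pi>\<^sub>M i\<in>I. borel :: ennreal measure). \<forall>p\<in>C. (\<Sum>i\<in>{i\<in>I. fst p \<in> e i}. y i) \<in> snd p}"
    have Y: "Y \<in> sets (\<Pi>\<^sub>M i\<in>I. borel)"
      unfolding Y_def
    proof (rule sets.sets_Collect_finite_All[OF _ C(1)])
      fix p assume "p \<in> C"
      then have [measurable]: "snd p \<in> sets borel" using C by auto
      show "{y \<in> space (\<Pi>\<^sub>M i\<in>I. borel :: ennreal measure). (\<Sum>i\<in>{i\<in>I. fst p \<in> e i}. y i) \<in> snd p} \<in> sets (\<Pi>\<^sub>M i\<in>I. borel)"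
        by measurable
    qed
    let ?R = "\<Pi>\<^sub>M i\<in>I. distr (measure_pmf (poi (lam (D i)))) borel (of_nat :: nat \<Rightarrow> ennreal)"
    have val: "emeasure R (cyl C) = emeasure ?R Y"
      if R: "is_poisson_law lam R" for R
    proof -
      interpret R: prob_space R using R by (simp add: is_poisson_law_def)
      have sR: "sets R = sets fm_space" using R by (simp add: is_poisson_law_def)
      have rv: "(\<lambda>\<mu>. emeasure \<mu> (D i)) \<in> borel_measurable R" for i
        unfolding measurable_cong_sets[OF sR refl] using D by measurable
      have T: "T \<in> R \<rightarrow>\<^sub>M (\<Pi>\<^sub>M i\<in>I. borel)"
        unfolding T_def by (rule measurable_restrict) (rule rv)
      have "R.indep_vars (\<lambda>_. borel) (\<lambda>i \<mu>. emeasure \<mu> (D i)) I"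
        using R I D disj unfolding is_poisson_law_def by blast
      then have "distr R (\<Pi>\<^sub>M i\<in>I. borel) T = (\<Pi>\<^sub>M i\<in>I. distr R borel (\<lambda>\<mu>. emeasure \<mu> (D i)))"
        unfolding T_def by (subst (asm) R.indep_vars_iff_distr_eq_PiM[OF I(2) rv])
      also have "\<dots> = (\<Pi>\<^sub>M i\<in>I. distr (measure_pmf (poi (lam (D i)))) borel of_nat)"
        using R D by (intro PiM_cong) (auto simp: is_poisson_law_def)
      finally have "emeasure ?R Y
          = emeasure (distr R (\<Pi>\<^sub>M i\<in>I. borel) T) Y" by simp
      also have "\<dots> = emeasure R (T -` Y \<inter> space R)"
        using T Y by (rule emeasure_distr)
      also have "T -` Y \<inter> space R = cyl C"
      proof -
        have "T \<mu> \<in> Y \<longleftrightarrow> (\<forall>(B, A)\<in>C. emeasure \<mu> B \<in> A)" if "\<mu> \<in> ?S" for \<mu>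
        proof -
          have "(\<Sum>i\<in>{i\<in>I. fst p \<in> e i}. T \<mu> i) = emeasure \<mu> (fst p)" if "p \<in> C" for p
            using B_eq[OF \<open>\<mu> \<in> ?S\<close>, of "fst p"] that by (auto simp: F_def T_def intro!: sum.cong)
          then show ?thesis unfolding Y_def by (auto simp: T_def space_PiM)
        qed
        then show ?thesis unfolding cyl_def sets_eq_imp_space_eq[OF sR] by auto
      qed
      finally show ?thesis by simp
    qed
    show ?thesis using val[OF Q] val[OF Q'] by simp
  qed
  have sQ: "sets R = sigma_sets ?S E" if "is_poisson_law lam R" for R
  proof -
    have "sets R = sets fm_space" using that by (simp add: is_poisson_law_def)
    also have "\<dots> = sigma_sets ?S E"
    proof (rule antisym)
      show "sets fm_space \<subseteq> sigma_sets ?S E"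
        unfolding sets_fm_space space_fm_space
      proof (rule sigma_sets_mono, safe)
        fix B :: "'x set" and A :: "ennreal set" assume "B \<in> sets borel" "A \<in> sets borel"
        then have "cyl {(B, A)} \<in> E" by (auto simp: E_def)
        moreover have "cyl {(B, A)} = {\<mu>. sets \<mu> = sets (borel :: 'x measure) \<and> emeasure \<mu> B \<in> A}"
          by (auto simp: cyl_def space_fm_space)
        ultimately show "{\<mu>. sets \<mu> = sets (borel :: 'x measure) \<and> emeasure \<mu> B \<in> A} \<in> sigma_sets {\<mu>. sets \<mu> = sets borel} E"
          by auto
      qed
      have "cyl C \<in> sets fm_space" if C: "finite C" "C \<subseteq> sets borel \<times> sets borel" for C
        unfolding cyl_def
      proof (rule sets.sets_Collect_finite_All[OF _ C(1)], clarify)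
        fix B A assume "(B, A) \<in> C"
        then have [measurable]: "B \<in> sets borel" "A \<in> sets borel" using C by auto
        show "{\<mu> \<in> ?S. emeasure \<mu> B \<in> A} \<in> sets fm_space" by measurable
      qed
      then show "sigma_sets ?S E \<subseteq> sets fm_space"
        by (intro sets.sigma_sets_subset) (auto simp: E_def)
    qed
    finally show ?thesis .
  qed
  show "Q = Q'"
  proof (rule measure_eqI_generator_eq[where E=E and \<Omega>="?S" and A="\<lambda>_. cyl {}"])
    show "Int_stable E"
      unfolding Int_stable_def
    proof safe
      fix X Y assume "X \<in> E" "Y \<in> E"
      then obtain C C' where "X = cyl C" "Y = cyl C'" "finite C" "finite C'" "C \<subseteq> sets borel \<times> sets borel" "C' \<subseteq> sets borel \<times> sets borel"
        by (auto simp: E_def)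
      then have "X \<inter> Y = cyl (C \<union> C')" "finite (C \<union> C')" "C \<union> C' \<subseteq> sets borel \<times> sets borel"
        by (auto simp: cyl_def)
      then show "X \<inter> Y \<in> E" by (auto simp: E_def)
    qed
    show "E \<subseteq> Pow ?S" by (auto simp: E_def cyl_def)
    show "emeasure Q X = emeasure Q' X" if "X \<in> E" for X
      using that cyl_eq by (auto simp: E_def)
    show "sets Q = sigma_sets ?S E" "sets Q' = sigma_sets ?S E" using sQ Q Q' by auto
    show "range (\<lambda>_. cyl {}) \<subseteq> E" by (auto simp: E_def)
    show "(\<Union>i. cyl {}) = ?S" by (auto simp: cyl_def)
    show "emeasure Q (cyl {}) \<noteq> \<infinity>" for i :: nat
    proof -
      interpret prob_space Q using Q by (simp add: is_poisson_law_def)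
      show ?thesis by simp
    qed
  qed
qed

text \<open>Existence and uniqueness together give the definite description its value.\<close>

lemma poisson_law_eq_poisson_points:
  fixes m :: "'x::topological_space measure"
  assumes "prob_space m" and "sets m = sets borel" and "0 \<le> t"
    and "\<And>B. B \<in> sets borel \<Longrightarrow> lam B = t * measure m B"
  shows "poisson_law lam = poisson_points t m"
  unfolding poisson_law_def
  using is_poisson_law_poisson_points[OF assms] is_poisson_law_unique by blast

section \<open>Unit atoms of random measures\<close>

text \<open>Dividing \<open>X w\<close> by 1 plus its total mass gives a subprobability kernel,
  whose value on the sections of a measurable set is measurable; the factor is restored at the end.
  The added 1 keeps the divisor away from 0.\<close>

lemma measurable_emeasure_finite_kernel:
  fixes X :: "'w \<Rightarrow> 'x::topological_space measure"
  assumes X: "X \<in> N \<rightarrow>\<^sub>M fm_space" and fin: "\<And>w. w \<in> space N \<Longrightarrow> finite_measure (X w)"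
    and A: "(SIGMA w:space N. A w) \<in> sets (N \<Otimes>\<^sub>M borel)"
  shows "(\<lambda>w. emeasure (X w) (A w)) \<in> borel_measurable N"
proof -
  have sX: "sets (X w) = sets borel" "space (X w) = UNIV" if "w \<in> space N" for w
  proof -
    show "sets (X w) = sets borel"
      using measurable_space[OF X that] by (simp add: space_fm_space)
    from sets_eq_imp_space_eq[OF this] show "space (X w) = UNIV" by simp
  qed
  have mX: "(\<lambda>w. emeasure (X w) B) \<in> borel_measurable N" if "B \<in> sets borel" for B
    using X measurable_emeasure_fm_space[OF that] by (rule measurable_compose)
  define z where "z w = 1 + emeasure (X w) UNIV" for w
  have z: "z \<in> borel_measurable N" unfolding z_def using mX[of UNIV] by simp
  have z1: "z w \<noteq> 0" "z w \<noteq> \<top>" "emeasure (X w) UNIV \<le> z w" if "w \<in> space N" for w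
    using finite_measure.emeasure_finite[OF fin[OF that], of UNIV] by (auto simp: z_def add_eq_0_iff_both_eq_0)
  define K where "K w = scale_measure (inverse (z w)) (X w)" for w
  have K: "K \<in> N \<rightarrow>\<^sub>M subprob_algebra borel"
  proof (rule measurable_subprob_algebra)
    fix w assume w: "w \<in> space N"
    show "sets (K w) = sets borel" using sX[OF w] by (simp add: K_def)
    have "inverse (z w) * emeasure (X w) UNIV \<le> inverse (z w) * z w"
      using z1[OF w] by (intro mult_left_mono) auto
    also have "\<dots> = 1"
      using ennreal_divide_self[of "z w"] z1[OF w] by (simp add: less_top mult.commute divide_ennreal_def)
    finally show "subprob_space (K w)"
      using sX[OF w] by (intro subprob_spaceI) (auto simp: K_def space_scale_measure)
  next
    fix B :: "'x set" assume "B \<in> sets borel"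
    then show "(\<lambda>w. emeasure (K w) B) \<in> borel_measurable N"
      unfolding K_def emeasure_scale_measure using mX z by (intro borel_measurable_times_ennreal borel_measurable_inverse_ennreal) auto
  qed
  have "(\<lambda>w. z w * emeasure (K w) (A w)) \<in> borel_measurable N"
    using emeasure_measurable_subprob_algebra2[OF A K] z by (intro borel_measurable_times_ennreal) auto
  moreover have "z w * emeasure (K w) (A w) = emeasure (X w) (A w)" if "w \<in> space N" for w
    using ennreal_divide_self[of "z w"] z1[OF that]
    by (simp add: K_def mult.assoc[symmetric] less_top divide_ennreal_def)
  ultimately show ?thesis
    by (subst measurable_cong[where g="\<lambda>w. z w * emeasure (K w) (A w)"]) auto
qed

text \<open>The singletons are the sections of the diagonal, which is the zero set of
  \<open>dist\<close>; second countability makes \<open>dist\<close> measurable for the product of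
  the Borel algebras.\<close>

lemma measurable_atom_mass:
  fixes X :: "'w \<Rightarrow> 'x::{metric_space, second_countable_topology} measure"
  assumes X: "X \<in> N \<rightarrow>\<^sub>M fm_space" and fin: "\<And>w. w \<in> space N \<Longrightarrow> finite_measure (X w)"
  shows "(\<lambda>p. emeasure (X (fst p)) {snd p}) \<in> borel_measurable (N \<Otimes>\<^sub>M borel)"
proof (rule measurable_emeasure_finite_kernel)
  let ?N = "N \<Otimes>\<^sub>M (borel :: 'x measure)"
  show "(\<lambda>p. X (fst p)) \<in> N \<Otimes>\<^sub>M borel \<rightarrow>\<^sub>M fm_space"
    using measurable_fst X by (rule measurable_compose)
  show "finite_measure (X (fst p))" if "p \<in> space ?N" for p
    using that fin by (auto simp: space_pair_measure)
  have "(SIGMA p:space ?N. {snd p})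
     = {q \<in> space (?N \<Otimes>\<^sub>M borel). dist (snd (fst q)) (snd q) = 0}"
    by (auto simp: space_pair_measure)
  also have "\<dots> \<in> sets (?N \<Otimes>\<^sub>M borel)"
    by measurable
  finally show "(SIGMA p:space ?N. {snd p}) \<in> sets (?N \<Otimes>\<^sub>M borel)" .
qed

text \<open>A finite part of \<open>T\<close> has mass equal to its cardinality, so the total mass
  bounds the cardinality of every finite part.\<close>

lemma unit_atoms:
  fixes \<mu> :: "'x::t1_space measure"
  assumes fin: "finite_measure \<mu>" and s: "sets \<mu> = sets borel" and T: "\<And>x. x \<in> T \<Longrightarrow> emeasure \<mu> {x} = 1"
  shows finite_unit_atoms: "finite T" and emeasure_unit_atoms: "emeasure \<mu> T = of_nat (card T)"
proof -
  interpret finite_measure \<mu> by fact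
  have sng: "{x} \<in> sets \<mu>" for x using s by simp
  have em: "emeasure \<mu> F = of_nat (card F)" if "finite F" "F \<subseteq> T" for F
  proof -
    have "emeasure \<mu> F = (\<Sum>x\<in>F. emeasure \<mu> {x})"
      using that sng by (intro emeasure_eq_sum_singleton) auto
    also have "\<dots> = (\<Sum>x\<in>F. 1)" using that T by (intro sum.cong) auto
    finally show ?thesis by simp
  qed
  show *: "finite T"
  proof (rule ccontr)
    assume inf: "infinite T"
    obtain n :: nat where n: "measure \<mu> (space \<mu>) < real n" using reals_Archimedean2 by blast
    obtain F where F: "F \<subseteq> T" "finite F" "card F = n"
      using infinite_arbitrarily_large[OF inf] by metis
    have "ennreal (real n) = emeasure \<mu> F" using em[OF F(2,1)] F(3) by (simp add: ennreal_of_nat_eq_real_of_nat)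
    also have "\<dots> \<le> emeasure \<mu> (space \<mu>)" by (rule emeasure_space)
    finally have "real n \<le> measure \<mu> (space \<mu>)" by (simp add: emeasure_eq_measure)
    with n show False by simp
  qed
  show "emeasure \<mu> T = of_nat (card T)" using em[OF *] by simp
qed

section \<open>Counting unit atoms outside a given set\<close>

definition finite_part :: "'x::topological_space measure \<Rightarrow> 'x measure" where
  "finite_part \<mu> = (if emeasure \<mu> UNIV = \<infinity> then null_measure borel else \<mu>)"

lemma finite_part_eq: "finite_measure \<mu> \<Longrightarrow> finite_part \<mu> = \<mu>"
  by (auto simp: finite_part_def finite_measure.emeasure_finite)

lemma finite_measure_finite_part:
  assumes "\<mu> \<in> space fm_space" shows "finite_measure (finite_part \<mu>)"
proof -
  have "space \<mu> = UNIV" using assms by (auto simp: space_fm_space dest: sets_eq_imp_space_eq)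
  then show ?thesis by (intro finite_measureI) (auto simp: finite_part_def)
qed

lemma sets_finite_part: "\<mu> \<in> space fm_space \<Longrightarrow> sets (finite_part \<mu>) = sets borel"
  by (auto simp: finite_part_def space_fm_space)

lemma measurable_finite_part: "finite_part \<in> fm_space \<rightarrow>\<^sub>M (fm_space :: 'x::topological_space measure measure)"
proof (rule measurable_into_fm_space)
  fix B :: "'x set" assume B: "B \<in> sets borel"
  have "(\<lambda>\<mu>. if emeasure \<mu> (UNIV :: 'x set) = \<infinity> then 0 else emeasure \<mu> B) \<in> borel_measurable fm_space"
    using B by measurable
  also have "(\<lambda>\<mu>. if emeasure \<mu> (UNIV :: 'x set) = \<infinity> then 0 else emeasure \<mu> B) = (\<lambda>\<mu>. emeasure (finite_part \<mu>) B)"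
    by (auto simp: fun_eq_iff finite_part_def)
  finally show "(\<lambda>\<mu>. emeasure (finite_part \<mu>) B) \<in> borel_measurable fm_space" .
qed (rule sets_finite_part)

text \<open>Measures in \<^const>\<open>fm_space\<close> may be infinite; passing to \<^const>\<open>finite_part\<close> makes the count
  below a measurable function of the measure without a finiteness side condition.\<close>

definition unit_count_off :: "'x::topological_space set \<Rightarrow> 'x measure \<Rightarrow> ennreal" where
  "unit_count_off S \<mu> = emeasure (finite_part \<mu>) {x. x \<notin> S \<and> emeasure (finite_part \<mu>) {x} = 1}"

text \<open>Each counted atom contributes mass 1, so evaluating the measure at the set of these
  atoms returns their number.\<close>

lemma unit_count_off_eq:
  fixes \<mu> :: "'x::t1_space measure"
  assumes "finite_measure \<mu>" "sets \<mu> = sets borel"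
  shows "unit_count_off S \<mu> = of_nat (card {x. x \<notin> S \<and> emeasure \<mu> {x} = 1})"
  unfolding unit_count_off_def finite_part_eq[OF assms(1)]
  by (rule emeasure_unit_atoms[OF assms]) auto

text \<open>Joint measurability in outcome and measure, needed because the set \<open>S\<close> of
  old dishes is itself random when the conditional law is disintegrated.\<close>

lemma measurable_unit_count_off_pair:
  fixes S :: "'w \<Rightarrow> 'x::{metric_space, second_countable_topology} set"
  assumes S: "{p \<in> space (N \<Otimes>\<^sub>M borel). snd p \<in> S (fst p)} \<in> sets (N \<Otimes>\<^sub>M borel)"
  shows "(\<lambda>p. unit_count_off (S (fst p)) (snd p)) \<in> borel_measurable (N \<Otimes>\<^sub>M fm_space)"
  unfolding unit_count_off_def
proof (rule measurable_emeasure_finite_kernel)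
  let ?N = "N \<Otimes>\<^sub>M (fm_space :: 'x measure measure)"
  show X: "(\<lambda>p. finite_part (snd p)) \<in> ?N \<rightarrow>\<^sub>M fm_space"
    using measurable_snd measurable_finite_part by (rule measurable_compose)
  show fin: "finite_measure (finite_part (snd p))" if "p \<in> space ?N" for p
    using that by (auto simp: space_pair_measure intro: finite_measure_finite_part)
  have m1: "(\<lambda>q. emeasure (finite_part (snd (fst q))) {snd q}) \<in> borel_measurable (?N \<Otimes>\<^sub>M borel)"
    by (rule measurable_atom_mass[OF X fin])
  have m2: "(\<lambda>q. (fst (fst q), snd q)) \<in> ?N \<Otimes>\<^sub>M (borel :: 'x measure) \<rightarrow>\<^sub>M N \<Otimes>\<^sub>M borel"
    by measurable
  have "(SIGMA p:space ?N. {x. x \<notin> S (fst p) \<and> emeasure (finite_part (snd p)) {x} = 1})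
     = {q \<in> space (?N \<Otimes>\<^sub>M (borel :: 'x measure)). emeasure (finite_part (snd (fst q))) {snd q} = 1}
       - ((\<lambda>q. (fst (fst q), snd q)) -` {p \<in> space (N \<Otimes>\<^sub>M borel). snd p \<in> S (fst p)} \<inter> space (?N \<Otimes>\<^sub>M borel))"
    by (auto simp: space_pair_measure)
  also have "\<dots> \<in> sets (?N \<Otimes>\<^sub>M borel)"
    using measurable_sets[OF m2 S] borel_measurable_eq[OF m1, of "\<lambda>_. 1"] by (intro sets.Diff) auto
  finally show "(SIGMA p:space ?N. {x. x \<notin> S (fst p) \<and> emeasure (finite_part (snd p)) {x} = 1}) \<in> sets (?N \<Otimes>\<^sub>M borel)" .
qed

lemma measurable_unit_count_off:
  fixes S :: "'x::{metric_space, second_countable_topology} set"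
  assumes "finite S"
  shows "unit_count_off S \<in> borel_measurable fm_space"
proof -
  \<comment> \<open>A fixed set is the random case over a one-point outcome space.\<close>
  let ?N = "count_space {()}"
  have "S \<in> sets borel" using assms by (simp add: borel_closed finite_imp_closed)
  then have "{p \<in> space (?N \<Otimes>\<^sub>M (borel :: 'x measure)). snd p \<in> S} \<in> sets (?N \<Otimes>\<^sub>M borel)"
    by measurable
  then have "(\<lambda>p. unit_count_off S (snd p)) \<in> borel_measurable (?N \<Otimes>\<^sub>M (fm_space :: 'x measure measure))"
    by (rule measurable_unit_count_off_pair[where S="\<lambda>_. S"])
  from measurable_compose[OF _ this, of "\<lambda>\<mu>. ((), \<mu>)" fm_space]
  show ?thesis by simp
qed

lemma emeasure_add_points:
  fixes \<mu> :: "'x::topological_space measure"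
  assumes s: "sets \<mu> = sets borel" and B: "B \<in> sets borel"
  shows "emeasure (add_points \<mu> V) B = emeasure \<mu> B + emeasure (count_space UNIV) (B \<inter> V)"
proof (rule emeasure_measure_of[OF add_points_def])
  show "sets borel \<subseteq> Pow (UNIV :: 'x set)" by simp
  have sets: "sets (add_points \<mu> V) = sets borel"
    unfolding add_points_def using sets.sigma_sets_eq[of "borel :: 'x measure"] by (simp add: sets_measure_of)
  show "B \<in> sets (add_points \<mu> V)" using B sets by simp
  show "positive (sets (add_points \<mu> V)) (\<lambda>B. emeasure \<mu> B + emeasure (count_space UNIV) (B \<inter> V))"
    by (simp add: positive_def)
  show "countably_additive (sets (add_points \<mu> V)) (\<lambda>B. emeasure \<mu> B + emeasure (count_space UNIV) (B \<inter> V))"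
  proof (rule countably_additiveI)
    fix A :: "nat \<Rightarrow> 'x set"
    assume A: "range A \<subseteq> sets (add_points \<mu> V)" "disjoint_family A"
    have 1: "(\<Sum>i. emeasure \<mu> (A i)) = emeasure \<mu> (\<Union>i. A i)"
      using A sets s by (intro suminf_emeasure) auto
    have "disjoint_family (\<lambda>i. A i \<inter> V)"
      using A(2) by (auto simp: disjoint_family_on_def)
    then have 2: "(\<Sum>i. emeasure (count_space UNIV) (A i \<inter> V)) = emeasure (count_space UNIV) (\<Union>i. A i \<inter> V)"
      by (intro suminf_emeasure) auto
    have "(\<Sum>i. emeasure \<mu> (A i) + emeasure (count_space UNIV) (A i \<inter> V))
        = (\<Sum>i. emeasure \<mu> (A i)) + (\<Sum>i. emeasure (count_space UNIV) (A i \<inter> V))"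
      by (rule suminf_add[symmetric]) auto
    also have "\<dots> = emeasure \<mu> (\<Union>i. A i) + emeasure (count_space UNIV) (\<Union>i. A i \<inter> V)"
      unfolding 1 2 ..
    also have "(\<Union>i. A i \<inter> V) = (\<Union>i. A i) \<inter> V" by auto
    finally show "(\<Sum>i. emeasure \<mu> (A i) + emeasure (count_space UNIV) (A i \<inter> V))
        = emeasure \<mu> (\<Union>i. A i) + emeasure (count_space UNIV) ((\<Union>i. A i) \<inter> V)" .
  qed
qed

lemma sets_add_points [simp]: "sets (add_points \<mu> V) = sets (borel :: 'x::topological_space measure)"
  unfolding add_points_def using sets.sigma_sets_eq[of "borel :: 'x measure"] by (simp add: sets_measure_of)

text \<open>Points placed inside \<open>S\<close> alter no atom outside it, and finitely many of
  them do not change whether the total mass is finite, the case on which \<open>finite_part\<close>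
  branches.\<close>

lemma unit_count_off_add_points:
  fixes \<mu> :: "'x::t1_space measure"
  assumes s: "sets \<mu> = sets borel" and V: "V \<subseteq> S" "finite V"
  shows "unit_count_off S (add_points \<mu> V) = unit_count_off S \<mu>"
proof -
  have spc: "space \<mu> = UNIV" "space (add_points \<mu> V) = UNIV"
    using sets_eq_imp_space_eq[OF s] sets_eq_imp_space_eq[OF sets_add_points[of \<mu> V]] by simp_all
  have U: "emeasure (add_points \<mu> V) UNIV = emeasure \<mu> UNIV + of_nat (card V)"
    using V by (simp add: emeasure_add_points s)
  show ?thesis
  proof (cases "emeasure \<mu> UNIV = \<infinity>")
    case True
    then show ?thesis using U by (simp add: unit_count_off_def finite_part_def)
  next
    case False
    have f1: "finite_measure \<mu>" using False spc by (intro finite_measureI) simp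
    have f2: "finite_measure (add_points \<mu> V)"
      using False spc U by (intro finite_measureI) (simp add: ennreal_add_eq_top)
    have "emeasure (add_points \<mu> V) {x} = emeasure \<mu> {x}" if "x \<notin> S" for x
    proof -
      have "{x} \<inter> V = {}" using that V by auto
      then show ?thesis using emeasure_add_points[OF s, of "{x}" V] by simp
    qed
    then have "{x. x \<notin> S \<and> emeasure (add_points \<mu> V) {x} = 1} = {x. x \<notin> S \<and> emeasure \<mu> {x} = 1}"
      by auto
    then show ?thesis using unit_count_off_eq[OF f1 s, of S] unit_count_off_eq[OF f2, of S] by simp
  qed
qed

section \<open>New unit atoms under Poisson and Bernoulli laws\<close>

lemma distr_snd_pair_measure:
  assumes "prob_space A" and "sigma_finite_measure B"
  shows "distr (A \<Otimes>\<^sub>M B) B snd = B"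
proof (rule measure_eqI)
  interpret A: prob_space A by fact
  interpret B: sigma_finite_measure B by fact
  fix X assume "X \<in> sets (distr (A \<Otimes>\<^sub>M B) B snd)"
  then have X: "X \<in> sets B" by simp
  have "snd -` X \<inter> space (A \<Otimes>\<^sub>M B) = space A \<times> X"
    using sets.sets_into_space[OF X] by (auto simp: space_pair_measure)
  then show "emeasure (distr (A \<Otimes>\<^sub>M B) B snd) X = emeasure B X"
    using X by (simp add: emeasure_distr B.emeasure_pair_measure_Times A.emeasure_space_1)
qed simp

text \<open>A coordinate misses any given point almost surely since \<open>m\<close> is diffuse. For
  two coordinates, Fubini with one of them held fixed gives the same, and there are countably many
  pairs.\<close>

lemma AE_distinct_points:
  fixes m :: "'x::{metric_space, second_countable_topology} measure"
  assumes m: "prob_space m" and ms: "sets m = sets borel" and diff: "\<And>x. emeasure m {x} = 0"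
    and S: "finite S"
  shows "AE w in mixed_binomial t m. inj (snd w) \<and> (\<forall>i. snd w i \<notin> S)"
proof -
  let ?P = "PiM UNIV (\<lambda>i::nat. m)"
  interpret prob_space m by fact
  interpret sequence_space m ..
  have [measurable_cong]: "sets m = sets borel" by fact
  have ne: "AE x in m. x \<noteq> a" for a
    using diff[of a] ms by (intro AE_I[where N="{a}"]) auto
  have 1: "AE X in ?P. \<forall>i. \<forall>a\<in>S. X i \<noteq> a"
    unfolding AE_all_countable AE_ball_countable[OF countable_finite[OF S]]
    using ne by (intro allI ballI AE_PiM_component[where M="\<lambda>i. m"]) (auto simp: m)
  have 2: "AE X in ?P. X i \<noteq> X j" if ij: "i \<noteq> j" for i j
  proof -
    let ?J = "{i, j}"
    let ?Q = "PiM ?J (\<lambda>i::nat. m)"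
    let ?D = "{X \<in> space ?Q. dist (X i) (X j) = 0}"
    have Dm: "?D \<in> sets ?Q" by measurable
    have "emeasure ?Q ?D = (\<integral>\<^sup>+X. indicator ?D X \<partial>PiM (insert i {j}) (\<lambda>i::nat. m))"
      using Dm by simp
    also have "\<dots> = (\<integral>\<^sup>+X. \<integral>\<^sup>+y. indicator ?D (X(i := y)) \<partial>m \<partial>PiM {j} (\<lambda>i::nat. m))"
      using ij Dm by (intro product_nn_integral_insert) auto
    also have "\<dots> = (\<integral>\<^sup>+X. 0 \<partial>PiM {j} (\<lambda>i::nat. m))"
    proof (intro nn_integral_cong)
      fix X assume "X \<in> space (PiM {j} (\<lambda>i::nat. m))"
      have "(\<integral>\<^sup>+y. indicator ?D (X(i := y)) \<partial>m) \<le> (\<integral>\<^sup>+y. indicator {X j} y \<partial>m)"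
        using ij by (intro nn_integral_mono) (auto simp: indicator_def)
      also have "\<dots> = 0" using diff ms by simp
      finally show "(\<integral>\<^sup>+y. indicator ?D (X(i := y)) \<partial>m) = 0" by simp
    qed
    finally have "emeasure ?Q ?D = 0" by simp
    then have "AE X in ?Q. X i \<noteq> X j"
      using Dm by (intro AE_I[where N="?D"]) auto
    then have "AE X in distr ?P ?Q (\<lambda>x. restrict x ?J). X i \<noteq> X j"
      by (subst distr_PiM_restrict_finite) (auto simp: m)
    then have "AE X in ?P. restrict X ?J i \<noteq> restrict X ?J j"
      by (rule AE_distrD[rotated]) (rule measurable_restrict_subset, simp)
    then show ?thesis by simp
  qed
  have 3: "AE X in ?P. \<forall>i j. i \<noteq> j \<longrightarrow> X i \<noteq> X j"
    unfolding AE_all_countable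
  proof (intro allI)
    fix i j :: nat
    show "AE X in ?P. i \<noteq> j \<longrightarrow> X i \<noteq> X j"
      using 2[of i j] by (cases "i = j") auto
  qed
  have "AE X in ?P. inj X \<and> (\<forall>i. X i \<notin> S)"
    using 1 3 by eventually_elim (auto simp: inj_def)
  then have "AE X in distr (mixed_binomial t m) ?P snd. inj X \<and> (\<forall>i. X i \<notin> S)"
    unfolding mixed_binomial_def
    by (subst distr_snd_pair_measure) (auto intro!: prob_space_measure_pmf prob_space_imp_sigma_finite P.prob_space_axioms)
  then show ?thesis
    unfolding mixed_binomial_def by (rule AE_distrD[rotated]) auto
qed

text \<open>When the points are distinct and avoid \<open>S\<close>, each is a unit atom off
  \<open>S\<close>, so the count is the Poisson number \<open>fst w\<close> itself.\<close>

lemma measure_poisson_points_unit_count: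
  fixes m :: "'x::{metric_space, second_countable_topology} measure"
  assumes m: "prob_space m" and ms: "sets m = sets borel" and diff: "\<And>x. emeasure m {x} = 0"
    and S: "finite S"
  shows "measure (poisson_points t m) {\<mu> \<in> space fm_space. unit_count_off S \<mu> = of_nat k} = pmf (poi t) k"
proof -
  let ?S = "space (\<Pi>\<^sub>M i\<in>(UNIV::nat set). m)"
  let ?mb = "mixed_binomial t m"
  interpret prob_space m by fact
  interpret sequence_space m ..
  interpret mb: prob_space ?mb by (rule prob_space_mixed_binomial) fact
  let ?g = "\<lambda>w. point_measure_upto (fst w) (snd w)"
  let ?E = "{\<mu> \<in> space (fm_space :: 'x measure measure). unit_count_off S \<mu> = of_nat k}"
  have E: "?E \<in> sets fm_space"
    using borel_measurable_eq[OF measurable_unit_count_off[OF S], of "\<lambda>_. of_nat k"] by simp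
  have count: "unit_count_off S (point_measure_upto n X) = of_nat n" if X: "inj X" "\<And>i. X i \<notin> S" for n X
  proof -
    have fin: "finite_measure (point_measure_upto n X)"
    proof (rule finite_measureI)
      have "space (point_measure_upto n X) = UNIV" by (simp add: point_measure_upto_def)
      then show "emeasure (point_measure_upto n X) (space (point_measure_upto n X)) \<noteq> \<infinity>"
        by (simp add: emeasure_point_measure_upto)
    qed
    have "{x. x \<notin> S \<and> emeasure (point_measure_upto n X) {x} = 1} = X ` {..<n}"
    proof -
      have "emeasure (point_measure_upto n X) {x} = (if x \<in> X ` {..<n} then 1 else 0)" for x
      proof (cases "x \<in> X ` {..<n}")
        case True
        then obtain i where "i < n" "x = X i" by auto
        then have "{j. j < n \<and> X j \<in> {x}} = {i}" using X(1) by (auto simp: inj_def)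
        then show ?thesis using True by (simp add: emeasure_point_measure_upto)
      next
        case False
        then have "{j. j < n \<and> X j \<in> {x}} = {}" by auto
        then show ?thesis using False by (simp only: emeasure_point_measure_upto borel_singleton sets.empty_sets) simp
      qed
      then show ?thesis using X(2) by auto
    qed
    moreover have "card (X ` {..<n}) = n"
      using X(1) by (subst card_image) (auto intro: inj_on_subset)
    ultimately show ?thesis by (simp add: unit_count_off_eq[OF fin])
  qed
  have "measure (poisson_points t m) ?E = measure ?mb (?g -` ?E \<inter> space ?mb)"
    unfolding poisson_points_def using measurable_point_measure_upto[OF ms] E by (rule measure_distr)
  also have "\<dots> = measure ?mb ({k} \<times> ?S)"
  proof (rule measure_eq_AE)
    show "AE w in ?mb. (w \<in> ?g -` ?E \<inter> space ?mb) = (w \<in> {k} \<times> ?S)"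
      using AE_distinct_points[OF m ms diff S, of t] AE_space
    proof eventually_elim
      case (elim w)
      have "unit_count_off S (?g w) = of_nat (fst w)" using elim(1) by (intro count) auto
      moreover have "?g w \<in> space fm_space" by (simp add: space_fm_space)
      moreover have "snd w \<in> ?S"
        using elim(2) by (auto simp: mixed_binomial_def space_pair_measure)
      ultimately show ?case using elim(2) by (cases w) auto
    qed
    show "?g -` ?E \<inter> space ?mb \<in> sets ?mb"
      using measurable_point_measure_upto[OF ms] E by (rule measurable_sets)
    show "{k} \<times> ?S \<in> sets ?mb"
      unfolding mixed_binomial_def by (intro pair_measureI) auto
  qed
  also have "emeasure ?mb ({k} \<times> ?S) = ennreal (pmf (poi t) k)"
    unfolding mixed_binomial_def
    by (subst P.emeasure_pair_measure_Times) (auto simp: P.emeasure_space_1 emeasure_pmf_single)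
  then have "measure ?mb ({k} \<times> ?S) = pmf (poi t) k"
    by (simp add: measure_eq_emeasure_eq_ennreal)
  finally show ?thesis .
qed

text \<open>The Bernoulli component places points on the atoms of \<open>\<nu>\<close>, where
  nothing is counted, so the count sees the Poisson component alone.\<close>

lemma BeP_unit_count:
  fixes m :: "'x::{metric_space, second_countable_topology} measure"
  assumes m: "prob_space m" and ms: "sets m = sets borel" and diff: "\<And>x. emeasure m {x} = 0"
    and t: "0 \<le> t" and S: "finite (atoms \<nu>)"
    and dp: "\<And>B. B \<in> sets borel \<Longrightarrow> diffuse_part \<nu> B = t * measure m B"
  shows prob_space_BeP: "prob_space (BeP \<nu>)" and sets_BeP: "sets (BeP \<nu>) = sets fm_space"
    and measure_BeP_unit_count:
      "measure (BeP \<nu>) {\<mu> \<in> space fm_space. unit_count_off (atoms \<nu>) \<mu> = of_nat k} = pmf (poi t) k"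
proof -
  let ?p = "poisson_points t m"
  let ?V = "PiM (atoms \<nu>) (\<lambda>x. measure_pmf (bernoulli_pmf (measure \<nu> {x})))"
  let ?Q = "?p \<Otimes>\<^sub>M ?V"
  let ?f = "\<lambda>(\<mu>, v). add_points \<mu> {x \<in> atoms \<nu>. v x}"
  have pl: "poisson_law (diffuse_part \<nu>) = ?p"
    using m ms t dp by (rule poisson_law_eq_poisson_points)
  have BeP: "BeP \<nu> = distr ?Q fm_space ?f"
    unfolding BeP_def pl ..
  interpret V: prob_space ?V by (intro prob_space_PiM prob_space_measure_pmf)
  interpret pp: prob_space ?p
    using is_poisson_law_poisson_points[OF m ms t dp] by (simp add: is_poisson_law_def)
  interpret Q: pair_prob_space ?p ?V ..
  have spp: "sets ?p = sets fm_space" by (simp add: poisson_points_def)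
  have sppp: "space ?p = space fm_space" by (simp add: poisson_points_def)
  have f: "?f \<in> ?Q \<rightarrow>\<^sub>M fm_space"
  proof (rule measurable_into_fm_space)
    fix B :: "'x set" assume B: "B \<in> sets borel"
    have m1: "(\<lambda>p. emeasure (fst p) B) \<in> borel_measurable ?Q"
      using measurable_emeasure_fm_space[OF B] by (intro measurable_compose[OF measurable_fst]) (simp add: measurable_cong_sets[OF spp refl])
    have m2: "(\<lambda>p. of_bool (snd p x) :: ennreal) \<in> borel_measurable ?Q" if "x \<in> atoms \<nu>" for x
    proof (rule measurable_compose[OF measurable_snd])
      show "(\<lambda>v. of_bool (v x) :: ennreal) \<in> borel_measurable ?V"
        by (rule measurable_compose[OF measurable_component_singleton[OF that]]) simp
    qed
    have "(\<lambda>p. emeasure (fst p) B + (\<Sum>x\<in>atoms \<nu> \<inter> B. of_bool (snd p x))) \<in> borel_measurable ?Q"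
      by (intro borel_measurable_add borel_measurable_sum m1 m2) auto
    moreover have "emeasure (?f p) B = emeasure (fst p) B + (\<Sum>x\<in>atoms \<nu> \<inter> B. of_bool (snd p x))"
      if "p \<in> space ?Q" for p
    proof -
      have "emeasure (count_space UNIV) (B \<inter> {x \<in> atoms \<nu>. snd p x}) = of_nat (card (B \<inter> {x \<in> atoms \<nu>. snd p x}))"
        using S by (subst emeasure_count_space_finite) auto
      also have "\<dots> = (\<Sum>x\<in>B \<inter> {x \<in> atoms \<nu>. snd p x}. 1)" by simp
      also have "\<dots> = (\<Sum>x\<in>atoms \<nu> \<inter> B. of_bool (snd p x))"
        using S by (intro sum.mono_neutral_cong_left) auto
      finally show ?thesis
        using that B by (auto simp: space_pair_measure sppp space_fm_space emeasure_add_points case_prod_beta)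
    qed
    ultimately show "(\<lambda>p. emeasure (?f p) B) \<in> borel_measurable ?Q"
      by (subst measurable_cong) auto
  qed auto
  show "prob_space (BeP \<nu>)" unfolding BeP using f by (rule Q.prob_space_distr)
  show "sets (BeP \<nu>) = sets fm_space" unfolding BeP by simp
  let ?E = "{\<mu> \<in> space (fm_space :: 'x measure measure). unit_count_off (atoms \<nu>) \<mu> = of_nat k}"
  have E: "?E \<in> sets fm_space"
    using borel_measurable_eq[OF measurable_unit_count_off[OF S], of "\<lambda>_. of_nat k"] by simp
  have "measure (BeP \<nu>) ?E = measure ?Q (?f -` ?E \<inter> space ?Q)"
    unfolding BeP using f E by (rule measure_distr)
  \<comment> \<open>The preimage is a rectangle that does not constrain the Bernoulli
    coordinates.\<close>
  also have "?f -` ?E \<inter> space ?Q = ?E \<times> space ?V"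
  proof -
    have eq: "unit_count_off (atoms \<nu>) (add_points \<mu> {x \<in> atoms \<nu>. v x}) = unit_count_off (atoms \<nu>) \<mu>"
      if "sets \<mu> = sets borel" for \<mu> v
      by (rule unit_count_off_add_points[OF that]) (use S in auto)
    have "?f p \<in> ?E \<longleftrightarrow> fst p \<in> ?E" if "fst p \<in> space fm_space" for p
      using that eq[of "fst p" "snd p"] by (cases p) (simp add: space_fm_space)
    then show ?thesis
      unfolding space_pair_measure sppp by (intro set_eqI) (auto simp only: vimage_eq Int_iff mem_Times_iff mem_Collect_eq)
  qed
  also have "measure ?Q (?E \<times> space ?V) = measure ?p ?E"
  proof -
    have "emeasure ?Q (?E \<times> space ?V) = emeasure ?p ?E"
      using E spp by (subst V.emeasure_pair_measure_Times) (simp_all add: V.emeasure_space_1)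
    then show ?thesis unfolding pp.emeasure_eq_measure
      by (rule measure_eq_emeasure_eq_ennreal[OF measure_nonneg])
  qed
  also have "\<dots> = pmf (poi t) k"
    by (rule measure_poisson_points_unit_count[OF m ms diff S])
  finally show "measure (BeP \<nu>) ?E = pmf (poi t) k" .
qed

text \<open>The diffuse part charges no point and the weights on \<open>S\<close> are positive, so
  the atoms are exactly \<open>S\<close>; removing their finite sum leaves the multiple of
  \<open>m\<close>.\<close>

lemma hazard_measure:
  fixes m :: "'x::t1_space measure" and S :: "'x set" and w :: "'x \<Rightarrow> real" and t :: real
  defines "\<nu> \<equiv> measure_of UNIV (sets (borel :: 'x measure))
     (\<lambda>B. (\<integral>\<^sup>+x. indicator (S \<inter> B) x * ennreal (w x) \<partial>count_space UNIV) + ennreal t * emeasure m B)"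
  assumes m: "prob_space m" and ms: "sets m = sets borel" and diff: "\<And>x. emeasure m {x} = 0"
    and S: "finite S" and w: "\<And>x. x \<in> S \<Longrightarrow> 0 < w x" and t: "0 \<le> t"
  shows atoms_hazard_measure: "atoms \<nu> = S"
    and diffuse_part_hazard_measure: "B \<in> sets borel \<Longrightarrow> diffuse_part \<nu> B = t * measure m B"
proof -
  interpret m: prob_space m by fact
  let ?f = "\<lambda>B. (\<integral>\<^sup>+x. indicator (S \<inter> B) x * ennreal (w x) \<partial>count_space UNIV) + ennreal t * emeasure m B"
  \<comment> \<open>Reading the discrete part as a density makes its countable additivity that of a
    measure.\<close>
  let ?D = "density (count_space UNIV) (\<lambda>x. indicator S x * ennreal (w x))"
  have D: "(\<integral>\<^sup>+x. indicator (S \<inter> B) x * ennreal (w x) \<partial>count_space UNIV) = emeasure ?D B" for B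
    by (subst emeasure_density) (auto intro!: nn_integral_cong simp: indicator_def)
  have fin: "(\<integral>\<^sup>+x. indicator (S \<inter> B) x * ennreal (w x) \<partial>count_space UNIV) = ennreal (\<Sum>x\<in>S \<inter> B. w x)" for B
  proof -
    have "(\<integral>\<^sup>+x. indicator (S \<inter> B) x * ennreal (w x) \<partial>count_space UNIV) = (\<Sum>x\<in>S \<inter> B. indicator (S \<inter> B) x * ennreal (w x))"
      using S by (intro nn_integral_count_space') auto
    also have "\<dots> = (\<Sum>x\<in>S \<inter> B. ennreal (w x))" by (intro sum.cong) auto
    also have "\<dots> = ennreal (\<Sum>x\<in>S \<inter> B. w x)" using w by (intro sum_ennreal) (auto intro: less_imp_le)
    finally show ?thesis .
  qed
  have sets: "sets \<nu> = sets borel"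
    unfolding \<nu>_def using sets.sigma_sets_eq[of "borel :: 'x measure"] by (simp add: sets_measure_of)
  have em: "emeasure \<nu> B = ennreal ((\<Sum>x\<in>S \<inter> B. w x) + t * measure m B)" if B: "B \<in> sets borel" for B
  proof -
    have "emeasure \<nu> B = ?f B"
    proof (rule emeasure_measure_of[OF \<nu>_def[THEN meta_eq_to_obj_eq]])
      show "positive (sets \<nu>) ?f" by (simp add: positive_def)
      show "countably_additive (sets \<nu>) ?f"
      proof (rule countably_additiveI)
        fix A :: "nat \<Rightarrow> 'x set"
        assume A: "range A \<subseteq> sets \<nu>" "disjoint_family A"
        have "(\<Sum>i. ?f (A i)) = (\<Sum>i. emeasure ?D (A i)) + (\<Sum>i. ennreal t * emeasure m (A i))"
          unfolding D by (rule suminf_add[symmetric]) auto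
        also have "(\<Sum>i. emeasure ?D (A i)) = emeasure ?D (\<Union>i. A i)"
          using A by (intro suminf_emeasure) auto
        also have "(\<Sum>i. ennreal t * emeasure m (A i)) = ennreal t * emeasure m (\<Union>i. A i)"
          using A sets ms by (subst ennreal_suminf_cmult) (auto intro!: arg_cong2[where f="(*)"] suminf_emeasure)
        finally show "(\<Sum>i. ?f (A i)) = ?f (\<Union>i. A i)" unfolding D .
      qed
    qed (use B sets in auto)
    then show ?thesis
      using w t unfolding fin m.emeasure_eq_measure
      by (subst ennreal_plus) (auto simp: ennreal_mult less_imp_le intro!: sum_nonneg)
  qed
  have me: "measure \<nu> B = (\<Sum>x\<in>S \<inter> B. w x) + t * measure m B" if B: "B \<in> sets borel" for B
    using em[OF B] w t by (intro measure_eq_emeasure_eq_ennreal add_nonneg_nonneg sum_nonneg) (auto intro: less_imp_le)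
  have sing: "measure \<nu> {x} = (if x \<in> S then w x else 0)" for x
    using me[of "{x}"] diff[of x] by (auto simp: measure_def)
  show at: "atoms \<nu> = S" using w by (auto simp: atoms_def sing)
  show "diffuse_part \<nu> B = t * measure m B" if B: "B \<in> sets borel"
    unfolding diffuse_part_def at me[OF B] using S by (auto simp: sing intro!: sum.cong)
qed

section \<open>Conditional laws\<close>

text \<open>Passes from events of \<open>X\<close> alone to events that also involve
  \<open>F\<close>. On rectangles the \<open>F\<close>-factor comes out of the conditional
  expectation; a Dynkin argument does the rest, with countable disjoint unions as the substantial
  case.\<close>

lemma (in finite_measure_subalgebra) real_cond_exp_disintegration:
  assumes prob: "prob_space M" and X: "X \<in> M \<rightarrow>\<^sub>M N"
    and K: "\<And>w. w \<in> space M \<Longrightarrow> prob_space (K w)" "\<And>w. w \<in> space M \<Longrightarrow> sets (K w) = sets N"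
    and cond: "\<And>A. A \<in> sets N \<Longrightarrow>
      AE w in M. real_cond_exp M F (indicator {w' \<in> space M. X w' \<in> A}) w = measure (K w) A"
    and D: "D \<in> sets (F \<Otimes>\<^sub>M N)"
  shows "AE w in M. real_cond_exp M F (indicator {w' \<in> space M. (w', X w') \<in> D}) w = measure (K w) (Pair w -` D)"
proof -
  let ?E = "real_cond_exp M F"
  interpret prob_space M by fact
  have spF: "space F = space M" and sF: "\<And>A. A \<in> sets F \<Longrightarrow> A \<in> sets M"
    using subalg by (auto simp: subalgebra_def)
  have spK: "space (K w) = space N" if "w \<in> space M" for w
    using K(2)[OF that] by (rule sets_eq_imp_space_eq)
  let ?ev = "\<lambda>D. {w' \<in> space M. (w', X w') \<in> D}"
  have pair: "(\<lambda>w. (w, X w)) \<in> M \<rightarrow>\<^sub>M F \<Otimes>\<^sub>M N"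
    using measurable_Pair[OF measurable_from_subalg[OF subalg measurable_ident_sets[OF refl]] X] .
  have ev: "?ev D \<in> sets M" if "D \<in> sets (F \<Otimes>\<^sub>M N)" for D
    using measurable_sets[OF pair that] by (simp add: vimage_def Int_def conj_commute)
  have int: "integrable M (indicator (?ev D) :: _ \<Rightarrow> real)" if "D \<in> sets (F \<Otimes>\<^sub>M N)" for D
    using ev[OF that] by (simp add: less_top[symmetric])
  have gen: "sets (F \<Otimes>\<^sub>M N) = sigma_sets (space F \<times> space N) {a \<times> b | a b. a \<in> sets F \<and> b \<in> sets N}"
    by (rule sets_pair_measure)
  have "D \<in> sigma_sets (space F \<times> space N) {a \<times> b | a b. a \<in> sets F \<and> b \<in> sets N}"
    using D gen by simp
  with Int_stable_pair_measure_generator pair_measure_closed show ?thesis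
  proof (induction rule: sigma_sets_induct_disjoint)
    case (basic D)
    then obtain a b where ab: "D = a \<times> b" "a \<in> sets F" "b \<in> sets N" by auto
    let ?b = "{w' \<in> space M. X w' \<in> b}"
    have b: "?b \<in> sets M"
      using measurable_sets[OF X ab(3)] by (simp add: vimage_def Int_def conj_commute)
    have eq: "indicator (?ev D) = (\<lambda>w. indicator a w * indicator ?b w :: real)"
      using sets.sets_into_space[OF ab(2)] spF by (auto simp: fun_eq_iff indicator_def ab(1))
    have "AE w in M. ?E (\<lambda>w. indicator a w * indicator ?b w) w = indicator a w * ?E (indicator ?b) w"
    proof (rule real_cond_exp_mult)
      show "indicator a \<in> borel_measurable F" using ab(2) by (rule borel_measurable_indicator)
      show "indicator ?b \<in> borel_measurable M" using b by (rule borel_measurable_indicator)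
      have "integrable M (indicator (a \<inter> ?b) :: _ \<Rightarrow> real)"
        using sets.Int[OF sF[OF ab(2)] b] by (simp only: integrable_indicator_iff) (simp add: less_top[symmetric])
      then show "integrable M (\<lambda>w. indicator a w * indicator ?b w :: real)"
        unfolding indicator_inter_arith[symmetric] .
    qed
    with cond[OF ab(3)] AE_space show ?case
      unfolding eq
    proof eventually_elim
      case (elim w)
      have "Pair w -` D = (if w \<in> a then b else {})" by (auto simp: ab(1))
      then show ?case using elim by (auto simp: indicator_def)
    qed
  next
    case empty
    have "AE w in M. ?E (\<lambda>_. 0) w = 0"
      by (rule real_cond_exp_F_meas) auto
    moreover have "(indicator {} :: 'a \<Rightarrow> real) = (\<lambda>_. 0)" by auto
    ultimately show ?case by simp
  next
    case (compl D)
    then have D: "D \<in> sets (F \<Otimes>\<^sub>M N)" using gen by simp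
    let ?C = "space F \<times> space N - D"
    have C: "?C \<in> sets (F \<Otimes>\<^sub>M N)" using D by (metis sets.compl_sets space_pair_measure)
    have XN: "X w \<in> space N" if "w \<in> space M" for w using measurable_space[OF X that] .
    have "AE w in M. ?E (indicator (?ev ?C)) w = ?E (\<lambda>w. 1 - indicator (?ev D) w) w"
      using ev[OF C] ev[OF D] by (intro real_cond_exp_cong AE_I2) (auto simp: indicator_def spF XN)
    moreover have "AE w in M. ?E (\<lambda>w. 1 - indicator (?ev D) w) w
        = ?E (\<lambda>_. 1) w - ?E (indicator (?ev D)) w"
      using int[OF D] by (intro real_cond_exp_diff) auto
    moreover have "AE w in M. ?E (\<lambda>_. 1) w = 1"
      by (rule real_cond_exp_F_meas) auto
    ultimately show ?case using compl.IH AE_space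
    proof eventually_elim
      case (elim w)
      interpret K: prob_space "K w" using K elim by simp
      have "Pair w -` ?C = space (K w) - Pair w -` D"
        using elim(5) by (auto simp: spF spK)
      moreover have "Pair w -` D \<in> sets (K w)"
        using sets_Pair1[OF D] K(2)[OF elim(5)] by simp
      ultimately show ?case using elim by (simp add: K.prob_compl)
    qed
  next
    case (union Ds)
    then have D: "Ds i \<in> sets (F \<Otimes>\<^sub>M N)" for i using gen by auto
    let ?A = "\<lambda>i. ?ev (Ds i)" and ?U = "?ev (\<Union>i. Ds i)"
    let ?c = "\<lambda>i. ?E (indicator (?A i))"
    have UD: "(\<Union>i. Ds i) \<in> sets (F \<Otimes>\<^sub>M N)" using D by auto
    have all: "AE w in M. \<forall>i. ?c i w = measure (K w) (Pair w -` Ds i)"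
      unfolding AE_all_countable using union.IH by blast
    have sm: "(\<lambda>i. measure (K w) (Pair w -` Ds i)) sums measure (K w) (Pair w -` (\<Union>i. Ds i))" if "w \<in> space M" for w
    proof -
      interpret K: prob_space "K w" using K that by simp
      have "disjoint_family (\<lambda>i. Pair w -` Ds i)"
        using union.hyps(1) by (auto simp: disjoint_family_on_def)
      moreover have "range (\<lambda>i. Pair w -` Ds i) \<subseteq> sets (K w)"
        using sets_Pair1[OF D] K(2)[OF that] by auto
      ultimately show ?thesis
        using K.finite_measure_UNION by (simp add: vimage_UN)
    qed
    \<comment> \<open>The candidate is built from conditional expectations rather than from
      \<open>K\<close>, which gives its \<open>F\<close>-measurability; the hypotheses say nothing
      about how \<open>K w\<close> depends on \<open>w\<close>.\<close>
    define h where "h w = (\<Sum>i. ?c i w)" for w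
    have hF: "h \<in> borel_measurable F" unfolding h_def by (intro borel_measurable_suminf) auto
    have hM: "h \<in> borel_measurable M" by (rule measurable_from_subalg[OF subalg hF])
    have hK: "AE w in M. (\<lambda>n. \<Sum>i<n. ?c i w) \<longlonglongrightarrow> h w \<and> h w = measure (K w) (Pair w -` (\<Union>i. Ds i))
        \<and> (\<forall>n. \<bar>\<Sum>i<n. ?c i w\<bar> \<le> 1)"
      using all AE_space
    proof eventually_elim
      case (elim w)
      interpret K: prob_space "K w" using K elim by simp
      have s: "(\<lambda>i. ?c i w) sums measure (K w) (Pair w -` (\<Union>i. Ds i))" using sm[OF elim(2)] elim(1) by simp
      have nn: "0 \<le> ?c i w" for i using elim by simp
      have "(\<Sum>i<n. ?c i w) \<le> 1" for n
      proof -
        have "(\<Sum>i<n. ?c i w) \<le> (\<Sum>i. ?c i w)"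
          using s nn by (intro sum_le_suminf) (auto simp: sums_iff)
        also have "\<dots> \<le> 1" using s K.prob_le_1 by (simp add: sums_iff)
        finally show ?thesis .
      qed
      moreover have "0 \<le> (\<Sum>i<n. ?c i w)" for n using nn by (intro sum_nonneg)
      moreover have h: "h w = measure (K w) (Pair w -` (\<Union>i. Ds i))" using s by (simp add: h_def sums_iff)
      moreover have "(\<lambda>n. \<Sum>i<n. ?c i w) \<longlonglongrightarrow> h w" using s unfolding h sums_def .
      ultimately show ?case by auto
    qed
    have hint: "integrable M h"
    proof (rule integrable_const_bound[where B=1])
      show "AE w in M. norm (h w) \<le> 1" using hK AE_space
      proof eventually_elim
        case (elim w)
        interpret K: prob_space "K w" using K elim by simp
        show ?case using elim by simp
      qed
    qed fact
    have "AE w in M. ?E (indicator ?U) w = h w"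
    proof (rule real_cond_exp_charact[OF _ int[OF UD] hint hF])
      fix A assume A: "A \<in> sets F"
      have AM: "A \<in> sets M" using sF A by simp
      \<comment> \<open>The characterising identity over \<open>A\<close> holds for finite sums by
        linearity. Both sides then pass to the limit under the dominating constant 1, in
        \<open>s1\<close> and \<open>s2\<close>.\<close>
      have s1: "(\<lambda>n. \<integral>w. indicator A w * (\<Sum>i<n. ?c i w) \<partial>M) \<longlonglongrightarrow> (\<integral>w. indicator A w * h w \<partial>M)"
      proof (rule integral_dominated_convergence[where w="\<lambda>_. 1"])
        show "AE w in M. (\<lambda>n. indicator A w * (\<Sum>i<n. ?c i w)) \<longlonglongrightarrow> indicator A w * h w"
          using hK by eventually_elim (auto intro: tendsto_mult_left)
        show "AE w in M. norm (indicator A w * (\<Sum>i<n. ?c i w)) \<le> 1" for n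
          using hK by eventually_elim (auto simp: indicator_def abs_mult)
      qed (use AM hM in auto)
      have s2: "(\<lambda>n. \<integral>w. indicator A w * (\<Sum>i<n. indicator (?A i) w :: real) \<partial>M) \<longlonglongrightarrow> (\<integral>w. indicator A w * indicator ?U w \<partial>M)"
      proof (rule integral_dominated_convergence[where w="\<lambda>_. 1"])
        have dj: "disjoint_family (\<lambda>i. ?A i)" using union.hyps(1) by (auto simp: disjoint_family_on_def)
        have U: "?U = (\<Union>i. ?A i)" by auto
        have sms: "(\<lambda>i. indicator (?A i) w :: real) sums indicator ?U w" for w
          unfolding U by (rule indicator_sums) (use dj in \<open>auto simp: disjoint_family_on_def\<close>)
        then show "AE w in M. (\<lambda>n. indicator A w * (\<Sum>i<n. indicator (?A i) w :: real)) \<longlonglongrightarrow> indicator A w * indicator ?U w"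
          by (intro AE_I2 tendsto_mult_left) (simp add: sums_def)
        have "(\<Sum>i<n. indicator (?A i) w :: real) \<le> 1" for n w
        proof -
          have "(\<Sum>i<n. indicator (?A i) w :: real) \<le> (\<Sum>i. indicator (?A i) w)"
            using sms[of w] by (intro sum_le_suminf) (auto simp: sums_iff)
          also have "\<dots> \<le> 1" using sms[of w] by (simp add: sums_iff indicator_def)
          finally show ?thesis .
        qed
        then show "AE w in M. norm (indicator A w * (\<Sum>i<n. indicator (?A i) w :: real)) \<le> 1" for n
          by (intro AE_I2) (simp add: indicator_def[of A] sum_nonneg)
        show "(\<lambda>w. indicator A w * (\<Sum>i<n. indicator (?A i) w :: real)) \<in> borel_measurable M" for n
          using AM ev[OF D] by measurable
        show "(\<lambda>w. indicator A w * indicator ?U w :: real) \<in> borel_measurable M"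
          using AM ev[OF UD] by measurable
      qed auto
      have "(\<integral>w. indicator A w * (\<Sum>i<n. ?c i w) \<partial>M) = (\<integral>w. indicator A w * (\<Sum>i<n. indicator (?A i) w) \<partial>M)" for n
      proof -
        have i1: "integrable M (\<lambda>w. indicator A w * indicator (?A i) w :: real)" for i
          by (intro integrable_real_mult_indicator ev[OF D]) (use AM in \<open>simp add: less_top[symmetric]\<close>)
        have i2: "integrable M (\<lambda>w. indicator A w * ?c i w)"
           "(\<integral>w. indicator A w * ?c i w \<partial>M) = (\<integral>w. indicator A w * indicator (?A i) w \<partial>M)" for i
          using real_cond_exp_intg[OF i1, of i] A ev[OF D] by auto
        show ?thesis
          unfolding sum_distrib_left Bochner_Integration.integral_sum[OF i1] Bochner_Integration.integral_sum[OF i2(1)] i2(2) ..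
      qed
      with s1 s2 have "(\<integral>w. indicator A w * indicator ?U w \<partial>M) = (\<integral>w. indicator A w * h w \<partial>M)"
        using LIMSEQ_unique by fastforce
      then show "(\<integral>w\<in>A. indicator ?U w \<partial>M) = (\<integral>w\<in>A. h w \<partial>M)"
        by (simp add: set_lebesgue_integral_def)
    qed
    with hK show ?case by eventually_elim simp
  qed
qed

lemma (in finite_measure_subalgebra) integral_mult_real_cond_exp_complex:
  fixes Y :: "'a \<Rightarrow> complex" and g :: "'a \<Rightarrow> real"
  assumes Y: "Y \<in> borel_measurable F" "\<And>w. w \<in> space M \<Longrightarrow> norm (Y w) \<le> C" and g: "integrable M g"
  shows "(\<integral>w. Y w * of_real (g w) \<partial>M) = (\<integral>w. Y w * of_real (real_cond_exp M F g w) \<partial>M)"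
proof -
  have YM: "Y \<in> borel_measurable M" by (rule measurable_from_subalg[OF subalg Y(1)])
  have i: "integrable M (\<lambda>w. Y w * of_real (f w))" if f: "integrable M f" for f
  proof (rule Bochner_Integration.integrable_bound)
    show "integrable M (\<lambda>w. C * f w)" using f by simp
    show "(\<lambda>w. Y w * of_real (f w)) \<in> borel_measurable M" using YM f by measurable
    show "AE w in M. norm (Y w * complex_of_real (f w)) \<le> norm (C * f w)"
    proof (rule AE_I2)
      fix w assume "w \<in> space M"
      then have "norm (Y w) \<le> \<bar>C\<bar>" using Y(2) by (meson abs_ge_self order_trans)
      then show "norm (Y w * complex_of_real (f w)) \<le> norm (C * f w)"
        by (simp add: norm_mult abs_mult mult_right_mono)
    qed
  qed
  have cg: "integrable M (real_cond_exp M F g)" using g by (rule real_cond_exp_int)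
  \<comment> \<open>Applied below with \<open>Re\<close> and \<open>Im\<close> for \<open>y\<close>,
    since the defining property of \<open>real_cond_exp\<close> concerns real functions.\<close>
  have part: "(\<integral>w. y (Y w) * g w \<partial>M) = (\<integral>w. y (Y w) * real_cond_exp M F g w \<partial>M)"
    if y: "y \<in> borel_measurable borel" "\<And>z. y (z * of_real a) = y z * a" "\<And>z. \<bar>y z\<bar> \<le> norm z" for y :: "complex \<Rightarrow> real" and a
  proof -
    have "integrable M (\<lambda>w. y (Y w) * g w)"
    proof (rule Bochner_Integration.integrable_bound[OF i[OF g]])
      show "AE w in M. norm (y (Y w) * g w) \<le> norm (Y w * complex_of_real (g w))"
        using y(3) by (intro AE_I2) (simp add: norm_mult abs_mult mult_right_mono)
      show "(\<lambda>w. y (Y w) * g w) \<in> borel_measurable M" using YM y(1) g by measurable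
    qed
    then show ?thesis using y(1) Y(1) g by (intro real_cond_exp_intg(2)[symmetric]) auto
  qed
  show ?thesis
  proof (rule complex_eqI)
    show "Re (\<integral>w. Y w * of_real (g w) \<partial>M) = Re (\<integral>w. Y w * of_real (real_cond_exp M F g w) \<partial>M)"
      using part[of Re] i[OF g] i[OF cg] by (simp add: integral_Re[symmetric] abs_Re_le_cmod)
    show "Im (\<integral>w. Y w * of_real (g w) \<partial>M) = Im (\<integral>w. Y w * of_real (real_cond_exp M F g w) \<partial>M)"
      using part[of Im] i[OF g] i[OF cg] by (simp add: integral_Im[symmetric] abs_Im_le_cmod)
  qed
qed

section \<open>Stable convergence\<close>

text \<open>Scaling brings in the known characteristic function of the standard normal law.\<close>

lemma gauss_eq_distr_std_normal:
  assumes "0 < v"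
  shows "gauss v = distr std_normal_distribution borel (\<lambda>x. sqrt v * x)"
proof -
  interpret real_distribution std_normal_distribution by (rule real_dist_normal_dist)
  have "distributed std_normal_distribution lborel (\<lambda>x. x) (normal_density 0 1)"
    unfolding distributed_def by (auto simp: distr_id2 measurable_ident_sets)
  then have "distributed std_normal_distribution lborel (\<lambda>x. 0 + sqrt v * x) (normal_density (0 + sqrt v * 0) (\<bar>sqrt v\<bar> * 1))"
    using assms by (intro normal_density_affine) auto
  then have "distr std_normal_distribution lborel (\<lambda>x. sqrt v * x) = density lborel (normal_density 0 (sqrt v))"
    using assms by (simp add: distributed_def)
  moreover have "distr std_normal_distribution lborel (\<lambda>x. sqrt v * x) = distr std_normal_distribution borel (\<lambda>x. sqrt v * x)"
    by (rule distr_cong) auto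
  ultimately show ?thesis using assms by (simp add: gauss_def)
qed

lemma real_distribution_gauss:
  assumes "0 < v" shows "real_distribution (gauss v)"
proof -
  interpret real_distribution std_normal_distribution by (rule real_dist_normal_dist)
  show ?thesis unfolding gauss_eq_distr_std_normal[OF assms]
    by (intro real_distribution_distr) auto
qed

lemma char_gauss:
  assumes "0 < v" shows "char (gauss v) t = of_real (exp (- (v * t\<^sup>2) / 2))"
proof -
  have "char (gauss v) t = char std_normal_distribution (t * sqrt v)"
    unfolding gauss_eq_distr_std_normal[OF assms] char_def
    by (subst integral_distr) (auto simp: mult.assoc)
  then show ?thesis using assms by (simp add: char_std_normal_distribution power_mult_distrib mult.commute)
qed

text \<open>For a fixed event \<open>H\<close> the claim is weak convergence of the laws of
  \<open>X n\<close> under the conditional probability given \<open>H\<close>, so Levy continuity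
  applies event by event.\<close>

lemma stably_conv_gaussI:
  assumes P: "prob_space P" and X: "\<And>n. X n \<in> borel_measurable P" and v: "0 < v"
    and lim: "\<And>H t. H \<in> sets P \<Longrightarrow> (\<lambda>n. \<integral>w. indicator H w * iexp (t * X n w) \<partial>P)
       \<longlonglongrightarrow> of_real (measure P H * exp (- (v * t\<^sup>2) / 2))"
  shows "stably_conv P X (\<lambda>_. gauss v)"
proof -
  interpret prob_space P by fact
  interpret g: real_distribution "gauss v" by (rule real_distribution_gauss[OF v])
  have "(\<lambda>n. (\<integral>w. f (X n w) * indicator H w \<partial>P) / measure P H)
      \<longlonglongrightarrow> (\<integral>w. (\<integral>x. f x \<partial>gauss v) * indicator H w \<partial>P) / measure P H"
    if H: "H \<in> sets P" "measure P H > 0" and f: "continuous_on UNIV f" "bounded (range f)" for H and f :: "real \<Rightarrow> real"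
  proof -
    define p where "p = measure P H"
    have p: "0 < p" using H by (simp add: p_def)
    \<comment> \<open>The conditional probability given \<open>H\<close>, written as a density with
      respect to \<open>P\<close>.\<close>
    define PH where "PH = density P (\<lambda>w. ennreal (indicator H w / p))"
    have prob: "prob_space PH"
    proof (rule prob_spaceI)
      have "emeasure PH (space PH) = (\<integral>\<^sup>+w. ennreal (indicator H w / p) \<partial>P)"
        unfolding PH_def using H(1) by (simp add: emeasure_density cong: nn_integral_cong)
      also have "\<dots> = ennreal (\<integral>w. indicator H w / p \<partial>P)"
        using p H(1) by (intro nn_integral_eq_integral integrable_divide) (auto simp: less_top[symmetric])
      also have "(\<integral>w. indicator H w / p \<partial>P) = 1" using p H(1) by (simp add: p_def)
      finally show "emeasure PH (space PH) = 1" by simp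
    qed
    interpret PH: prob_space PH by fact
    have XH: "X n \<in> borel_measurable PH" for n using X[of n] by (simp add: PH_def)
    have int: "(\<integral>w. g (X n w) \<partial>PH) = (\<integral>w. (indicator H w / p) *\<^sub>R g (X n w) \<partial>P)"
      if "g \<in> borel_measurable borel" for g :: "real \<Rightarrow> 'b::{banach, second_countable_topology}" and n
      unfolding PH_def using p H(1) X that by (intro integral_density) auto
    define \<mu> where "\<mu> n = distr PH borel (X n)" for n
    have mu: "real_distribution (\<mu> n)" for n
      unfolding \<mu>_def by (rule PH.real_distribution_distr[OF XH])
    have "weak_conv_m \<mu> (gauss v)"
    proof (rule levy_continuity[OF mu g.real_distribution_axioms])
      fix t
      let ?J = "\<lambda>n. \<integral>w. indicator H w * iexp (t * X n w) \<partial>P"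
      have "char (\<mu> n) t = ?J n / of_real p" for n
      proof -
        have "char (\<mu> n) t = (\<integral>w. iexp (t * X n w) \<partial>PH)"
          unfolding \<mu>_def char_def using XH by (subst integral_distr) auto
        also have "\<dots> = (\<integral>w. (indicator H w / p) *\<^sub>R iexp (t * X n w) \<partial>P)"
          by (rule int) measurable
        also have "\<dots> = (\<integral>w. (indicator H w * iexp (t * X n w)) / of_real p \<partial>P)"
          by (intro Bochner_Integration.integral_cong) (auto simp: scaleR_conv_of_real indicator_def)
        finally show ?thesis by simp
      qed
      moreover have "(\<lambda>n. ?J n / of_real p)
          \<longlonglongrightarrow> of_real (p * exp (- (v * t\<^sup>2) / 2)) / of_real p"
        using lim[OF H(1), of t] p unfolding p_def by (intro tendsto_divide) auto
      ultimately show "(\<lambda>n. char (\<mu> n) t) \<longlonglongrightarrow> char (gauss v) t"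
        using p by (simp add: char_gauss[OF v])
    qed
    obtain B where B: "\<And>x. norm (f x) \<le> B" using f(2) by (auto simp: bounded_iff)
    have fm: "f \<in> borel_measurable borel" using f(1) by (rule borel_measurable_continuous_onI)
    have "(\<lambda>n. integral\<^sup>L (\<mu> n) f) \<longlonglongrightarrow> integral\<^sup>L (gauss v) f"
      using mu g.real_distribution_axioms \<open>weak_conv_m \<mu> (gauss v)\<close>
    proof (rule weak_conv_imp_integral_bdd_continuous_conv)
      show "isCont f x" for x using f(1) by (simp add: continuous_on_eq_continuous_at)
    qed (rule B)
    moreover have "integral\<^sup>L (\<mu> n) f = (\<integral>w. f (X n w) * indicator H w \<partial>P) / p" for n
    proof -
      have "integral\<^sup>L (\<mu> n) f = (\<integral>w. f (X n w) \<partial>PH)"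
        unfolding \<mu>_def using XH fm by (subst integral_distr) auto
      also have "\<dots> = (\<integral>w. (f (X n w) * indicator H w) / p \<partial>P)"
        by (subst int[OF fm]) (simp add: mult.commute)
      finally show ?thesis by simp
    qed
    moreover have "(\<integral>w. (\<integral>x. f x \<partial>gauss v) * indicator H w \<partial>P) / p = integral\<^sup>L (gauss v) f"
      using p H(1) by (simp add: p_def)
    ultimately show ?thesis by (simp add: p_def)
  qed
  then show ?thesis
    unfolding stably_conv_def using g.prob_space_axioms g.events_eq_borel by auto
qed

text \<open>The functionals \<open>?J f n\<close> are bounded by \<open>B\<close> times the L1 norm
  of \<open>f\<close>, uniformly in \<open>n\<close>, so the \<open>f\<close> on which they tend to
  0 form an L1-closed linear space. This serves twice: for disjoint unions in the Dynkin step, and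
  for passing from indicators to the conditional probability of \<open>H\<close>.\<close>

lemma tendsto_integral_mult_indicator_all_events:
  fixes W :: "nat \<Rightarrow> 'w \<Rightarrow> complex"
  assumes P: "prob_space P" and F: "\<And>n. subalgebra P (F n)" "\<And>n. sets (F n) \<subseteq> sets (F (Suc n))"
    and W: "\<And>n. W n \<in> borel_measurable (F n)" and B: "\<And>n w. w \<in> space P \<Longrightarrow> norm (W n w) \<le> B"
    and lim: "\<And>k H. H \<in> sets (F k) \<Longrightarrow> (\<lambda>n. \<integral>w. indicator H w * W n w \<partial>P) \<longlonglongrightarrow> 0"
    and H: "H \<in> sets P"
  shows "(\<lambda>n. \<integral>w. indicator H w * W n w \<partial>P) \<longlonglongrightarrow> 0"
proof -
  let ?J = "\<lambda>g n. \<integral>w. g w * W n w \<partial>P"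
  interpret prob_space P by fact
  have mono: "sets (F m) \<subseteq> sets (F n)" if "m \<le> n" for m n
    using lift_Suc_mono_le[of "\<lambda>n. sets (F n)", OF F(2) that] .
  have spF: "space (F n) = space P" and sF: "sets (F n) \<subseteq> sets P" for n
    using F(1)[of n] by (auto simp: subalgebra_def)
  have WP: "W n \<in> borel_measurable P" for n by (rule measurable_from_subalg[OF F(1) W])
  obtain w0 where "w0 \<in> space P" using not_empty by auto
  then have B0: "0 \<le> B" using B[of w0 0] norm_ge_zero order_trans by blast
  let ?U = "\<Union>n. sets (F n)"
  have Usub: "?U \<subseteq> Pow (space P)" using sF sets.space_closed by blast
  define G where "G = sigma (space P) ?U"
  have spG: "space G = space P" unfolding G_def using Usub by (rule space_measure_of)
  have sG: "sets G = sigma_sets (space P) ?U" unfolding G_def using Usub by (rule sets_measure_of)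
  have GP: "sets G \<subseteq> sets P" unfolding sG using sF by (intro sets.sigma_sets_subset) auto
  have subG: "subalgebra P G" using spG GP by (simp add: subalgebra_def)
  interpret G: finite_measure_subalgebra P G by unfold_locales (rule subG)
  have FG: "subalgebra G (F n)" for n
    unfolding subalgebra_def spG spF sG by auto
  have WG: "W n \<in> borel_measurable G" for n by (rule measurable_from_subalg[OF FG W])
  have intW: "integrable P (\<lambda>w. f w * W n w)" if "integrable P f" for f :: "'w \<Rightarrow> complex" and n
  proof (rule Bochner_Integration.integrable_bound)
    show "integrable P (\<lambda>w. of_real B * f w)" using that by simp
    show "(\<lambda>w. f w * W n w) \<in> borel_measurable P" using that WP by measurable
    show "AE w in P. norm (f w * W n w) \<le> norm (of_real B * f w)"
      using B B0 by (intro AE_I2) (auto simp: norm_mult mult.commute[of B] intro!: mult_left_mono)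
  qed
  have bd: "norm (?J f n) \<le> B * (\<integral>w. norm (f w) \<partial>P)" if f: "integrable P f" for f :: "'w \<Rightarrow> complex" and n
  proof -
    have "norm (?J f n) \<le> (\<integral>w. norm (f w * W n w) \<partial>P)" by (rule integral_norm_bound)
    also have "\<dots> \<le> (\<integral>w. B * norm (f w) \<partial>P)"
    proof (rule integral_mono)
      show "integrable P (\<lambda>w. norm (f w * W n w))" using intW[OF f] by (rule integrable_norm)
      show "integrable P (\<lambda>w. B * norm (f w))" using f by simp
    qed (use B in \<open>auto simp: norm_mult mult.commute[of B] intro!: mult_left_mono\<close>)
    finally show ?thesis using f by simp
  qed
  \<comment> \<open>L1-closedness: choose the approximant \<open>s i\<close> first, uniformly in
    \<open>n\<close>, and let \<open>n\<close> grow afterwards.\<close>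
  have approx: "(?J f) \<longlonglongrightarrow> 0"
    if f: "integrable P f" and s: "\<And>i. integrable P (s i)" and L1: "(\<lambda>i. \<integral>w. norm (f w - s i w) \<partial>P) \<longlonglongrightarrow> 0"
      and ls: "\<And>i. (?J (s i)) \<longlonglongrightarrow> 0" for f :: "'w \<Rightarrow> complex" and s :: "nat \<Rightarrow> 'w \<Rightarrow> complex"
  proof (rule LIMSEQ_I)
    fix e :: real assume e: "0 < e"
    have "(\<lambda>i. B * (\<integral>w. norm (f w - s i w) \<partial>P)) \<longlonglongrightarrow> B * 0" by (intro tendsto_mult_left L1)
    then have "eventually (\<lambda>i. B * (\<integral>w. norm (f w - s i w) \<partial>P) < e / 2) sequentially"
      using e by (intro order_tendstoD(2)) auto
    then obtain i where i: "B * (\<integral>w. norm (f w - s i w) \<partial>P) < e / 2" by (auto simp: eventually_sequentially)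
    obtain N where N: "\<And>n. n \<ge> N \<Longrightarrow> norm (?J (s i) n) < e / 2"
      using LIMSEQ_D[OF ls[of i], of "e / 2"] e by auto
    show "\<exists>N. \<forall>n\<ge>N. norm ((?J f n) - 0) < e"
    proof (intro exI allI impI)
      fix n assume "N \<le> n"
      have "(?J f n) = (\<integral>w. (f w - s i w) * W n w \<partial>P) + (?J (s i) n)"
        using intW[OF f] intW[OF s] by (simp add: left_diff_distrib)
      then have "norm (?J f n) \<le> norm (\<integral>w. (f w - s i w) * W n w \<partial>P) + norm (?J (s i) n)"
        by (simp add: norm_triangle_ineq)
      also have "\<dots> < e / 2 + e / 2"
        using bd[of "\<lambda>w. f w - s i w" n] f s i N[OF \<open>N \<le> n\<close>] by (intro add_strict_mono) auto
      finally show "norm ((?J f n) - 0) < e" by simp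
    qed
  qed
  have intI: "integrable P (indicator A :: 'w \<Rightarrow> complex)" if "A \<in> sets P" for A
    using borel_measurable_indicator[OF that] by (intro integrable_const_bound[where B=1]) (auto split: split_indicator)
  have limG: "(?J (indicator A)) \<longlonglongrightarrow> 0" if "A \<in> sets G" for A
  proof -
    have IS: "Int_stable ?U"
    proof (rule Int_stableI)
      fix a b assume "a \<in> ?U" "b \<in> ?U"
      then obtain i j where "a \<in> sets (F i)" "b \<in> sets (F j)" by auto
      then have "a \<in> sets (F (max i j))" "b \<in> sets (F (max i j))" using mono[of i "max i j"] mono[of j "max i j"] by auto
      then have "a \<inter> b \<in> sets (F (max i j))" by auto
      then show "a \<inter> b \<in> ?U" by auto
    qed
    have "A \<in> sigma_sets (space P) ?U" using that sG by simp
    with IS Usub show ?thesis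
    proof (induction rule: sigma_sets_induct_disjoint)
      case (basic A)
      then show ?case using lim by auto
    next
      case empty
      then show ?case by simp
    next
      case (compl A)
      have A: "A \<in> sets P" using compl GP sG by auto
      have Om: "space P \<in> sets (F 0)" using sets.top[of "F 0"] spF by simp
      have "(?J (indicator (space P - A)) n)
          = (?J (indicator (space P)) n) - (?J (indicator A) n)" for n
        unfolding Bochner_Integration.integral_diff[OF intW[OF intI[OF sets.top]] intW[OF intI[OF A]], symmetric]
        by (rule Bochner_Integration.integral_cong) (auto split: split_indicator)
      then show ?case using tendsto_diff[OF lim[OF Om] compl.IH] by simp
    next
      case (union As)
      have As: "As i \<in> sets P" for i using union GP sG by auto
      let ?A = "\<Union>i. As i"

      show ?case
      \<comment> \<open>Finite partial unions converge in L1 to the whole union by continuity of the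
        measure from below; on them the claim is a finite sum of induction hypotheses.\<close>
      proof (rule approx[of _ "\<lambda>i. indicator (\<Union>j<i. As j)"])
        show "integrable P (indicator ?A :: 'w \<Rightarrow> complex)" using As by (intro intI) auto
        show "integrable P (indicator (\<Union>j<i. As j) :: 'w \<Rightarrow> complex)" for i using As by (intro intI) auto
        have nrm: "norm (indicator ?A w - indicator (\<Union>j<i. As j) w :: complex) = indicator (?A - (\<Union>j<i. As j)) w" for i w
          by (auto simp: indicator_def)
        have "(\<lambda>i. measure P (\<Union>j<i. As j)) \<longlonglongrightarrow> measure P (\<Union>i. \<Union>j<i. As j)"
        proof (rule finite_Lim_measure_incseq)
          show "incseq (\<lambda>i. \<Union>j<i. As j)" unfolding incseq_def by (intro allI impI UN_mono) auto
        qed (use As in auto)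
        also have "(\<Union>i. \<Union>j<i. As j) = ?A" by auto
        finally have "(\<lambda>i. measure P ?A - measure P (\<Union>j<i. As j)) \<longlonglongrightarrow> measure P ?A - measure P ?A"
          by (intro tendsto_diff tendsto_const)
        moreover have "measure P (?A - (\<Union>j<i. As j)) = measure P ?A - measure P (\<Union>j<i. As j)" for i
          using As by (intro finite_measure_Diff) auto
        moreover have "(\<integral>w. indicator (?A - (\<Union>j<i. As j)) w \<partial>P) = measure P (?A - (\<Union>j<i. As j))" for i
        proof -
          have "?A - (\<Union>j<i. As j) \<in> sets P" using As by auto
          then show ?thesis by (simp add: Int_absorb2[OF sets.sets_into_space])
        qed
        ultimately show "(\<lambda>i. \<integral>w. norm (indicator ?A w - indicator (\<Union>j<i. As j) w :: complex) \<partial>P) \<longlonglongrightarrow> 0"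
          unfolding nrm by simp
        show "(?J (indicator (\<Union>j<i. As j))) \<longlonglongrightarrow> 0" for i
        proof -
          have dj: "indicator (\<Union>j<i. As j) w = (\<Sum>j<i. indicator (As j) w :: complex)" for w
            using union.hyps(1) by (intro indicator_UN_disjoint) (auto simp: disjoint_family_on_def)
          have "(?J (indicator (\<Union>j<i. As j)) n) = (\<Sum>j<i. \<integral>w. indicator (As j) w * W n w \<partial>P)" for n
            unfolding dj sum_distrib_right using intW[OF intI[OF As]] by (intro Bochner_Integration.integral_sum) auto
          then show ?thesis using tendsto_sum[of "{..<i}", OF union.IH] by simp
        qed
      qed
    qed
  qed
  have limh: "(\<lambda>n. \<integral>w. of_real (h w) * W n w \<partial>P) \<longlonglongrightarrow> 0" if "integrable (restr_to_subalg P G) h" for h :: "'w \<Rightarrow> real"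
    using that
  proof (induction rule: integrable_induct)
    case (base A c)
    then have "A \<in> sets G" using sets_restr_to_subalg[OF subG] by simp
    from tendsto_mult_left[OF limG[OF this], of "of_real c"]
    have "(\<lambda>n. of_real c * (?J (indicator A) n)) \<longlonglongrightarrow> 0" by simp
    moreover have "of_real c * (?J (indicator A) n) = (\<integral>w. of_real (indicator A w *\<^sub>R c) * W n w \<partial>P)" for n
    proof -
      have "(\<lambda>w. of_real (indicator A w *\<^sub>R c) * W n w) = (\<lambda>w. of_real c * (indicator A w * W n w))"
        by (auto simp: fun_eq_iff split: split_indicator)
      then show ?thesis by simp
    qed
    ultimately show ?case by simp
  next
    case (add f g)
    have "integrable P (\<lambda>w. of_real (f w) :: complex)" "integrable P (\<lambda>w. of_real (g w) :: complex)"
      using add.hyps integrable_from_subalg[OF subG] by auto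
    from intW[OF this(1)] intW[OF this(2)]
    have "(\<integral>w. of_real (f w + g w) * W n w \<partial>P) = (\<integral>w. of_real (f w) * W n w \<partial>P) + (\<integral>w. of_real (g w) * W n w \<partial>P)" for n
      by (simp add: distrib_right)
    then show ?case using tendsto_add[OF add.IH] by simp
  next
    case (lim f s)
    have iP: "integrable P f" "\<And>i. integrable P (s i)"
      by (rule integrable_from_subalg[OF subG], fact lim.hyps)+
    show ?case
    proof (rule approx[of _ "\<lambda>i w. of_real (s i w)"])
      have "(\<lambda>i. \<integral>w. \<bar>f w - s i w\<bar> \<partial>P) \<longlonglongrightarrow> (\<integral>w. 0 \<partial>P)"
      \<comment> \<open>The induction rule provides approximants with modulus at most twice that of
        \<open>f\<close>, hence the factor 3.\<close>
      proof (rule integral_dominated_convergence[where w="\<lambda>w. 3 * \<bar>f w\<bar>"])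
        show "AE w in P. (\<lambda>i. \<bar>f w - s i w\<bar>) \<longlonglongrightarrow> 0"
        proof (rule AE_I2)
          fix w assume "w \<in> space P"
          then have "(\<lambda>i. s i w) \<longlonglongrightarrow> f w" using lim.hyps(2) by (simp add: space_restr_to_subalg)
          then have "(\<lambda>i. \<bar>f w - s i w\<bar>) \<longlonglongrightarrow> \<bar>f w - f w\<bar>" by (intro tendsto_intros)
          then show "(\<lambda>i. \<bar>f w - s i w\<bar>) \<longlonglongrightarrow> 0" by simp
        qed
        show "AE w in P. norm \<bar>f w - s i w\<bar> \<le> 3 * \<bar>f w\<bar>" for i
        proof (rule AE_I2)
          fix w assume "w \<in> space P"
          then have "\<bar>s i w\<bar> \<le> 2 * \<bar>f w\<bar>" using lim.hyps(3)[of w i] by (simp add: space_restr_to_subalg)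
          then show "norm \<bar>f w - s i w\<bar> \<le> 3 * \<bar>f w\<bar>" by (simp add: abs_if split: if_splits)
        qed
      qed (use iP in auto)
      then show "(\<lambda>i. \<integral>w. norm (of_real (f w) - of_real (s i w) :: complex) \<partial>P) \<longlonglongrightarrow> 0"
        unfolding of_real_diff[symmetric] norm_of_real by simp
    qed (use iP lim.IH in auto)
  qed
  have IH: "integrable P (indicator H :: 'w \<Rightarrow> real)" using H by (simp add: less_top[symmetric])
  \<comment> \<open>Every \<open>W n\<close> is measurable for \<open>G\<close>, so integrating it
    over \<open>H\<close> equals integrating it against the conditional probability of
    \<open>H\<close> given \<open>G\<close>.\<close>
  let ?h = "real_cond_exp P G (indicator H)"
  have "integrable (restr_to_subalg P G) ?h"
    using G.real_cond_exp_int(1)[OF IH] by (intro integrable_in_subalg[OF subG]) auto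
  then have "(\<lambda>n. \<integral>w. of_real (?h w) * W n w \<partial>P) \<longlonglongrightarrow> 0" by (rule limh)
  moreover have "(\<integral>w. of_real (?h w) * W n w \<partial>P) = (?J (indicator H) n)" for n
    using G.integral_mult_real_cond_exp_complex[OF WG[of n] B[of _ n] IH]
    by (simp add: mult.commute of_real_indicator)
  ultimately show ?thesis by simp
qed

section \<open>Counts with conditionally Poisson increments and their exponential martingale\<close>

lemma poi_charfun_sums:
  assumes "0 \<le> t"
  shows "(\<lambda>k. of_real (pmf (poi t) k) * iexp (s * real k)) sums exp (of_real t * (iexp s - 1))"
proof -
  have "(\<lambda>k. exp (- of_real t) * ((of_real t * iexp s) ^ k /\<^sub>R fact k)) sums (exp (- of_real t) * exp (of_real t * iexp s) :: complex)"
    by (intro sums_mult exp_converges)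
  moreover have "exp (- of_real t) * ((of_real t * iexp s) ^ k /\<^sub>R fact k) = of_real (pmf (poi t) k) * iexp (s * real k)" for k
  proof -
    have "iexp s ^ k = iexp (s * real k)" by (simp add: exp_of_nat_mult[symmetric] mult_ac)
    then show ?thesis
      using assms by (simp add: pmf_poi power_mult_distrib scaleR_conv_of_real exp_of_real[symmetric] field_simps)
  qed
  moreover have "exp (- of_real t) * exp (of_real t * iexp s) = exp (of_real t * (iexp s - 1))"
    by (simp add: exp_add[symmetric] algebra_simps)
  ultimately show ?thesis by simp
qed

text \<open>The hypothesis concerns single values of \<open>K\<close>. Truncating at
  \<open>m\<close> leaves a finite sum in which each indicator may be replaced by its conditional
  probability; dominated convergence with bound \<open>C\<close> then removes the truncation on both
  sides.\<close>

lemma (in finite_measure_subalgebra) integral_cond_poisson_charfun: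
  fixes K :: "'a \<Rightarrow> nat" and Y :: "'a \<Rightarrow> complex"
  assumes K: "K \<in> M \<rightarrow>\<^sub>M count_space UNIV"
    and lam: "lam \<in> borel_measurable F" "\<And>w. w \<in> space M \<Longrightarrow> 0 \<le> lam w"
    and cond: "\<And>k. AE w in M. real_cond_exp M F (indicator {w \<in> space M. K w = k}) w = pmf (poi (lam w)) k"
    and Y: "Y \<in> borel_measurable F" "\<And>w. w \<in> space M \<Longrightarrow> norm (Y w) \<le> C"
  shows "(\<integral>w. Y w * iexp (s * real (K w)) \<partial>M) = (\<integral>w. Y w * exp (of_real (lam w) * (iexp s - 1)) \<partial>M)"
proof -
  let ?q = "\<lambda>k w. pmf (poi (lam w)) k"
  let ?q = "\<lambda>k w. ?q k w"
  have YM: "Y \<in> borel_measurable M" by (rule measurable_from_subalg[OF subalg Y(1)])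
  have lamM: "lam \<in> borel_measurable M" by (rule measurable_from_subalg[OF subalg lam(1)])
  let ?E = "\<lambda>k. {w \<in> space M. K w = k}"
  have E: "?E k \<in> sets M" for k using K by measurable
  have KR: "(\<lambda>w. real (K w)) \<in> borel_measurable M" using K by (rule measurable_compose) simp
  have pm: "(\<lambda>w. ?q k w) \<in> borel_measurable M" for k
  proof -
    have "(\<lambda>w. lam w ^ k / fact k * exp (- lam w)) \<in> borel_measurable M" using lamM by measurable
    then show ?thesis using lam(2) by (subst measurable_cong[OF pmf_poi]) auto
  qed
  have wint: "integrable M (\<lambda>w. C)" by simp
  \<comment> \<open>\<open>A m\<close> is the exponential truncated to \<open>K w < m\<close>, and
    \<open>B m\<close> is its conditional counterpart.\<close>
  define A where "A m w = (\<Sum>k<m. iexp (s * real k) * of_real (indicator (?E k) w))" for m w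
  define B where "B m w = (\<Sum>k<m. iexp (s * real k) * of_real (?q k w))" for m w
  have A_eq: "A m w = (if K w < m then iexp (s * real (K w)) else 0)" if "w \<in> space M" for m w
  proof -
    have "A m w = (\<Sum>k<m. if k = K w then iexp (s * real k) else 0)"
      unfolding A_def using that by (intro sum.cong) auto
    also have "\<dots> = (if K w < m then iexp (s * real (K w)) else 0)" by (subst sum.delta) auto
    finally show ?thesis .
  qed
  have nB: "norm (B m w) \<le> 1" for m w
  proof -
    have "norm (B m w) \<le> (\<Sum>k<m. norm (iexp (s * real k) * of_real (?q k w)))"
      unfolding B_def by (rule norm_sum)
    also have "\<dots> = (\<Sum>k<m. ?q k w)" by (simp add: norm_mult)
    also have "\<dots> = measure (measure_pmf (poi (lam w))) {..<m}" by (simp add: measure_measure_pmf_finite)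
    also have "\<dots> \<le> 1" by (rule measure_pmf.prob_le_1)
    finally show ?thesis .
  qed
  have YC: "norm (Y w * z) \<le> C" if "w \<in> space M" "norm z \<le> 1" for w z
    using mult_left_mono[OF that(2), of "norm (Y w)"] Y(2)[OF that(1)] by (simp add: norm_mult)
  have "(\<lambda>m. \<integral>w. Y w * A m w \<partial>M) \<longlonglongrightarrow> (\<integral>w. Y w * iexp (s * real (K w)) \<partial>M)"
  proof (rule integral_dominated_convergence[where w="\<lambda>_. C"])
    show "AE w in M. (\<lambda>m. Y w * A m w) \<longlonglongrightarrow> Y w * iexp (s * real (K w))"
    proof (rule AE_I2)
      fix w assume w: "w \<in> space M"
      have "eventually (\<lambda>m. Y w * A m w = Y w * iexp (s * real (K w))) sequentially"
        using eventually_gt_at_top[of "K w"] by eventually_elim (simp add: A_eq[OF w])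
      then show "(\<lambda>m. Y w * A m w) \<longlonglongrightarrow> Y w * iexp (s * real (K w))" by (rule tendsto_eventually)
    qed
    show "AE w in M. norm (Y w * A m w) \<le> C" for m
      by (intro AE_I2 YC) (auto simp: A_eq)
    show "(\<lambda>w. Y w * A m w) \<in> borel_measurable M" for m
      unfolding A_def using YM E by (intro borel_measurable_times borel_measurable_sum borel_measurable_of_real borel_measurable_indicator) auto
    show "(\<lambda>w. Y w * iexp (s * real (K w))) \<in> borel_measurable M"
      using YM KR by measurable
  qed fact
  moreover have "(\<lambda>m. \<integral>w. Y w * B m w \<partial>M) \<longlonglongrightarrow> (\<integral>w. Y w * exp (of_real (lam w) * (iexp s - 1)) \<partial>M)"
  proof (rule integral_dominated_convergence[where w="\<lambda>_. C"])
    show "AE w in M. (\<lambda>m. Y w * B m w) \<longlonglongrightarrow> Y w * exp (of_real (lam w) * (iexp s - 1))"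
      using poi_charfun_sums[OF lam(2), of _ s]
      by (intro AE_I2 tendsto_mult_left) (auto simp: B_def sums_def mult.commute)
    show "AE w in M. norm (Y w * B m w) \<le> C" for m
      by (intro AE_I2 YC nB)
    show "(\<lambda>w. Y w * B m w) \<in> borel_measurable M" for m
      unfolding B_def using YM pm by (intro borel_measurable_times borel_measurable_sum borel_measurable_of_real) auto
    show "(\<lambda>w. Y w * exp (of_real (lam w) * (iexp s - 1))) \<in> borel_measurable M"
      using YM lamM by measurable
  qed fact
  moreover have "(\<integral>w. Y w * A m w \<partial>M) = (\<integral>w. Y w * B m w \<partial>M)" for m
  proof -
    let ?Y = "\<lambda>k w. Y w * iexp (s * real k)"
    have int: "integrable M (\<lambda>w. ?Y k w * of_real (g w))" if "g \<in> borel_measurable M" "\<And>w. \<bar>g w\<bar> \<le> 1" for k and g :: "'a \<Rightarrow> real"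
    proof (rule integrable_const_bound[where B=C])
      show "AE w in M. norm (?Y k w * of_real (g w)) \<le> C"
        unfolding mult.assoc using that(2) by (intro AE_I2 YC) (auto simp: norm_mult)
      show "(\<lambda>w. ?Y k w * of_real (g w)) \<in> borel_measurable M" using YM that(1) by measurable
    qed
    have i1: "integrable M (\<lambda>w. ?Y k w * of_real (indicator (?E k) w))" for k
      by (rule int[OF borel_measurable_indicator[OF E]]) (auto split: split_indicator)
    have i2: "integrable M (\<lambda>w. ?Y k w * of_real (?q k w))" for k
      by (rule int[OF pm]) (auto simp: pmf_le_1)
    have eq: "(\<integral>w. ?Y k w * of_real (indicator (?E k) w) \<partial>M) = (\<integral>w. ?Y k w * of_real (?q k w) \<partial>M)" for k
    proof -
      have "(\<integral>w. ?Y k w * of_real (indicator (?E k) w) \<partial>M) = (\<integral>w. ?Y k w * of_real (real_cond_exp M F (indicator (?E k)) w) \<partial>M)"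
      proof (rule integral_mult_real_cond_exp_complex)
        show "?Y k \<in> borel_measurable F" using Y(1) by measurable
        show "norm (?Y k w) \<le> C" if "w \<in> space M" for w using YC[OF that] by simp
        show "integrable M (indicator (?E k) :: _ \<Rightarrow> real)" using E by (simp add: less_top[symmetric])
      qed
      also have "\<dots> = (\<integral>w. ?Y k w * of_real (?q k w) \<partial>M)"
      proof (rule integral_cong_AE)
        show "AE w in M. ?Y k w * of_real (real_cond_exp M F (indicator (?E k)) w) = ?Y k w * of_real (?q k w)"
          using cond[of k] by eventually_elim simp
        show "(\<lambda>w. ?Y k w * of_real (real_cond_exp M F (indicator (?E k)) w)) \<in> borel_measurable M"
          using YM by (intro borel_measurable_times borel_measurable_of_real borel_measurable_cond_exp2) auto
        show "(\<lambda>w. ?Y k w * of_real (?q k w)) \<in> borel_measurable M"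
          using YM pm by (intro borel_measurable_times borel_measurable_of_real) auto
      qed
      finally show ?thesis .
    qed
    show ?thesis
      unfolding A_def B_def sum_distrib_left mult.assoc[symmetric]
        Bochner_Integration.integral_sum[OF i1] Bochner_Integration.integral_sum[OF i2] eq ..
  qed
  ultimately show ?thesis using LIMSEQ_unique by simp
qed

text \<open>The left half-plane is convex and the derivative of \<open>exp\<close> has modulus at
  most 1 on it.\<close>

lemma norm_exp_diff_le:
  fixes a b :: complex
  assumes "Re a \<le> 0" "Re b \<le> 0"
  shows "norm (exp a - exp b) \<le> norm (a - b)"
proof -
  have "convex {z. Re z \<le> 0}" by (rule convex_halfspace_Re_le)
  then have "norm (exp a - exp b) \<le> 1 * norm (a - b)"
  proof (rule field_differentiable_bound)
    show "(exp has_field_derivative exp z) (at z within {z. Re z \<le> 0})" for z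
      by (rule DERIV_exp[THEN has_field_derivative_at_within])
    show "norm (exp z) \<le> 1" if "z \<in> {z. Re z \<le> 0}" for z using that by (simp add: norm_exp_eq_Re)
  qed (use assms in auto)
  then show ?thesis by simp
qed

text \<open>Taylor expansion of \<open>iexp s\<close> to second order. With
  \<open>s\<^sup>2 = t\<^sup>2 / a\<close> the exponents differ by a linear and a quadratic multiple
  of \<open>V - v * a\<close> plus the cubic remainder times \<open>V\<close>. Both exponents have
  nonpositive real part, so \<open>exp\<close> does not enlarge the difference.\<close>

lemma norm_exp_poisson_compensator_diff:
  fixes a V C v t :: real
  assumes a: "1 \<le> a" and V: "0 \<le> V" "V \<le> C * a" and v: "0 \<le> v"
  defines "s \<equiv> t / sqrt a"
  shows "norm (exp ((iexp s - 1) * of_real V - \<i> * of_real (s * v * a)) - of_real (exp (- (v * t\<^sup>2) / 2)))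
    \<le> (\<bar>t\<bar> + t\<^sup>2 / 2) * (\<bar>V - v * a\<bar> / sqrt a) + C * \<bar>t\<bar> ^ 3 / (6 * sqrt a)"
proof -
  define d where "d = \<bar>V - v * a\<bar>"
  define h where "h = iexp s - (1 + \<i> * of_real s - of_real (s\<^sup>2 / 2))"
  have sa: "1 \<le> sqrt a" "sqrt a * sqrt a = a" "sqrt a \<le> a"
  proof -
    show 1: "1 \<le> sqrt a" "sqrt a * sqrt a = a" using a by auto
    then show "sqrt a \<le> a" by (metis mult_left_mono mult.right_neutral order_trans zero_le_one)
  qed
  have s2: "s\<^sup>2 = t\<^sup>2 / a" using a by (simp add: s_def power_divide)
  have r: "norm h \<le> \<bar>s\<bar> ^ 3 / 6"
    using iexp_approx1[of s 2]
    by (simp add: h_def atMost_Suc numeral_2_eq_2 numeral_3_eq_3 fact_numeral algebra_simps power2_eq_square)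
  let ?D = "(iexp s - 1) * of_real V - \<i> * of_real (s * v * a)"
  have "?D - of_real (- (v * t\<^sup>2) / 2) = \<i> * of_real (s * (V - v * a)) + h * of_real V - of_real (t\<^sup>2 / (2 * a) * (V - v * a))"
  proof -
    have "- (s\<^sup>2 / 2 * V) + v * t\<^sup>2 / 2 = - (t\<^sup>2 / (2 * a) * (V - v * a))"
      using a by (simp add: s2 field_simps)
    from arg_cong[where f=complex_of_real, OF this]
    have "- (of_real (s\<^sup>2 / 2) * of_real V) + of_real (v * t\<^sup>2 / 2) = - complex_of_real (t\<^sup>2 / (2 * a) * (V - v * a))" by simp
    then show ?thesis unfolding h_def by (simp add: algebra_simps)
  qed
  moreover have "norm (A + B - E) \<le> norm A + norm B + norm E" for A B E :: complex
    using norm_triangle_ineq4[of "A + B" E] norm_triangle_ineq[of A B] by linarith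
  ultimately have "norm (?D - of_real (- (v * t\<^sup>2) / 2))
      \<le> norm (\<i> * complex_of_real (s * (V - v * a))) + norm (h * of_real V) + norm (complex_of_real (t\<^sup>2 / (2 * a) * (V - v * a)))"
    by (simp only:)
  also have "\<dots> = \<bar>s\<bar> * d + norm h * V + t\<^sup>2 / (2 * a) * d"
    using V a by (simp add: norm_mult abs_mult d_def del: of_real_mult of_real_diff of_real_divide)
  also have "\<bar>s\<bar> * d = \<bar>t\<bar> * (d / sqrt a)" using a by (simp add: s_def abs_divide)
  also have "norm h * V \<le> C * \<bar>t\<bar> ^ 3 / (6 * sqrt a)"
  proof -
    have "norm h * V \<le> \<bar>s\<bar> ^ 3 / 6 * (C * a)" using r V by (intro mult_mono) auto
    also have "\<bar>s\<bar> ^ 3 = \<bar>t\<bar> ^ 3 / (a * sqrt a)"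
      using a sa by (simp add: s_def abs_divide power_divide power3_eq_cube)
    also have "\<bar>t\<bar> ^ 3 / (a * sqrt a) / 6 * (C * a) = C * \<bar>t\<bar> ^ 3 / (6 * sqrt a)" using a by (simp add: mult.commute)
    finally show ?thesis .
  qed
  \<comment> \<open>As \<open>a \<ge> 1\<close>, the quadratic term may be bounded on the same scale
    \<open>sqrt a\<close> as the linear one.\<close>
  also have "t\<^sup>2 / (2 * a) * d \<le> t\<^sup>2 / 2 * (d / sqrt a)"
  proof -
    have "d / a \<le> d / sqrt a" using sa a by (intro divide_left_mono) (auto simp: d_def)
    then have "t\<^sup>2 / 2 * (d / a) \<le> t\<^sup>2 / 2 * (d / sqrt a)" by (intro mult_left_mono) auto
    then show ?thesis by simp
  qed
  finally have *: "norm (?D - of_real (- (v * t\<^sup>2) / 2)) \<le> (\<bar>t\<bar> + t\<^sup>2 / 2) * (d / sqrt a) + C * \<bar>t\<bar> ^ 3 / (6 * sqrt a)"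
    by (simp add: algebra_simps)
  have "Re ?D = (cos s - 1) * V" by (simp add: exp_of_real cis.simps exp_eq_polar Re_exp)
  also have "\<dots> \<le> 0" using V by (intro mult_nonpos_nonneg) auto
  finally have "norm (exp ?D - exp (of_real (- (v * t\<^sup>2) / 2))) \<le> norm (?D - of_real (- (v * t\<^sup>2) / 2))"
    using v by (intro norm_exp_diff_le) auto
  with * show ?thesis unfolding exp_of_real d_def by linarith
qed

text \<open>The deterministic bounds \<open>b\<close> make \<open>U s n\<close> bounded for each
  fixed \<open>n\<close>, which settles integrability and the dominated limit at a fixed
  time.\<close>

locale conditionally_poisson_counts = prob_space P for P :: "'w measure" +
  fixes F :: "nat \<Rightarrow> 'w measure" and L :: "nat \<Rightarrow> 'w \<Rightarrow> nat" and lam :: "nat \<Rightarrow> 'w \<Rightarrow> real" and b :: "nat \<Rightarrow> real"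
  assumes subalgebra_F: "\<And>n. subalgebra P (F n)"
    and F_mono: "\<And>n. sets (F n) \<subseteq> sets (F (Suc n))"
    and L_measurable: "\<And>n. L n \<in> F n \<rightarrow>\<^sub>M count_space UNIV"
    and L_mono: "\<And>n w. w \<in> space P \<Longrightarrow> L n w \<le> L (Suc n) w"
    and lam_measurable: "\<And>n. lam n \<in> borel_measurable (F n)"
    and lam_nonneg: "\<And>n w. w \<in> space P \<Longrightarrow> 0 \<le> lam n w"
    and lam_le: "\<And>n w. w \<in> space P \<Longrightarrow> lam n w \<le> b n"
    and increment_law: "\<And>n k. AE w in P.
      real_cond_exp P (F n) (indicator {w \<in> space P. L (Suc n) w - L n w = k}) w = pmf (poi (lam n w)) k"
begin

definition V :: "nat \<Rightarrow> 'w \<Rightarrow> real" where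
  "V n w = (\<Sum>j<n. lam j w)"

definition U :: "real \<Rightarrow> nat \<Rightarrow> 'w \<Rightarrow> complex" where
  "U s n w = exp (\<i> * of_real (s * real (L n w)) - (iexp s - 1) * of_real (V n w))"

lemma F_mono_le: "m \<le> n \<Longrightarrow> subalgebra (F n) (F m)"
  using lift_Suc_mono_le[of "\<lambda>n. sets (F n)", OF F_mono] subalgebra_F by (auto simp: subalgebra_def)

lemma V_measurable: "V n \<in> borel_measurable (F n)"
proof -
  have "lam j \<in> borel_measurable (F n)" if "j < n" for j
    using that by (intro measurable_from_subalg[OF F_mono_le lam_measurable]) auto
  then show ?thesis unfolding V_def[abs_def] by (intro borel_measurable_sum) auto
qed

lemma L_real_measurable: "(\<lambda>w. real (L n w)) \<in> borel_measurable (F n)"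
  using L_measurable by (rule measurable_compose) simp

lemma U_measurable: "U s n \<in> borel_measurable (F n)"
  unfolding U_def[abs_def] using V_measurable[of n] L_real_measurable[of n] by measurable

lemma measurable_from_F: "f \<in> borel_measurable (F n) \<Longrightarrow> f \<in> borel_measurable P"
  by (rule measurable_from_subalg[OF subalgebra_F])

lemma V_nonneg: "w \<in> space P \<Longrightarrow> 0 \<le> V n w"
  unfolding V_def by (intro sum_nonneg lam_nonneg)

lemma V_le: "w \<in> space P \<Longrightarrow> V n w \<le> (\<Sum>j<n. b j)"
  unfolding V_def by (intro sum_mono lam_le)

lemma integrable_V: "integrable P (V n)"
  using V_le V_nonneg measurable_from_F[OF V_measurable]
  by (intro integrable_const_bound[where B="\<Sum>j<n. b j"]) auto

lemma norm_U: "norm (U s n w) = exp ((1 - cos s) * V n w)"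
  unfolding U_def norm_exp_eq_Re by (simp add: Re_exp algebra_simps)

lemma norm_U_le: "w \<in> space P \<Longrightarrow> norm (U s n w) \<le> exp (2 * (\<Sum>j<n. b j))"
proof -
  assume w: "w \<in> space P"
  have "(1 - cos s) * V n w \<le> 2 * (\<Sum>j<n. b j)"
    using V_le[OF w] V_nonneg[OF w] cos_ge_minus_one[of s] by (intro mult_mono) auto
  then show ?thesis by (simp add: norm_U)
qed

text \<open>From 1 - cos s = 2 sin(s/2)^2. With \<open>s\<close> of order
  \<open>1 / sqrt (a n)\<close> and \<open>V\<close> of order \<open>a n\<close> the exponent stays
  bounded in \<open>n\<close>, whereas the bound in \<open>norm_U_le\<close> depends on the sum of
  the \<open>b j\<close>.\<close>

lemma norm_U_le_square: "w \<in> space P \<Longrightarrow> norm (U s n w) \<le> exp (s\<^sup>2 / 2 * V n w)"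
proof -
  assume w: "w \<in> space P"
  have "(sin (s / 2))\<^sup>2 \<le> (s / 2)\<^sup>2" using abs_sin_x_le_abs_x[of "s / 2"] by (rule abs_le_square_iff[THEN iffD1])
  then have "1 - cos s \<le> s\<^sup>2 / 2" using cos_double_sin[of "s / 2"] by (simp add: power_divide)
  from mult_right_mono[OF this V_nonneg[OF w, of n]] show ?thesis
    unfolding norm_U exp_le_cancel_iff .
qed

lemma integrable_indicator_U:
  assumes "H \<in> sets P" shows "integrable P (\<lambda>w. indicator H w * U s n w)"
proof (rule integrable_const_bound[where B="exp (2 * (\<Sum>j<n. b j))"])
  show "AE w in P. norm (indicator H w * U s n w) \<le> exp (2 * (\<Sum>j<n. b j))"
    using norm_U_le by (intro AE_I2) (auto split: split_indicator)
  show "(\<lambda>w. indicator H w * U s n w) \<in> borel_measurable P"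
    using assms measurable_from_F[OF U_measurable] by (intro borel_measurable_times borel_measurable_indicator)
qed

text \<open>\<^term>\<open>U s\<close> is the exponential martingale of the compensated counts.\<close>

lemma integral_U_Suc:
  assumes H: "H \<in> sets (F n)"
  shows "(\<integral>w. indicator H w * U s (Suc n) w \<partial>P) = (\<integral>w. indicator H w * U s n w \<partial>P)"
proof -
  interpret F: finite_measure_subalgebra P "F n" by unfold_locales (rule subalgebra_F)
  \<comment> \<open>The compensator up to \<open>Suc n\<close> is already known at time
    \<open>n\<close>; it is collected in \<open>Y\<close>, so that \<open>U s (Suc n)\<close> on
    \<open>H\<close> is \<open>Y\<close> times the exponential of the increment.\<close>
  define Y where "Y w = indicator H w * U s n w * exp (- ((iexp s - 1) * of_real (lam n w)))" for w
  have K: "(\<lambda>w. L (Suc n) w - L n w) \<in> P \<rightarrow>\<^sub>M count_space UNIV"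
  proof -
    have [measurable]: "L j \<in> P \<rightarrow>\<^sub>M count_space UNIV" for j
      by (rule measurable_from_subalg[OF subalgebra_F L_measurable])
    show ?thesis by measurable
  qed
  have Y1: "Y \<in> borel_measurable (F n)"
    unfolding Y_def[abs_def] using H U_measurable[of s n] lam_measurable[of n] by measurable
  have Y2: "norm (Y w) \<le> exp (2 * (\<Sum>j<n. b j)) * exp (2 * b n)" if w: "w \<in> space P" for w
  proof -
    have "norm (exp (- ((iexp s - 1) * of_real (lam n w)))) = exp ((1 - cos s) * lam n w)"
      by (simp add: norm_exp_eq_Re Re_exp algebra_simps)
    also have "(1 - cos s) * lam n w \<le> 2 * b n"
      using lam_le[OF w, of n] lam_nonneg[OF w, of n] cos_ge_minus_one[of s] by (intro mult_mono) auto
    finally have "norm (exp (- ((iexp s - 1) * of_real (lam n w)))) \<le> exp (2 * b n)" by simp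
    then show ?thesis unfolding Y_def norm_mult using norm_U_le[OF w, of s n]
      by (intro mult_mono) (auto split: split_indicator)
  qed
  have "(\<integral>w. Y w * iexp (s * real (L (Suc n) w - L n w)) \<partial>P) = (\<integral>w. Y w * exp (of_real (lam n w) * (iexp s - 1)) \<partial>P)"
    by (rule F.integral_cond_poisson_charfun[OF K lam_measurable lam_nonneg increment_law Y1 Y2])
  moreover have "(\<integral>w. Y w * iexp (s * real (L (Suc n) w - L n w)) \<partial>P) = (\<integral>w. indicator H w * U s (Suc n) w \<partial>P)"
  proof (rule Bochner_Integration.integral_cong[OF refl])
    fix w assume "w \<in> space P"
    then have "real (L (Suc n) w - L n w) = real (L (Suc n) w) - real (L n w)" using L_mono by (simp add: of_nat_diff)
    then have "U s n w * exp (- ((iexp s - 1) * of_real (lam n w))) * iexp (s * real (L (Suc n) w - L n w)) = U s (Suc n) w"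
      unfolding U_def exp_add[symmetric] by (simp add: V_def algebra_simps)
    then show "Y w * iexp (s * real (L (Suc n) w - L n w)) = indicator H w * U s (Suc n) w"
      by (simp add: Y_def mult.assoc)
  qed
  moreover have "(\<integral>w. Y w * exp (of_real (lam n w) * (iexp s - 1)) \<partial>P) = (\<integral>w. indicator H w * U s n w \<partial>P)"
    by (rule Bochner_Integration.integral_cong[OF refl]) (simp add: Y_def mult.assoc exp_add[symmetric])
  ultimately show ?thesis by simp
qed

lemma integral_U_eq:
  assumes H: "H \<in> sets (F k)" and "k \<le> n"
  shows "(\<integral>w. indicator H w * U s n w \<partial>P) = (\<integral>w. indicator H w * U s k w \<partial>P)"
  using \<open>k \<le> n\<close>
proof (induction n rule: dec_induct)
  case (step n)
  then have "H \<in> sets (F n)" using H F_mono_le[of k n] by (auto simp: subalgebra_def)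
  then show ?case using step integral_U_Suc by simp
qed simp

text \<open>The exponential of the normalised count is \<open>U * D\<close>, where \<open>D\<close>
  approaches the Gaussian constant \<open>q\<close>. It is split as
  \<open>U * (D - q) + q * (U - 1) + q\<close>: the first term is small in mean by the L1
  hypothesis, the second by the martingale property extended to all events.\<close>

theorem stably_conv_counts:
  assumes a: "filterlim a at_top sequentially" and v: "0 < v"
    and Va: "eventually (\<lambda>n. \<forall>w\<in>space P. V n w \<le> C * a n) sequentially"
    and L1: "(\<lambda>n. (\<integral>w. \<bar>V n w - v * a n\<bar> \<partial>P) / sqrt (a n)) \<longlonglongrightarrow> 0"
  shows "stably_conv P (\<lambda>n w. sqrt (a n) * (real (L n w) / a n - v)) (\<lambda>_. gauss v)"
proof (rule stably_conv_gaussI)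
  let ?I = "\<lambda>H. \<integral>w. indicator H w \<partial>P"
  let ?J = "\<lambda>H f. \<integral>w. indicator H w * f w \<partial>P"
  let ?X = "\<lambda>n w. sqrt (a n) * (real (L n w) / a n - v)"
  show "prob_space P" by (rule prob_space_axioms)
  show "0 < v" by fact
  show "(\<lambda>w. ?X n w) \<in> borel_measurable P" for n
    using measurable_from_F[OF L_real_measurable[of n]] by measurable
  fix H t assume H: "H \<in> sets P"
  define s where "s n = t / sqrt (a n)" for n
  define q where "q = complex_of_real (exp (- (v * t\<^sup>2) / 2))"
  have "eventually (\<lambda>n. 1 \<le> a n) sequentially" using a by (simp add: filterlim_at_top)
  with Va have "eventually (\<lambda>n. 1 \<le> a n \<and> (\<forall>w\<in>space P. V n w \<le> C * a n)) sequentially"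
    by eventually_elim simp
  then obtain N where N: "\<And>n. n \<ge> N \<Longrightarrow> 1 \<le> a n" "\<And>n w. n \<ge> N \<Longrightarrow> w \<in> space P \<Longrightarrow> V n w \<le> C * a n"
    unfolding eventually_sequentially by blast
  have sq: "filterlim (\<lambda>n. sqrt (a n)) at_top sequentially" using filterlim_compose[OF sqrt_at_top a] .
  have s0: "s \<longlonglongrightarrow> 0" unfolding s_def by (rule real_tendsto_divide_at_top[OF tendsto_const sq])
  define B where "B = exp (t\<^sup>2 * C / 2)"
  have UB: "norm (U (s n) n w) \<le> B" if "n \<ge> N" "w \<in> space P" for n w
  proof -
    have "(s n)\<^sup>2 / 2 * V n w \<le> (s n)\<^sup>2 / 2 * (C * a n)" using N(2)[OF that] by (intro mult_left_mono) auto
    also have "\<dots> = t\<^sup>2 * C / 2" using N(1)[OF that(1)] by (simp add: s_def power_divide)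
    finally have "exp ((s n)\<^sup>2 / 2 * V n w) \<le> B" unfolding B_def by simp
    then show ?thesis using norm_U_le_square[OF that(2), of "s n" n] by linarith
  qed
  \<comment> \<open>Set to 0 before \<open>N\<close> so that one bound holds for every
    \<open>n\<close>.\<close>
  define W where "W n w = (if N \<le> n then U (s n) n w - 1 else 0)" for n w
  have W0: "(\<lambda>n. ?J H (W n)) \<longlonglongrightarrow> 0"
  proof (rule tendsto_integral_mult_indicator_all_events[where F=F and B="B + 1"])
    show "W n \<in> borel_measurable (F n)" for n
      unfolding W_def[abs_def] using U_measurable[of "s n" n] by (cases "N \<le> n") auto
    show "norm (W n w) \<le> B + 1" if "w \<in> space P" for n w
      using norm_triangle_ineq4[of "U (s n) n w" 1] UB[OF _ that, of n] by (auto simp: W_def B_def)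
    fix k H' assume H': "H' \<in> sets (F k)"
    then have HP: "H' \<in> sets P" using subalgebra_F[of k] by (auto simp: subalgebra_def)
    \<comment> \<open>Time is frozen at \<open>k\<close> while the frequency \<open>s n\<close>
      tends to 0; \<open>integral_U_eq\<close> then moves the integral from \<open>k\<close> to
      \<open>n\<close>.\<close>
    have "(\<lambda>n. ?J H' (U (s n) k)) \<longlonglongrightarrow> ?J H' (U 0 k)"
    proof (rule integral_dominated_convergence[where w="\<lambda>_. exp (2 * (\<Sum>j<k. b j))"])
      show "AE w in P. (\<lambda>n. indicator H' w * U (s n) k w) \<longlonglongrightarrow> indicator H' w * U 0 k w"
        unfolding U_def using s0 by (intro AE_I2 tendsto_intros) auto
      show "AE w in P. norm (indicator H' w * U (s n) k w) \<le> exp (2 * (\<Sum>j<k. b j))" for n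
        using norm_U_le by (intro AE_I2) (auto split: split_indicator)
    qed (use integrable_indicator_U[OF HP] in auto)
    then have "(\<lambda>n. ?J H' (U (s n) k) - ?I H') \<longlonglongrightarrow>
        ?J H' (U 0 k) - ?I H'"
      by (intro tendsto_diff tendsto_const)
    also have "?J H' (U 0 k) = ?I H'" by (simp add: U_def)
    finally have "(\<lambda>n. ?J H' (U (s n) k) - ?I H') \<longlonglongrightarrow> 0" by simp
    moreover have "eventually (\<lambda>n. ?J H' (U (s n) k) - ?I H'
        = ?J H' (W n)) sequentially"
      using eventually_ge_at_top[of "max N k"]
    proof eventually_elim
      case (elim n)
      have "integrable P (indicator H' :: 'w \<Rightarrow> complex)"
        using integrable_indicator_U[OF HP, of 0 k] by (simp add: U_def)
      then have "?J H' (U (s n) n) - ?I H'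
          = (\<integral>w. indicator H' w * U (s n) n w - indicator H' w \<partial>P)"
        using integrable_indicator_U[OF HP] by (intro Bochner_Integration.integral_diff[symmetric]) auto
      then show ?case using elim integral_U_eq[OF H', of n "s n"] by (simp add: W_def right_diff_distrib)
    qed
    ultimately show "(\<lambda>n. ?J H' (W n)) \<longlonglongrightarrow> 0" by (rule Lim_transform_eventually)
  qed (use H prob_space_axioms subalgebra_F F_mono in auto)
  \<comment> \<open>Contains the compensator and the centring, so that
    \<open>U (s n) n w * D n w\<close> is the exponential of the normalised count.\<close>
  define D where "D n w = exp ((iexp (s n) - 1) * of_real (V n w) - \<i> * of_real (s n * v * a n))" for n w
  define R where "R n = (\<integral>w. indicator H w * U (s n) n w * (D n w - q) \<partial>P)" for n
  let ?t = "\<bar>t\<bar> + t\<^sup>2 / 2" and ?r = "\<lambda>n. C * \<bar>t\<bar> ^ 3 / (6 * sqrt (a n))"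
  define e where "e n = B * (?t * ((\<integral>w. \<bar>V n w - v * a n\<bar> \<partial>P) / sqrt (a n)) + ?r n)" for n
  have Dm: "D n \<in> borel_measurable P" for n
    unfolding D_def[abs_def] using measurable_from_F[OF V_measurable[of n]] by measurable
  have nR: "norm (R n) \<le> e n" "integrable P (\<lambda>w. indicator H w * U (s n) n w * (D n w - q))" if n: "n \<ge> N" for n
  proof -
    let ?w = "\<lambda>w. B * (?t * (\<bar>V n w - v * a n\<bar> / sqrt (a n)) + ?r n)"
    have iw: "integrable P ?w" using integrable_V[of n] by auto
    have le: "norm (indicator H w * U (s n) n w * (D n w - q)) \<le> ?w w" if w: "w \<in> space P" for w
    proof -
      have "norm (D n w - q) \<le> ?t * (\<bar>V n w - v * a n\<bar> / sqrt (a n)) + ?r n"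
        unfolding D_def s_def q_def
        using N(1)[OF n] N(2)[OF n w] V_nonneg[OF w] v by (intro norm_exp_poisson_compensator_diff) auto
      moreover have "norm (indicator H w * U (s n) n w) \<le> B"
        using UB[OF n w] by (auto simp: B_def split: split_indicator)
      ultimately show ?thesis unfolding norm_mult[of _ "D n w - q"] by (intro mult_mono) (auto simp: B_def)
    qed
    show int: "integrable P (\<lambda>w. indicator H w * U (s n) n w * (D n w - q))"
    proof (rule Bochner_Integration.integrable_bound[OF iw])
      show "(\<lambda>w. indicator H w * U (s n) n w * (D n w - q)) \<in> borel_measurable P"
        using H Dm[of n] measurable_from_F[OF U_measurable[of "s n" n]] by measurable
      show "AE w in P. norm (indicator H w * U (s n) n w * (D n w - q)) \<le> norm (?w w)"
      proof (rule AE_I2)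
        fix w assume "w \<in> space P"
        from le[OF this] show "norm (indicator H w * U (s n) n w * (D n w - q)) \<le> norm (?w w)"
          unfolding real_norm_def by (rule order_trans[OF _ abs_ge_self])
      qed
    qed
    have "norm (R n) \<le> (\<integral>w. norm (indicator H w * U (s n) n w * (D n w - q)) \<partial>P)"
      unfolding R_def by (rule integral_norm_bound)
    also have "\<dots> \<le> (\<integral>w. ?w w \<partial>P)" using int iw le by (intro integral_mono integrable_norm)
    also have "\<dots> = e n" using integrable_V[of n] by (simp add: e_def prob_space)
    finally show "norm (R n) \<le> e n" .
  qed
  have e0: "e \<longlonglongrightarrow> 0"
  proof -
    have "(\<lambda>n. ?r n) \<longlonglongrightarrow> 0"
      by (intro real_tendsto_divide_at_top[OF tendsto_const] filterlim_tendsto_pos_mult_at_top[OF tendsto_const _ sq]) auto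
    with L1 have "e \<longlonglongrightarrow> B * (?t * 0 + 0)" unfolding e_def by (intro tendsto_intros)
    then show ?thesis by simp
  qed
  have R0: "R \<longlonglongrightarrow> 0"
    by (rule Lim_null_comparison[OF _ e0]) (use nR(1) in \<open>auto simp: eventually_sequentially\<close>)
  have "(\<lambda>n. R n + q * ?J H (W n) + q * of_real (measure P H)) \<longlonglongrightarrow> 0 + q * 0 + q * of_real (measure P H)"
    by (intro tendsto_intros R0 W0)
  moreover have "eventually (\<lambda>n. R n + q * ?J H (W n) + q * of_real (measure P H)
      = (\<integral>w. indicator H w * iexp (t * (?X n w)) \<partial>P)) sequentially"
    using eventually_ge_at_top[of N]
  proof eventually_elim
    case (elim n)
    have ra: "sqrt (a n) * sqrt (a n) = a n" "0 < a n" using N(1)[OF elim] by auto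
    have iI: "integrable P (indicator H :: 'w \<Rightarrow> complex)"
      using integrable_indicator_U[OF H, of 0 0] by (simp add: U_def)
    have iW: "integrable P (\<lambda>w. indicator H w * W n w)"
      using integrable_indicator_U[OF H, of "s n" n] iI elim by (simp add: W_def right_diff_distrib)
    have "(\<integral>w. indicator H w * iexp (t * (?X n w)) \<partial>P)
       = (\<integral>w. indicator H w * U (s n) n w * (D n w - q) + q * (indicator H w * W n w) + q * indicator H w \<partial>P)"
    proof (rule Bochner_Integration.integral_cong[OF refl])
      fix w assume "w \<in> space P"
      have "t * (x * (y / (x * x) - v)) = t / x * y - t / x * v * (x * x)" if "0 < x" for x y
        using that by (simp add: field_simps)
      from this[of "sqrt (a n)" "real (L n w)"]
      have eq: "t * (?X n w) = s n * real (L n w) - s n * v * a n"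
        using ra(2) unfolding ra(1) s_def by simp
      have "iexp (t * (?X n w)) = U (s n) n w * D n w"
        unfolding eq U_def D_def exp_add[symmetric] by (simp add: algebra_simps)
      then show "indicator H w * iexp (t * (?X n w))
         = indicator H w * U (s n) n w * (D n w - q) + q * (indicator H w * W n w) + q * indicator H w"
        using elim by (simp add: W_def algebra_simps)
    qed
    also have "\<dots> = R n + q * ?J H (W n) + q * (\<integral>w. indicator H w \<partial>P)"
      using nR(2)[OF elim] iW iI by (simp add: R_def)
    also have "(\<integral>w. indicator H w \<partial>P) = complex_of_real (measure P H)"
    proof -
      have "(\<integral>w. indicator H w \<partial>P) = (\<integral>w. complex_of_real (indicator H w) \<partial>P)"
        by (intro Bochner_Integration.integral_cong) (auto split: split_indicator)
      also have "\<dots> = complex_of_real (\<integral>w. indicator H w \<partial>P)" by (rule integral_complex_of_real)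
      finally show ?thesis using H by simp
    qed
    finally show ?case by simp
  qed
  ultimately have "(\<lambda>n. \<integral>w. indicator H w * iexp (t * (?X n w)) \<partial>P)
      \<longlonglongrightarrow> 0 + q * 0 + q * of_real (measure P H)"
    by (rule Lim_transform_eventually)
  then show "(\<lambda>n. \<integral>w. indicator H w * iexp (t * (?X n w)) \<partial>P)
      \<longlonglongrightarrow> of_real (measure P H * exp (- (v * t\<^sup>2) / 2))"
    by (simp add: q_def mult.commute)
qed

end

section \<open>Asymptotics of the intensities\<close>

text \<open>Wendel's inequality, from log-convexity of Gamma: \<open>y + \<beta>\<close> lies
  between \<open>y\<close> and \<open>y + 1\<close> for the upper bound, and \<open>y + 1\<close>
  between \<open>y + \<beta>\<close> and \<open>y + \<beta> + 1\<close> for the lower one.\<close>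

lemma Gamma_ratio_bounds:
  fixes y \<beta> :: real
  assumes y: "0 < y" and b: "0 \<le> \<beta>" "\<beta> < 1"
  shows "(y + \<beta>) powr (\<beta> - 1) \<le> Gamma (y + \<beta>) / Gamma (y + 1)"
    and "Gamma (y + \<beta>) / Gamma (y + 1) \<le> y powr (\<beta> - 1)"
proof -
  have conv: "ln (Gamma ((1 - l) * x + l * z)) \<le> (1 - l) * ln (Gamma x) + l * ln (Gamma z)"
    if "0 < x" "0 < z" "0 \<le> l" "l \<le> 1" for x z l :: real
    using convex_onD[OF log_convex_Gamma_real, of l x z] that by simp
  have lnG: "ln (Gamma (x + 1)) = ln x + ln (Gamma x)" if "0 < x" for x :: real
  proof -
    have "Gamma (x + 1) = x * Gamma x" using that by (intro Gamma_plus1) (auto elim!: nonpos_Ints_cases)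
    then show ?thesis using that Gamma_real_pos[OF that] by (simp add: ln_mult_pos)
  qed
  have G: "0 < Gamma (y + \<beta>)" "0 < Gamma (y + 1)" using y b by (auto intro!: Gamma_real_pos)
  define q where "q = Gamma (y + \<beta>) / Gamma (y + 1)"
  have q: "0 < q" "ln q = ln (Gamma (y + \<beta>)) - ln (Gamma (y + 1))"
    using G by (auto simp: q_def ln_div)
  have "(1 - \<beta>) * y + \<beta> * (y + 1) = y + \<beta>" by (simp add: algebra_simps)
  with conv[of y "y + 1" \<beta>] have "ln (Gamma (y + \<beta>)) \<le> (1 - \<beta>) * ln (Gamma y) + \<beta> * ln (Gamma (y + 1))"
    using y b by simp
  then have "ln q \<le> (\<beta> - 1) * ln y" using lnG[OF y] q by (simp add: algebra_simps)
  have "q = exp (ln q)" using q(1) by simp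
  also have "\<dots> \<le> exp ((\<beta> - 1) * ln y)"
    using \<open>ln q \<le> (\<beta> - 1) * ln y\<close> by (rule exp_le_cancel_iff[THEN iffD2])
  also have "\<dots> = y powr (\<beta> - 1)" using y by (simp add: powr_def)
  finally show "Gamma (y + \<beta>) / Gamma (y + 1) \<le> y powr (\<beta> - 1)" unfolding q_def .
  have "(1 - (1 - \<beta>)) * (y + \<beta>) + (1 - \<beta>) * (y + \<beta> + 1) = y + 1" by (simp add: algebra_simps)
  with conv[of "y + \<beta>" "y + \<beta> + 1" "1 - \<beta>"]
  have "ln (Gamma (y + 1)) \<le> (1 - (1 - \<beta>)) * ln (Gamma (y + \<beta>)) + (1 - \<beta>) * ln (Gamma (y + \<beta> + 1))"
    using y b by simp
  then have "(\<beta> - 1) * ln (y + \<beta>) \<le> ln q" using lnG[of "y + \<beta>"] q y b by (simp add: algebra_simps)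
  have "(y + \<beta>) powr (\<beta> - 1) = exp ((\<beta> - 1) * ln (y + \<beta>))" using y b by (simp add: powr_def)
  also have "\<dots> \<le> exp (ln q)"
    using \<open>(\<beta> - 1) * ln (y + \<beta>) \<le> ln q\<close> by (rule exp_le_cancel_iff[THEN iffD2])
  also have "\<dots> = q" using q(1) by simp
  finally show "(y + \<beta>) powr (\<beta> - 1) \<le> Gamma (y + \<beta>) / Gamma (y + 1)" unfolding q_def .
qed

text \<open>Mean value inequality on \<open>{l..}\<close>: the derivative has modulus
  \<open>(1 - \<beta>) * z powr (\<beta> - 2)\<close>, whose power decreases in \<open>z\<close> and
  whose factor is at most 1.\<close>

lemma powr_diff_le:
  fixes x y l \<beta> :: real
  assumes l: "0 < l" "l \<le> x" "l \<le> y" and b: "0 \<le> \<beta>" "\<beta> < 1"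
  shows "\<bar>x powr (\<beta> - 1) - y powr (\<beta> - 1)\<bar> \<le> l powr (\<beta> - 2) * \<bar>x - y\<bar>"
proof -
  have "norm (x powr (\<beta> - 1) - y powr (\<beta> - 1)) \<le> l powr (\<beta> - 2) * norm (x - y)"
  proof (rule field_differentiable_bound[where S="{l..}" and f'="\<lambda>z. (\<beta> - 1) * z powr (\<beta> - 1 - 1)"])
    fix z :: real assume z: "z \<in> {l..}"
    then have z0: "0 < z" using l by simp
    show "((\<lambda>z. z powr (\<beta> - 1)) has_field_derivative (\<beta> - 1) * z powr (\<beta> - 1 - 1)) (at z within {l..})"
      by (rule has_real_derivative_powr[OF z0, THEN has_field_derivative_at_within])
    have "z powr (\<beta> - 2) \<le> l powr (\<beta> - 2)" using z l b by (intro powr_mono2') auto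
    moreover have "(1 - \<beta>) * z powr (\<beta> - 2) \<le> 1 * z powr (\<beta> - 2)" using b by (intro mult_right_mono) auto
    ultimately show "norm ((\<beta> - 1) * z powr (\<beta> - 1 - 1)) \<le> l powr (\<beta> - 2)"
      using b by (simp add: abs_mult)
  qed (use l in auto)
  then show ?thesis by simp
qed

text \<open>With \<open>y = x + c\<close> the quotient lies between the powers of
  \<open>y + \<beta>\<close> and of \<open>y\<close>. Each differs from
  \<open>x powr (\<beta> - 1)\<close> by order \<open>real j powr (\<beta> - 2)\<close>, which is
  summable; replacing \<open>x\<close> by \<open>real j * r\<close> costs the term in the deviation
  of the average.\<close>

lemma Gamma_ratio_approx:
  fixes c u r \<beta> :: real
  assumes b: "0 \<le> \<beta>" "\<beta> < 1" and u: "0 < u" "0 < u + c" and r: "u \<le> r"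
  obtains C1 C2 C3 where "0 \<le> C1" "0 \<le> C2" "0 \<le> C3"
    "\<And>j x. 1 \<le> j \<Longrightarrow> real j * u \<le> x \<Longrightarrow> \<bar>Gamma (c + \<beta> + x) / Gamma (c + 1 + x) - (real j * r) powr (\<beta> - 1)\<bar>
        \<le> C1 * real j powr (\<beta> - 2) + C2 * (real j powr (\<beta> - 1) * \<bar>x / real j - r\<bar>)"
    "\<And>j x. 1 \<le> j \<Longrightarrow> real j * u \<le> x \<Longrightarrow> Gamma (c + \<beta> + x) / Gamma (c + 1 + x) \<le> C3 * real j powr (\<beta> - 1)"
proof -
  let ?G = "\<lambda>x. Gamma (c + \<beta> + x) / Gamma (c + 1 + x)"
  let ?p = "\<lambda>j. real j powr (\<beta> - 1)"
  \<comment> \<open>Since \<open>c\<close> may be negative, \<open>k\<close> is chosen with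
    \<open>k * x \<le> x + c\<close> for all \<open>x \<ge> u\<close>; thus
    \<open>real j * (k * u)\<close> lies below both \<open>x\<close> and
    \<open>x + c\<close>.\<close>
  define k where "k = min 1 ((u + c) / u)"
  have k: "0 < k" "k \<le> 1" using u by (auto simp: k_def)
  have kx: "k * x \<le> x + c" if "u \<le> x" for x
  proof (cases "0 \<le> c")
    case True
    have "k * x \<le> 1 * x" using that u k by (intro mult_right_mono) auto
    then show ?thesis using True by simp
  next
    case False
    have "k * x \<le> (u + c) / u * x" using that u by (intro mult_right_mono) (auto simp: k_def)
    also have "\<dots> = x + c * (x / u)" using u by (simp add: field_simps)
    also have "\<dots> \<le> x + c * 1" using False that u by (intro add_left_mono mult_left_mono_neg) auto
    finally show ?thesis by simp
  qed
  have main: "\<bar>?G x - (real j * r) powr (\<beta> - 1)\<bar>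
        \<le> ((k * u) powr (\<beta> - 2) * (\<bar>c\<bar> + 1)) * real j powr (\<beta> - 2) + u powr (\<beta> - 2) * (?p j * \<bar>x / real j - r\<bar>)"
    "?G x \<le> (k * u) powr (\<beta> - 1) * ?p j"
    if j: "1 \<le> j" and x: "real j * u \<le> x" for j :: nat and x :: real
  proof -
    have j0: "0 < real j" using j by simp
    have "1 * u \<le> real j * u" using j u by (intro mult_right_mono) auto
    then have xu: "u \<le> x" using x by simp
    define y where "y = x + c"
    have l: "0 < real j * (k * u)" "real j * (k * u) \<le> y" "real j * (k * u) \<le> x"
    proof -
      show "0 < real j * (k * u)" using j0 k u by simp
      have "real j * (k * u) \<le> k * x" using mult_left_mono[OF x, of k] k by (simp add: mult_ac)
      moreover have "k * x \<le> x" using k xu u mult_right_mono[of k 1 x] by simp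
      ultimately show "real j * (k * u) \<le> y" "real j * (k * u) \<le> x" using kx[OF xu] by (auto simp: y_def)
    qed
    define q where "q = ?G x"
    have qb: "(y + \<beta>) powr (\<beta> - 1) \<le> q" "q \<le> y powr (\<beta> - 1)"
      using Gamma_ratio_bounds[of y \<beta>] l b by (auto simp: q_def y_def add_ac)
    let ?l = "(real j * (k * u)) powr (\<beta> - 2)"
    \<comment> \<open>The constant \<open>\<bar>c\<bar> + 1\<close> covers both shifts,
      \<open>c\<close> here and \<open>c + \<beta>\<close> in the next estimate.\<close>
    have 1: "\<bar>y powr (\<beta> - 1) - x powr (\<beta> - 1)\<bar> \<le> ?l * (\<bar>c\<bar> + 1)"
    proof -
      have "\<bar>y powr (\<beta> - 1) - x powr (\<beta> - 1)\<bar> \<le> ?l * \<bar>y - x\<bar>" using l b by (intro powr_diff_le) auto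
      also have "\<dots> \<le> ?l * (\<bar>c\<bar> + 1)" by (intro mult_left_mono) (auto simp: y_def)
      finally show ?thesis .
    qed
    have 2: "\<bar>(y + \<beta>) powr (\<beta> - 1) - x powr (\<beta> - 1)\<bar> \<le> ?l * (\<bar>c\<bar> + 1)"
    proof -
      have "\<bar>(y + \<beta>) powr (\<beta> - 1) - x powr (\<beta> - 1)\<bar> \<le> ?l * \<bar>(y + \<beta>) - x\<bar>" using l b by (intro powr_diff_le) auto
      also have "\<dots> \<le> ?l * (\<bar>c\<bar> + 1)" using b by (intro mult_left_mono) (auto simp: y_def)
      finally show ?thesis .
    qed
    have 3: "\<bar>x powr (\<beta> - 1) - (real j * r) powr (\<beta> - 1)\<bar> \<le> (real j * u) powr (\<beta> - 2) * \<bar>x - real j * r\<bar>"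
      using x r j0 u b by (intro powr_diff_le) auto
    also have "\<bar>x - real j * r\<bar> = real j * \<bar>x / real j - r\<bar>"
    proof -
      have "x - real j * r = real j * (x / real j - r)" using j0 by (simp add: right_diff_distrib)
      then show ?thesis using j0 by (simp add: abs_mult)
    qed
    also have "(real j * u) powr (\<beta> - 2) * (real j * \<bar>x / real j - r\<bar>) = u powr (\<beta> - 2) * (?p j * \<bar>x / real j - r\<bar>)"
    proof -
      have "real j powr (\<beta> - 2) * real j = ?p j"
        using j0 powr_add[of "real j" "\<beta> - 2" 1] by simp
      then show ?thesis using j0 u by (simp add: powr_mult mult_ac)
    qed
    finally have 3: "\<bar>x powr (\<beta> - 1) - (real j * r) powr (\<beta> - 1)\<bar> \<le> u powr (\<beta> - 2) * (?p j * \<bar>x / real j - r\<bar>)" .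
    have "?l * (\<bar>c\<bar> + 1) = ((k * u) powr (\<beta> - 2) * (\<bar>c\<bar> + 1)) * real j powr (\<beta> - 2)"
      using j0 k u by (simp add: powr_mult mult_ac)
    with 1 2 3 qb show "\<bar>?G x - (real j * r) powr (\<beta> - 1)\<bar>
        \<le> ((k * u) powr (\<beta> - 2) * (\<bar>c\<bar> + 1)) * real j powr (\<beta> - 2) + u powr (\<beta> - 2) * (?p j * \<bar>x / real j - r\<bar>)"
      unfolding q_def[symmetric] by linarith
    have "q \<le> (real j * (k * u)) powr (\<beta> - 1)"
      using qb(2) powr_mono2'[of "\<beta> - 1" "real j * (k * u)" y] l b by linarith
    then show "?G x \<le> (k * u) powr (\<beta> - 1) * ?p j"
      using j0 k u by (simp add: q_def powr_mult mult_ac)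
  qed
  show thesis
    by (rule that[of "(k * u) powr (\<beta> - 2) * (\<bar>c\<bar> + 1)" "u powr (\<beta> - 2)" "(k * u) powr (\<beta> - 1)"]) (auto intro!: main)
qed

text \<open>An antiderivative of \<open>x powr (\<beta> - 1)\<close> at \<open>n\<close>. It is a
  constant multiple of \<open>a_seq\<close>, and that constant is the source of the factor
  \<open>1 / \<beta>\<close> in \<open>lam_const\<close>.\<close>

definition powr_sum_limit :: "real \<Rightarrow> nat \<Rightarrow> real" where
  "powr_sum_limit \<beta> n = (if \<beta> = 0 then ln (real n) else real n powr \<beta> / \<beta>)"

text \<open>Mean value theorem for the antiderivative, whose derivative is decreasing.\<close>

lemma powr_sum_limit_increment:
  assumes b: "0 \<le> \<beta>" "\<beta> < 1" and j: "1 \<le> j"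
  shows "real (Suc j) powr (\<beta> - 1) \<le> powr_sum_limit \<beta> (Suc j) - powr_sum_limit \<beta> j"
    and "powr_sum_limit \<beta> (Suc j) - powr_sum_limit \<beta> j \<le> real j powr (\<beta> - 1)"
proof -
  let ?b = "powr_sum_limit \<beta>"
  define g where "g x = (if \<beta> = 0 then ln x else x powr \<beta> / \<beta>)" for x :: real
  have "(g has_real_derivative x powr (\<beta> - 1)) (at x)" if "0 < x" for x
  proof (cases "\<beta> = 0")
    case True
    then show ?thesis using that unfolding g_def
      by (auto intro!: derivative_eq_intros simp: powr_minus divide_inverse)
  next
    case False
    then show ?thesis using that unfolding g_def
      by (auto intro!: derivative_eq_intros)
  qed
  then obtain z where z: "real j < z" "z < real (Suc j)" "g (real (Suc j)) - g (real j) = (real (Suc j) - real j) * z powr (\<beta> - 1)"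
    using MVT2[of "real j" "real (Suc j)" g "\<lambda>x. x powr (\<beta> - 1)"] j by auto
  have e: "?b (Suc j) - ?b j = z powr (\<beta> - 1)"
    using z(3) by (cases "\<beta> = 0") (simp_all add: g_def powr_sum_limit_def)
  show "real (Suc j) powr (\<beta> - 1) \<le> ?b (Suc j) - ?b j"
    unfolding e using z j b by (intro powr_mono2') auto
  show "?b (Suc j) - ?b j \<le> real j powr (\<beta> - 1)"
    unfolding e using z j b by (intro powr_mono2') auto
qed

lemma powr_sum_bounds:
  assumes b: "0 \<le> \<beta>" "\<beta> < 1" and n: "1 \<le> n"
  shows "\<bar>(\<Sum>j=1..<n. real j powr (\<beta> - 1)) - (powr_sum_limit \<beta> n - powr_sum_limit \<beta> 1)\<bar> \<le> 1"
proof -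
  \<comment> \<open>The upper bound carries the telescoped slack
    \<open>1 - real n powr (\<beta> - 1)\<close>, which makes the induction close and is at most
    1.\<close>
  have "powr_sum_limit \<beta> n - powr_sum_limit \<beta> 1 \<le> (\<Sum>j=1..<n. real j powr (\<beta> - 1)) \<and>
     (\<Sum>j=1..<n. real j powr (\<beta> - 1)) \<le> powr_sum_limit \<beta> n - powr_sum_limit \<beta> 1 + (1 - real n powr (\<beta> - 1))"
    using n
  proof (induction n rule: dec_induct)
    case base
    then show ?case by simp
  next
    case (step n)
    then show ?case using powr_sum_limit_increment[OF b step(1)] by (simp add: atLeastLessThanSuc)
  qed
  moreover have "0 \<le> real n powr (\<beta> - 1)" by simp
  ultimately show ?thesis by linarith
qed

lemma powr_sum_bounded:
  assumes b: "\<beta> < 1"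
  obtains C where "\<And>n. (\<Sum>j=1..<n. real j powr (\<beta> - 2)) \<le> C"
proof -
  have "summable (\<lambda>j. real j powr (\<beta> - 2))" using b by (subst summable_real_powr_iff) auto
  then have "(\<Sum>j=1..<n. real j powr (\<beta> - 2)) \<le> (\<Sum>j. real j powr (\<beta> - 2))" for n
    by (intro sum_le_suminf) auto
  then show thesis by (rule that)
qed

section \<open>The weighted Indian buffet model\<close>

lemma rand_measD:
  fixes X :: "'w \<Rightarrow> 'x::topological_space measure"
  assumes "rand_meas P X"
  shows rand_meas_measurable: "X \<in> P \<rightarrow>\<^sub>M fm_space"
    and rand_meas_finite: "w \<in> space P \<Longrightarrow> finite_measure (X w)"
    and rand_meas_sets: "w \<in> space P \<Longrightarrow> sets (X w) = sets borel"
  using assms by (auto simp: rand_meas_def intro: measurable_into_fm_space)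

lemma genF_gen_subset:
  "(\<Union>i\<in>Is. {M i -` A \<inter> space P | A. A \<in> sets (fm_space :: 'x::topological_space measure measure)}) \<union>
      (\<Union>j\<in>Js. {R j -` A \<inter> space P | A. A \<in> sets (borel :: real measure)}) \<subseteq> Pow (space P)"
  by auto

lemma space_genF: "space (genF P M R Is Js) = space P"
  unfolding genF_def by (rule space_measure_of[OF genF_gen_subset])

lemma sets_genF: "sets (genF P M R Is Js) = sigma_sets (space P)
     ((\<Union>i\<in>Is. {M i -` A \<inter> space P | A. A \<in> sets (fm_space :: 'x::topological_space measure measure)}) \<union>
      (\<Union>j\<in>Js. {R j -` A \<inter> space P | A. A \<in> sets (borel :: real measure)}))"
  unfolding genF_def by (rule sets_measure_of[OF genF_gen_subset])

lemma genF_measurable_M: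
  assumes "i \<in> Is" "M i \<in> P \<rightarrow>\<^sub>M fm_space"
  shows "M i \<in> genF P M R Is Js \<rightarrow>\<^sub>M fm_space"
proof (rule measurableI)
  show "M i w \<in> space fm_space" if "w \<in> space (genF P M R Is Js)" for w
    using that measurable_space[OF assms(2)] by (simp add: space_genF)
  show "M i -` A \<inter> space (genF P M R Is Js) \<in> sets (genF P M R Is Js)" if "A \<in> sets fm_space" for A
    unfolding space_genF sets_genF using that assms(1) by (intro sigma_sets.Basic) blast
qed

lemma genF_measurable_R: "j \<in> Js \<Longrightarrow> R j \<in> borel_measurable (genF P M R Is Js)"
proof (rule measurableI)
  assume j: "j \<in> Js"
  show "R j -` A \<inter> space (genF P M R Is Js) \<in> sets (genF P M R Is Js)" if "A \<in> sets borel" for A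
    unfolding space_genF sets_genF using that j by (intro sigma_sets.Basic) blast
qed auto

lemma subalgebra_genF:
  assumes "\<And>i. i \<in> Is \<Longrightarrow> M i \<in> P \<rightarrow>\<^sub>M fm_space" "\<And>j. j \<in> Js \<Longrightarrow> R j \<in> borel_measurable P"
  shows "subalgebra P (genF P M R Is Js)"
  unfolding subalgebra_def space_genF sets_genF
  using assms by (auto intro!: sets.sigma_sets_subset measurable_sets)

lemma genF_mono: "Is \<subseteq> Is' \<Longrightarrow> Js \<subseteq> Js' \<Longrightarrow> sets (genF P M R Is Js) \<subseteq> sets (genF P M R Is' Js')"
  unfolding sets_genF by (intro sigma_sets_mono') blast

section \<open>Old and new dishes\<close>

lemma finite_Sset:
  fixes M :: "nat \<Rightarrow> 'w \<Rightarrow> 'x::t1_space measure"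
  assumes "\<And>i. i \<in> {1..n} \<Longrightarrow> finite_measure (M i w)" "\<And>i. i \<in> {1..n} \<Longrightarrow> sets (M i w) = sets borel"
  shows "finite (Sset M n w)"
proof -
  have "Sset M n w = (\<Union>i\<in>{1..n}. {x. emeasure (M i w) {x} = 1})" by (auto simp: Sset_def)
  moreover have "finite {x. emeasure (M i w) {x} = 1}" if "i \<in> {1..n}" for i
    by (rule finite_unit_atoms[OF assms[OF that]]) simp
  ultimately show ?thesis by simp
qed

text \<open>The dishes after step \<open>Suc n\<close> are the disjoint union of the old ones and
  the unit atoms of \<open>M (Suc n) w\<close> off them.\<close>

lemma card_Sset_Suc:
  fixes M :: "nat \<Rightarrow> 'w \<Rightarrow> 'x::t1_space measure"
  assumes fin: "\<And>i. i \<in> {1..Suc n} \<Longrightarrow> finite_measure (M i w)"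
    and s: "\<And>i. i \<in> {1..Suc n} \<Longrightarrow> sets (M i w) = sets borel"
  shows card_Sset_mono: "card (Sset M n w) \<le> card (Sset M (Suc n) w)"
    and unit_count_off_Sset:
      "unit_count_off (Sset M n w) (M (Suc n) w) = of_nat (card (Sset M (Suc n) w) - card (Sset M n w))"
proof -
  let ?N = "{x. x \<notin> Sset M n w \<and> emeasure (M (Suc n) w) {x} = 1}"
  have "Sset M (Suc n) w = Sset M n w \<union> ?N"
    by (auto simp: Sset_def atLeastAtMostSuc_conv)
  moreover have "finite (Sset M (Suc n) w)" using assms by (rule finite_Sset)
  ultimately have c: "card (Sset M (Suc n) w) = card (Sset M n w) + card ?N"
    by (simp add: card_Un_disjoint disjoint_iff)
  then show "card (Sset M n w) \<le> card (Sset M (Suc n) w)" by simp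
  have "unit_count_off (Sset M n w) (M (Suc n) w) = of_nat (card ?N)"
    using fin s by (intro unit_count_off_eq) auto
  then show "unit_count_off (Sset M n w) (M (Suc n) w) = of_nat (card (Sset M (Suc n) w) - card (Sset M n w))"
    using c by simp
qed

lemma measurable_Sset_pair:
  fixes M :: "nat \<Rightarrow> 'w \<Rightarrow> 'x::{metric_space, second_countable_topology} measure"
  assumes M: "\<And>i. i \<in> {1..n} \<Longrightarrow> M i \<in> N \<rightarrow>\<^sub>M fm_space"
    and fin: "\<And>i w. i \<in> {1..n} \<Longrightarrow> w \<in> space N \<Longrightarrow> finite_measure (M i w)"
  shows "{p \<in> space (N \<Otimes>\<^sub>M borel). snd p \<in> Sset M n (fst p)} \<in> sets (N \<Otimes>\<^sub>M borel)"
proof -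
  have "{p \<in> space (N \<Otimes>\<^sub>M (borel :: 'x measure)). snd p \<in> Sset M n (fst p)}
    = (\<Union>i\<in>{1..n}. {p \<in> space (N \<Otimes>\<^sub>M borel). emeasure (M i (fst p)) {snd p} = 1})"
    by (auto simp: Sset_def)
  also have "\<dots> \<in> sets (N \<Otimes>\<^sub>M borel)"
    using borel_measurable_eq[OF measurable_atom_mass[OF M fin], of _ "\<lambda>_. 1"]
    by (intro sets.finite_UN) auto
  finally show ?thesis .
qed

text \<open>Induction along the increments, each a jointly measurable count at a random set.
  \<open>N\<close> is arbitrary because measurability is wanted for the filtration, not merely for
  \<open>P\<close>.\<close>

lemma measurable_card_Sset:
  fixes M :: "nat \<Rightarrow> 'w \<Rightarrow> 'x::{metric_space, second_countable_topology} measure"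
  assumes M: "\<And>i. i \<in> {1..n} \<Longrightarrow> M i \<in> N \<rightarrow>\<^sub>M fm_space"
    and fin: "\<And>i w. i \<in> {1..n} \<Longrightarrow> w \<in> space N \<Longrightarrow> finite_measure (M i w)"
  shows "(\<lambda>w. card (Sset M n w)) \<in> N \<rightarrow>\<^sub>M count_space UNIV"
proof -
  have sM: "sets (M i w) = sets borel" if "i \<in> {1..n}" "w \<in> space N" for i w
    using measurable_space[OF M[OF that(1)] that(2)] by (simp add: space_fm_space)
  have "(\<lambda>w. real (card (Sset M k w))) \<in> borel_measurable N" if "k \<le> n" for k
    using that
  proof (induction k)
    case 0
    then show ?case by (simp add: Sset_def)
  next
    case (Suc k)
    have "(\<lambda>p. unit_count_off (Sset M k (fst p)) (snd p)) \<in> borel_measurable (N \<Otimes>\<^sub>M fm_space)"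
      using Suc.prems M fin by (intro measurable_unit_count_off_pair measurable_Sset_pair) auto
    from measurable_compose[OF measurable_Pair[OF measurable_ident_sets[OF refl] M[of "Suc k"]] this]
    have "(\<lambda>w. unit_count_off (Sset M k w) (M (Suc k) w)) \<in> borel_measurable N"
      using Suc.prems by simp
    then have "(\<lambda>w. real (card (Sset M k w)) + enn2real (unit_count_off (Sset M k w) (M (Suc k) w))) \<in> borel_measurable N"
      using Suc by (intro borel_measurable_add borel_measurable_enn2real) auto
    moreover have "real (card (Sset M (Suc k) w)) = real (card (Sset M k w)) + enn2real (unit_count_off (Sset M k w) (M (Suc k) w))"
      if "w \<in> space N" for w
    proof -
      have "card (Sset M k w) \<le> card (Sset M (Suc k) w)"
        "unit_count_off (Sset M k w) (M (Suc k) w) = of_nat (card (Sset M (Suc k) w) - card (Sset M k w))"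
        by (intro card_Sset_mono unit_count_off_Sset; use Suc.prems that fin sM in auto)+
      then show ?thesis by (simp add: ennreal_of_nat_eq_real_of_nat of_nat_diff)
    qed
    ultimately show ?case by (subst measurable_cong) auto
  qed
  from measurable_compose[OF this[OF order_refl], of "\<lambda>x. nat \<lfloor>x\<rfloor>" "count_space UNIV"]
  show ?thesis by simp
qed

text \<open>An old dish was taken at least once, with weight at least \<open>u > \<beta>\<close>, so
  its numerator is positive; the denominator is at least \<open>u + c\<close>, positive since
  \<open>c > - \<beta>\<close>.\<close>

lemma nu_atoms_diffuse_part:
  fixes m :: "'x::t1_space measure"
  assumes m: "prob_space m" "sets m = sets borel" "\<And>x. emeasure m {x} = 0"
    and par: "0 < \<alpha>" "0 \<le> \<beta>" "\<beta> < 1" "- \<beta> < c" "max \<beta> 0 < u"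
    and fin: "\<And>i. i \<in> {1..n} \<Longrightarrow> finite_measure (M i w)" "\<And>i. i \<in> {1..n} \<Longrightarrow> sets (M i w) = sets borel"
    and R: "\<And>i. i \<in> {1..n} \<Longrightarrow> u \<le> R i w"
  shows Lam_nonneg: "0 \<le> Lam \<alpha> \<beta> c R n w"
    and atoms_nu: "atoms (nu m \<alpha> \<beta> c M R n w) = Sset M n w"
    and diffuse_part_nu: "B \<in> sets borel \<Longrightarrow> diffuse_part (nu m \<alpha> \<beta> c M R n w) B = Lam \<alpha> \<beta> c R n w * measure m B"
proof -
  let ?w = "\<lambda>x. ((\<Sum>i=1..n. R i w * measure (M i w) {x}) - \<beta>) / ((\<Sum>i=1..n. R i w) + c)"
  have R0: "0 \<le> R i w" if "i \<in> {1..n}" for i using R[OF that] par by simp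
  have T0: "0 \<le> (\<Sum>i=1..n. R i w)" using R0 by (intro sum_nonneg) auto
  have "0 < c + \<beta>" using par by simp
  moreover have "0 < c + 1" using par by simp
  ultimately show L0: "0 \<le> Lam \<alpha> \<beta> c R n w"
    unfolding Lam_def using T0 par by (intro divide_nonneg_pos mult_nonneg_nonneg mult_pos_pos less_imp_le Gamma_real_pos) auto
  have w: "0 < ?w x" if "x \<in> Sset M n w" for x
  proof -
    from that obtain i where i: "i \<in> {1..n}" "emeasure (M i w) {x} = 1" by (auto simp: Sset_def)
    have "measure (M i w) {x} = 1" using i(2) by (simp add: measure_def)
    then have "u \<le> R i w * measure (M i w) {x}" using R[OF i(1)] by simp
    also have "\<dots> \<le> (\<Sum>i=1..n. R i w * measure (M i w) {x})"
      using i(1) R0 by (intro member_le_sum) auto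
    finally have 1: "\<beta> < (\<Sum>i=1..n. R i w * measure (M i w) {x})" using par by simp
    have "u \<le> R i w" by (rule R[OF i(1)])
    also have "\<dots> \<le> (\<Sum>i=1..n. R i w)" using i(1) R0 by (intro member_le_sum) auto
    finally have "0 < (\<Sum>i=1..n. R i w) + c" using par by simp
    with 1 show ?thesis by simp
  qed
  have S: "finite (Sset M n w)" using fin by (rule finite_Sset)
  show "atoms (nu m \<alpha> \<beta> c M R n w) = Sset M n w"
    unfolding nu_def by (rule atoms_hazard_measure[OF m S w L0])
  show "diffuse_part (nu m \<alpha> \<beta> c M R n w) B = Lam \<alpha> \<beta> c R n w * measure m B" if "B \<in> sets borel"
    unfolding nu_def by (rule diffuse_part_hazard_measure[OF m S w L0 that])
qed

text \<open>The event depends on the outcome through both the old dishes and the next measure, so it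
  is disintegrated. Its section at \<open>w\<close> is the event of
  \<open>measure_BeP_unit_count\<close>, as the atoms of the hazard measure are the old
  dishes.\<close>

lemma new_dishes_cond_poisson:
  fixes m :: "'x::{metric_space, second_countable_topology} measure"
  assumes P: "prob_space P"
    and m: "prob_space m" "sets m = sets borel" "\<And>x. emeasure m {x} = 0"
    and par: "0 < \<alpha>" "0 \<le> \<beta>" "\<beta> < 1" "- \<beta> < c" "max \<beta> 0 < u"
    and M: "\<And>i. 1 \<le> i \<Longrightarrow> rand_meas P (M i)"
    and R: "\<And>i. 1 \<le> i \<Longrightarrow> R i \<in> borel_measurable P" "\<And>i w. 1 \<le> i \<Longrightarrow> w \<in> space P \<Longrightarrow> u \<le> R i w"
    and cond: "\<And>A. A \<in> sets (fm_space :: 'x measure measure) \<Longrightarrow>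
        AE w in P. real_cond_exp P (genF P M R {1..n} {1..n}) (indicator {w'\<in>space P. M (Suc n) w' \<in> A}) w
                   = measure (BeP (nu m \<alpha> \<beta> c M R n w)) A"
  shows "AE w in P. real_cond_exp P (genF P M R {1..n} {1..n})
      (indicator {w'\<in>space P. card (Sset M (Suc n) w') - card (Sset M n w') = k}) w = pmf (poi (Lam \<alpha> \<beta> c R n w)) k"
proof -
  let ?E = "{w'\<in>space P. card (Sset M (Suc n) w') - card (Sset M n w') = k}"
  let ?L = "Lam \<alpha> \<beta> c R n"
  interpret prob_space P by fact
  let ?F = "genF P M R {1..n} {1..n}"
  let ?\<nu> = "nu m \<alpha> \<beta> c M R n"
  have sub: "subalgebra P ?F" using M R(1) by (intro subalgebra_genF rand_meas_measurable) auto
  interpret F: finite_measure_subalgebra P ?F by unfold_locales (rule sub)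
  have fin: "finite_measure (M i w)" and sM: "sets (M i w) = sets borel" if "1 \<le> i" "w \<in> space P" for i w
    using rand_meas_finite[OF M[OF that(1)] that(2)] rand_meas_sets[OF M[OF that(1)] that(2)] by auto
  have nu: "0 \<le> ?L w" "atoms (?\<nu> w) = Sset M n w"
     "\<And>B. B \<in> sets borel \<Longrightarrow> diffuse_part (?\<nu> w) B = ?L w * measure m B"
     "finite (atoms (?\<nu> w))"
    if w: "w \<in> space P" for w
  proof -
    show "0 \<le> ?L w"
      by (rule Lam_nonneg[OF m par, where M=M]) (use fin sM R(2) w in auto)
    show at: "atoms (?\<nu> w) = Sset M n w"
      by (rule atoms_nu[OF m par]) (use fin sM R(2) w in auto)
    show "diffuse_part (?\<nu> w) B = ?L w * measure m B" if "B \<in> sets borel" for B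
      by (rule diffuse_part_nu[OF m par]) (use fin sM R(2) w that in auto)
    show "finite (atoms (?\<nu> w))" unfolding at by (rule finite_Sset) (use fin sM w in auto)
  qed
  note BeP = BeP_unit_count[OF m nu(1) nu(4) nu(3)]
  define D where "D = {p \<in> space (?F \<Otimes>\<^sub>M (fm_space :: 'x measure measure)). unit_count_off (Sset M n (fst p)) (snd p) = of_nat k}"
  have D: "D \<in> sets (?F \<Otimes>\<^sub>M fm_space)"
    unfolding D_def
  proof (rule borel_measurable_eq)
    show "(\<lambda>p. unit_count_off (Sset M n (fst p)) (snd p)) \<in> borel_measurable (?F \<Otimes>\<^sub>M fm_space)"
      using M fin
      by (intro measurable_unit_count_off_pair measurable_Sset_pair genF_measurable_M rand_meas_measurable)
         (auto simp: space_genF)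
  qed auto
  have "AE w in P. real_cond_exp P ?F (indicator {w' \<in> space P. (w', M (Suc n) w') \<in> D}) w = measure (BeP (?\<nu> w)) (Pair w -` D)"
  proof (rule F.real_cond_exp_disintegration)
    show "prob_space P" by fact
    show "M (Suc n) \<in> P \<rightarrow>\<^sub>M fm_space" using M by (intro rand_meas_measurable) auto
    show "prob_space (BeP (?\<nu> w))" "sets (BeP (?\<nu> w)) = sets fm_space" if "w \<in> space P" for w
      using BeP(1,2)[of w] that by blast+
  qed (use cond D in auto)
  moreover have "{w' \<in> space P. (w', M (Suc n) w') \<in> D} = ?E"
  proof -
    have "(w, M (Suc n) w) \<in> D \<longleftrightarrow> card (Sset M (Suc n) w) - card (Sset M n w) = k" if w: "w \<in> space P" for w
    proof -
      have "unit_count_off (Sset M n w) (M (Suc n) w) = of_nat (card (Sset M (Suc n) w) - card (Sset M n w))"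
        using w fin sM by (intro unit_count_off_Sset) auto
      moreover have "M (Suc n) w \<in> space fm_space" using w sM by (simp add: space_fm_space)
      ultimately show ?thesis using w by (simp add: D_def space_pair_measure space_genF)
    qed
    then show ?thesis by blast
  qed
  ultimately have "AE w in P. real_cond_exp P ?F (indicator ?E) w
      = measure (BeP (?\<nu> w)) (Pair w -` D)" by simp
  with AE_space show ?thesis
  proof eventually_elim
    case (elim w)
    have "Pair w -` D = {\<mu> \<in> space fm_space. unit_count_off (atoms (?\<nu> w)) \<mu> = of_nat k}"
      using elim(1) nu(2)[OF elim(1)] by (auto simp: D_def space_pair_measure space_genF)
    moreover have "measure (BeP (?\<nu> w)) {\<mu> \<in> space fm_space. unit_count_off (atoms (?\<nu> w)) \<mu> = of_nat k} = pmf (poi (?L w)) k"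
      using elim(1) by (intro BeP(3)) auto
    ultimately show ?case using elim(2) by simp
  qed
qed

text \<open>Gamma is continuous on the positive axis; cut off to 0 elsewhere it is Borel on the
  whole line.\<close>

lemma borel_measurable_Gamma_pos:
  fixes f :: "'a \<Rightarrow> real"
  assumes f: "f \<in> borel_measurable N" and pos: "\<And>\<omega>. \<omega> \<in> space N \<Longrightarrow> 0 < f \<omega>"
  shows "(\<lambda>\<omega>. Gamma (f \<omega>)) \<in> borel_measurable N"
proof -
  have "continuous_on {0<..} (Gamma :: real \<Rightarrow> real)"
    by (intro continuous_on_Gamma continuous_on_id) (auto elim!: nonpos_Ints_cases)
  then have "(\<lambda>x. indicator {0<..} x *\<^sub>R Gamma x :: real) \<in> borel_measurable borel"
    by (intro borel_measurable_continuous_on_indicator) auto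
  from measurable_compose[OF f this] show ?thesis
    by (rule subst[OF measurable_cong, rotated]) (simp add: pos)
qed

lemma filterlim_a_seq:
  assumes "0 \<le> \<beta>"
  shows "filterlim (a_seq \<beta>) at_top sequentially"
proof -
  have ln: "filterlim (\<lambda>n. ln (real n)) at_top sequentially"
    by (rule filterlim_compose[OF ln_at_top filterlim_real_sequentially])
  show ?thesis
  proof (cases "\<beta> = 0")
    case True
    then show ?thesis using ln by (simp add: a_seq_def[abs_def])
  next
    case False
    then have "filterlim (\<lambda>n. exp (\<beta> * ln (real n))) at_top sequentially"
      using assms by (intro filterlim_compose[OF exp_at_top] filterlim_tendsto_pos_mult_at_top[OF tendsto_const _ ln]) auto
    moreover have "eventually (\<lambda>n. exp (\<beta> * ln (real n)) = a_seq \<beta> n) sequentially"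
      using eventually_gt_at_top[of 0] by eventually_elim (use False in \<open>simp add: a_seq_def powr_def\<close>)
    ultimately show ?thesis by (rule filterlim_mono_eventually[OF _ order_refl order_refl])
  qed
qed

theorem theorem5:
  fixes P :: "'w measure"
    and m :: "('x :: {metric_space, second_countable_topology}) measure"
    and M :: "nat \<Rightarrow> 'w \<Rightarrow> 'x measure"
    and R :: "nat \<Rightarrow> 'w \<Rightarrow> real"
    and \<alpha> \<beta> c u r :: real
  assumes P: "prob_space P"
    and m_prob: "prob_space m" and m_sets: "sets m = sets (borel :: 'x measure)"
    and m_diffuse: "\<forall>x. emeasure m {x} = 0"
    and alpha: "\<alpha> > 0" and beta: "0 \<le> \<beta>" "\<beta> < 1" and c: "c > - \<beta>"
    and u: "u > max \<beta> 0"
    and M_rm: "\<forall>n\<ge>1. rand_meas P (M n)"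
    and R_meas: "\<forall>n\<ge>1. R n \<in> borel_measurable P"
    and R_ge: "\<forall>n\<ge>1. \<forall>\<omega>\<in>space P. R n \<omega> \<ge> u"
    and R_indep: "\<forall>n\<ge>1. prob_space.indep_set P (sets (genF P M R {} {n}))
                                             (sets (genF P M R {1..n} {1..<n}))"
    and M_cond: "\<forall>n. \<forall>A\<in>sets (fm_space :: 'x measure measure).
        AE \<omega> in P. real_cond_exp P (genF P M R {1..n} {1..n})
                      (indicator {\<omega>'\<in>space P. M (Suc n) \<omega>' \<in> A}) \<omega>
                   = measure (BeP (nu m \<alpha> \<beta> c M R n \<omega>)) A"
    and Rbar_lim: "AE \<omega> in P. (\<lambda>n. (\<Sum>i=1..n. R i \<omega>) / real n) \<longlonglongrightarrow> r"
    and Rbar_rate: "(\<lambda>n. (\<Sum>j=1..n. ennreal (real j powr (\<beta> - 1)) *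
                         (\<integral>\<^sup>+\<omega>. ennreal \<bar>(\<Sum>i=1..j. R i \<omega>) / real j - r\<bar> \<partial>P))
                      / ennreal (sqrt (a_seq \<beta> n))) \<longlonglongrightarrow> 0"
  shows "stably_conv P
           (\<lambda>n \<omega>. sqrt (a_seq \<beta> n) *
                   (real (card (Sset M n \<omega>)) / a_seq \<beta> n - lam_const \<alpha> \<beta> c r))
           (\<lambda>_. gauss (lam_const \<alpha> \<beta> c r))"
proof -
  interpret prob_space P by fact
  let ?p = "\<lambda>j. real j powr (\<beta> - 1)"
  let ?L = "Lam \<alpha> \<beta> c R"
  let ?T = "\<lambda>n w. \<Sum>i=1..n. R i w"
  let ?F = "\<lambda>n. genF P M R {1..n} {1..n}"
  have T_ge: "real n * u \<le> ?T n w" if "w \<in> space P" for n w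
  proof -
    have "(\<Sum>i=1..n. u) \<le> ?T n w" using R_ge that by (intro sum_mono) auto
    then show ?thesis by simp
  qed
  \<comment> \<open>A single outcome at which the averages converge suffices, since they are at
    least \<open>u\<close> everywhere. This places \<open>r\<close> in the range of
    \<open>Gamma_ratio_approx\<close>.\<close>
  have r: "u \<le> r"
  proof -
    obtain w where w: "w \<in> space P" "(\<lambda>n. ?T n w / real n) \<longlonglongrightarrow> r"
      using eventually_happens[OF eventually_conj[OF AE_space Rbar_lim]] ae_filter_eq_bot_iff[of P] emeasure_space_1
      by auto
    have "eventually (\<lambda>n. u \<le> ?T n w / real n) sequentially"
      using eventually_gt_at_top[of 0] by eventually_elim (use T_ge[OF w(1)] in \<open>simp add: field_simps\<close>)
    then show ?thesis by (rule tendsto_lowerbound[OF w(2)]) simp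
  qed
  have u0: "0 < u" "0 < u + c" using u c by auto
  have r0: "0 < r" using r u0 by simp
  obtain C1 C2 C3 where C: "0 \<le> C1" "0 \<le> C2" "0 \<le> C3"
    "\<And>j x. 1 \<le> j \<Longrightarrow> real j * u \<le> x \<Longrightarrow> \<bar>Gamma (c + \<beta> + x) / Gamma (c + 1 + x) - (real j * r) powr (\<beta> - 1)\<bar>
        \<le> C1 * real j powr (\<beta> - 2) + C2 * (?p j * \<bar>x / real j - r\<bar>)"
    "\<And>j x. 1 \<le> j \<Longrightarrow> real j * u \<le> x \<Longrightarrow> Gamma (c + \<beta> + x) / Gamma (c + 1 + x) \<le> C3 * ?p j"
    using Gamma_ratio_approx[OF beta u0 r] by blast
  obtain C4 where C4: "\<And>n. (\<Sum>j=1..<n. real j powr (\<beta> - 2)) \<le> C4" using powr_sum_bounded[OF beta(2)] by blast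
  have G0: "0 < Gamma (c + \<beta>)" "0 < Gamma (c + 1)" using c beta by (auto intro!: Gamma_real_pos)
  define C0 where "C0 = \<alpha> * Gamma (c + 1) / Gamma (c + \<beta>)"
  have C0: "0 < C0" using G0 alpha by (simp add: C0_def)
  have Lam_eq: "?L n w = C0 * (Gamma (c + \<beta> + ?T n w) / Gamma (c + 1 + ?T n w))" for n w
    by (simp add: Lam_def C0_def)
  have Lam_0: "?L 0 w = \<alpha>" for w using G0 by (simp add: Lam_def)
  have Lam_pos: "0 \<le> ?L n w" if "w \<in> space P" for n w
  proof -
    have "0 \<le> real n * u" using u0 by simp
    then have "0 \<le> ?T n w" using T_ge[OF that, of n] by linarith
    then show ?thesis unfolding Lam_eq using C0 c beta
      by (intro mult_nonneg_nonneg divide_nonneg_pos Gamma_real_pos less_imp_le[OF Gamma_real_pos]) auto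
  qed
  \<comment> \<open>The index 0 is separate: the Gamma estimate starts at 1, and
    \<open>0 powr (\<beta> - 1)\<close> is 0 by convention.\<close>
  define b where "b n = (if n = 0 then \<alpha> else C0 * (C3 * real n powr (\<beta> - 1)))" for n
  interpret conditionally_poisson_counts P ?F "\<lambda>n w. card (Sset M n w)" "?L" b
  proof
    fix n
    show "subalgebra P (?F n)" using M_rm R_meas by (intro subalgebra_genF rand_meas_measurable) auto
    show "sets (?F n) \<subseteq> sets (?F (Suc n))" by (rule genF_mono) auto
    show "(\<lambda>w. card (Sset M n w)) \<in> ?F n \<rightarrow>\<^sub>M count_space UNIV"
      using M_rm by (intro measurable_card_Sset genF_measurable_M) (auto simp: space_genF intro: rand_meas_measurable rand_meas_finite)
    show "card (Sset M n w) \<le> card (Sset M (Suc n) w)" if "w \<in> space P" for w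
      using M_rm that by (intro card_Sset_mono) (auto intro: rand_meas_finite simp: rand_meas_sets)
    have "?T n \<in> borel_measurable (?F n)" by (intro borel_measurable_sum genF_measurable_R)
    moreover have "0 \<le> ?T n w" if "w \<in> space (?F n)" for w
      using R_ge u0 that by (intro sum_nonneg) (force simp: space_genF)
    ultimately have "(\<lambda>w. Gamma (d + ?T n w)) \<in> borel_measurable (?F n)" if "0 < d" for d
      by (intro borel_measurable_Gamma_pos borel_measurable_add borel_measurable_const add_pos_nonneg that)
    from this[of "c + \<beta>"] this[of "c + 1"]
    have "(\<lambda>w. Gamma (c + \<beta> + ?T n w)) \<in> borel_measurable (?F n)" "(\<lambda>w. Gamma (c + 1 + ?T n w)) \<in> borel_measurable (?F n)"
      using c beta by simp_all
    then show "?L n \<in> borel_measurable (?F n)"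
      unfolding Lam_def[abs_def] by (intro borel_measurable_divide borel_measurable_times borel_measurable_const)
    show "0 \<le> ?L n w" if "w \<in> space P" for w using Lam_pos[OF that] .
    show "?L n w \<le> b n" if "w \<in> space P" for w
    proof (cases "n = 0")
      case False
      then have "1 \<le> n" by simp
      from mult_left_mono[OF C(5)[OF this T_ge[OF that]] less_imp_le[OF C0]]
      show ?thesis unfolding Lam_eq b_def by (simp only: False if_False)
    qed (simp add: Lam_0 b_def)
    show "AE w in P. real_cond_exp P (?F n) (indicator {w \<in> space P. card (Sset M (Suc n) w) - card (Sset M n w) = k}) w
       = pmf (poi (?L n w)) k" for k
      using M_rm R_meas R_ge M_cond m_diffuse
      by (intro new_dishes_cond_poisson[OF P m_prob m_sets _ alpha beta c u]) auto
  qed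
  let ?a = "a_seq \<beta>"
  \<comment> \<open>Ratio of the antiderivative \<open>powr_sum_limit\<close> to the normalisation
    \<open>a_seq\<close>.\<close>
  define k0 where "k0 = (if \<beta> = 0 then 1 else 1 / \<beta>)"
  define v where "v = lam_const \<alpha> \<beta> c r"
  have k0: "0 < k0" using beta by (simp add: k0_def)
  have lim_a: "powr_sum_limit \<beta> n = k0 * ?a n" for n by (simp add: powr_sum_limit_def a_seq_def k0_def)
  let ?c = "C0 * r powr (\<beta> - 1)"
  \<comment> \<open>The limiting slope of the compensator agrees with \<open>lam_const\<close>; for
    \<open>\<beta> = 0\<close> this is Gamma(c + 1) = c Gamma(c).\<close>
  have v_eq: "v = ?c * k0"
  proof (cases "\<beta> = 0")
    case True
    have "Gamma (c + 1) = c * Gamma c" using c True by (intro Gamma_plus1) (auto elim!: nonpos_Ints_cases)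
    then show ?thesis using True G0 r0 by (simp add: v_def lam_const_def C0_def k0_def powr_minus divide_inverse)
  next
    case False
    have "r powr (\<beta> - 1) = 1 / r powr (1 - \<beta>)" using powr_minus_divide[of r "1 - \<beta>"] by simp
    then show ?thesis using False by (simp add: v_def lam_const_def C0_def k0_def)
  qed
  have v0: "0 < v" unfolding v_eq using C0 r0 k0 by simp
  \<comment> \<open>Value of the antiderivative at 1, where the comparison of sum and integral
    starts.\<close>
  define l where "l = \<bar>powr_sum_limit \<beta> 1\<bar>"
  have sum_split: "(\<Sum>j<n. f j) = f 0 + (\<Sum>j=1..<n. f j)" if "1 \<le> n" for f :: "nat \<Rightarrow> real" and n
    using that by (simp add: lessThan_atLeast0 sum.atLeast_Suc_lessThan)
  have ps: "\<bar>(\<Sum>j=1..<n. ?p j) - k0 * ?a n\<bar> \<le> 1 + l" if "1 \<le> n" for n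
    using powr_sum_bounds[OF beta that] by (simp add: lim_a l_def)
  have a_top: "filterlim ?a at_top sequentially" by (rule filterlim_a_seq[OF beta(1)])
  let ?D = "\<lambda>n. \<integral>w. \<bar>V n w - v * ?a n\<bar> \<partial>P"
  have "stably_conv P (\<lambda>n w. sqrt (?a n) * (real (card (Sset M n w)) / ?a n - v)) (\<lambda>_. gauss v)"
  proof (rule stably_conv_counts[OF a_top v0])
    \<comment> \<open>Once \<open>a_seq\<close> is at least 1, additive constants are absorbed into
      multiples of it.\<close>
    have "eventually (\<lambda>n. 1 \<le> ?a n) sequentially" using a_top by (simp add: filterlim_at_top)
    with eventually_ge_at_top[of 1]
    show "eventually (\<lambda>n. \<forall>w\<in>space P. V n w \<le> (\<alpha> + C0 * C3 * (k0 + 1 + l)) * ?a n) sequentially"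
    proof eventually_elim
      case (elim n)
      have "V n w \<le> (\<alpha> + C0 * C3 * (k0 + 1 + l)) * ?a n" if "w \<in> space P" for w
      proof -
        have "V n w \<le> (\<Sum>j<n. b j)" using V_le[OF that] .
        also have "\<dots> = \<alpha> + (\<Sum>j=1..<n. C0 * C3 * ?p j)"
          unfolding sum_split[OF elim(1)] by (auto simp: b_def intro!: sum.cong)
        also have "\<dots> = \<alpha> + C0 * C3 * (\<Sum>j=1..<n. ?p j)" by (simp add: sum_distrib_left)
        also have "\<dots> \<le> \<alpha> + C0 * C3 * (k0 * ?a n + (1 + l))"
          using ps[OF elim(1)] C0 C(3) by (intro add_left_mono mult_left_mono) auto
        also have "\<dots> \<le> \<alpha> * ?a n + C0 * C3 * (k0 * ?a n + (1 + l) * ?a n)"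
          using elim(2) alpha C0 C(3) k0 mult_left_mono[OF elim(2), of \<alpha>] mult_left_mono[OF elim(2), of "1 + l"]
          by (intro add_mono mult_left_mono) (auto simp: l_def)
        also have "\<dots> = (\<alpha> + C0 * C3 * (k0 + 1 + l)) * ?a n" by (simp add: algebra_simps)
        finally show ?thesis .
      qed
      then show ?case by simp
    qed
    let ?e = "\<lambda>j w. \<bar>?T j w / real j - r\<bar>"
    \<comment> \<open>\<open>K1\<close> collects the intensity \<alpha> of the first customer, the
      summable Gamma error and the comparison of sum with antiderivative; \<open>K2\<close>
      multiplies the deviations governed by the rate hypothesis.\<close>
    define K1 where "K1 = \<alpha> + C0 * (C1 * C4) + ?c * (1 + l)"
    define K2 where "K2 = C0 * C2"
    \<comment> \<open>Runs to \<open>n\<close> as in the rate hypothesis, while \<open>V n\<close>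
      stops at index \<open>n - 1\<close>; the extra term is nonnegative.\<close>
    define G where "G n = (\<Sum>j=1..n. ennreal (?p j) * (\<integral>\<^sup>+w. ennreal (?e j w) \<partial>P))" for n
    \<comment> \<open>At \<open>n = 0\<close> the sum bounded by \<open>C4\<close> is empty, hence
      \<open>C4\<close> is nonnegative.\<close>
    have K1: "0 \<le> K1" unfolding K1_def using C4[of 0] C(1) alpha C0 by (intro add_nonneg_nonneg mult_nonneg_nonneg) (auto simp: l_def)
    have K2: "0 \<le> K2" using C0 C(2) by (simp add: K2_def)
    have pw: "\<bar>V n w - v * ?a n\<bar> \<le> K1 + K2 * (\<Sum>j=1..<n. ?p j * ?e j w)"
      if n: "1 \<le> n" and w: "w \<in> space P" for n w
    proof -
      have summand: "\<bar>?L j w - ?c * ?p j\<bar>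
          \<le> C0 * C1 * real j powr (\<beta> - 2) + K2 * (?p j * ?e j w)" if "1 \<le> j" for j
      proof -
        let ?q = "Gamma (c + \<beta> + ?T j w) / Gamma (c + 1 + ?T j w)"
        have "?L j w - ?c * ?p j = C0 * (?q - (real j * r) powr (\<beta> - 1))"
          unfolding Lam_eq using r0 by (simp add: powr_mult algebra_simps)
        then have "\<bar>?L j w - ?c * ?p j\<bar> = C0 * \<bar>?q - (real j * r) powr (\<beta> - 1)\<bar>"
          using C0 by (simp add: abs_mult)
        also have "\<dots> \<le> C0 * (C1 * real j powr (\<beta> - 2) + C2 * (?p j * ?e j w))"
          using C(4)[OF that T_ge[OF w]] C0 by (intro mult_left_mono) auto
        finally show ?thesis by (simp add: K2_def algebra_simps)
      qed
      \<comment> \<open>Index 0 is split off, the intensities are compared with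
        \<open>?c * ?p j\<close>, and the sum of these powers with its antiderivative.\<close>
      have eq: "V n w - v * ?a n = \<alpha> + (\<Sum>j=1..<n. ?L j w - ?c * ?p j)
          + ?c * ((\<Sum>j=1..<n. ?p j) - k0 * ?a n)"
        unfolding V_def sum_split[OF n] Lam_0 v_eq by (simp add: sum_subtractf sum_distrib_left algebra_simps)
      have "\<bar>V n w - v * ?a n\<bar> \<le> \<alpha> + (\<Sum>j=1..<n. \<bar>?L j w - ?c * ?p j\<bar>)
          + ?c * \<bar>(\<Sum>j=1..<n. ?p j) - k0 * ?a n\<bar>"
        unfolding eq using alpha C0 by (intro order_trans[OF abs_triangle_ineq] add_mono sum_abs) (auto simp: abs_mult)
      also have "\<dots> \<le> \<alpha> + (\<Sum>j=1..<n. C0 * C1 * real j powr (\<beta> - 2) + K2 * (?p j * ?e j w))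
          + ?c * (1 + l)"
      proof (rule add_mono[OF add_mono[OF order_refl sum_mono]])
        fix j assume "j \<in> {1..<n}"
        then show "\<bar>?L j w - ?c * ?p j\<bar>
          \<le> C0 * C1 * real j powr (\<beta> - 2) + K2 * (?p j * ?e j w)" by (intro summand) simp
      qed (use ps[OF n] C0 in \<open>auto intro!: mult_left_mono\<close>)
      also have "\<dots> = \<alpha> + C0 * (C1 * (\<Sum>j=1..<n. real j powr (\<beta> - 2))) + K2 * (\<Sum>j=1..<n. ?p j * ?e j w)
          + ?c * (1 + l)"
        by (simp add: sum.distrib sum_distrib_left mult.assoc)
      also have "\<dots> \<le> K1 + K2 * (\<Sum>j=1..<n. ?p j * ?e j w)"
        unfolding K1_def using C4[of n] C0 C(1) by (auto intro!: mult_left_mono)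
      finally show ?thesis .
    qed
    have eM: "(\<lambda>w. ennreal (?e j w)) \<in> borel_measurable P" for j
    proof -
      have "?T j \<in> borel_measurable P" using R_meas by (intro borel_measurable_sum) auto
      then show ?thesis by measurable
    qed
    have bound: "ennreal (?D n) \<le> ennreal K1 + ennreal K2 * G n" if n: "1 \<le> n" for n
    proof -
      have "integrable P (\<lambda>w. \<bar>V n w - v * ?a n\<bar>)" using integrable_V by auto
      then have "ennreal (?D n) = (\<integral>\<^sup>+w. ennreal \<bar>V n w - v * ?a n\<bar> \<partial>P)"
        by (intro nn_integral_eq_integral[symmetric]) auto
      also have "\<dots> \<le> (\<integral>\<^sup>+w. ennreal K1 + ennreal K2 * (\<Sum>j=1..<n. ennreal (?p j) * ennreal (?e j w)) \<partial>P)"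
      proof (rule nn_integral_mono)
        fix w assume "w \<in> space P"
        from ennreal_leI[OF pw[OF n this]]
        have "ennreal \<bar>V n w - v * ?a n\<bar> \<le> ennreal (K1 + K2 * (\<Sum>j=1..<n. ?p j * ?e j w))" .
        also have "\<dots> = ennreal K1 + ennreal K2 * (\<Sum>j=1..<n. ennreal (?p j * ?e j w))"
          using K1 K2 by (subst sum_ennreal) (auto simp: ennreal_mult sum_nonneg)
        finally show "ennreal \<bar>V n w - v * ?a n\<bar> \<le> ennreal K1 + ennreal K2 * (\<Sum>j=1..<n. ennreal (?p j) * ennreal (?e j w))"
          by (simp add: ennreal_mult)
      qed
      also have "\<dots> = ennreal K1 + ennreal K2 * (\<Sum>j=1..<n. ennreal (?p j) * (\<integral>\<^sup>+w. ennreal (?e j w) \<partial>P))"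
        using eM by (simp add: nn_integral_add nn_integral_cmult nn_integral_sum emeasure_space_1)
      also have "\<dots> \<le> ennreal K1 + ennreal K2 * G n"
        unfolding G_def by (intro add_left_mono mult_left_mono sum_mono2) auto
      finally show ?thesis .
    qed
    \<comment> \<open>The rate hypothesis lives in \<open>ennreal\<close>, where the mean deviations
      might be infinite, so the comparison is made there and brought back to the reals at the
      end.\<close>
    have "(\<lambda>n. ennreal ((?D n) / sqrt (?a n))) \<longlonglongrightarrow> 0"
    proof (rule tendsto_sandwich[OF _ _ tendsto_const])
      show "eventually (\<lambda>n. ennreal ((?D n) / sqrt (?a n))
          \<le> ennreal (K1 / sqrt (?a n)) + ennreal K2 * (G n / ennreal (sqrt (?a n)))) sequentially"
        using eventually_ge_at_top[of 1] filterlim_at_top_dense[THEN iffD1, OF a_top, rule_format, of 0]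
      proof eventually_elim
        case (elim n)
        have s: "0 < sqrt (?a n)" using elim by simp
        have "ennreal ((?D n) / sqrt (?a n)) = ennreal (?D n) / ennreal (sqrt (?a n))"
          using s by (simp add: divide_ennreal)
        also have "\<dots> \<le> (ennreal K1 + ennreal K2 * G n) / ennreal (sqrt (?a n))"
          using bound[OF elim(1)] by (rule divide_right_mono_ennreal)
        also have "\<dots> = ennreal (K1 / sqrt (?a n)) + ennreal K2 * (G n / ennreal (sqrt (?a n)))"
          using s K1 by (simp add: add_divide_distrib_ennreal divide_ennreal ennreal_times_divide)
        finally show ?case .
      qed
      have "(\<lambda>n. K1 / sqrt (?a n)) \<longlonglongrightarrow> 0"
        by (rule real_tendsto_divide_at_top[OF tendsto_const filterlim_compose[OF sqrt_at_top a_top]])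
      then have "(\<lambda>n. ennreal (K1 / sqrt (?a n))) \<longlonglongrightarrow> ennreal 0" by (rule tendsto_ennrealI)
      moreover have "(\<lambda>n. ennreal K2 * (G n / ennreal (sqrt (?a n)))) \<longlonglongrightarrow> ennreal K2 * 0"
        using Rbar_rate unfolding G_def by (intro ennreal_tendsto_cmult) auto
      ultimately show "(\<lambda>n. ennreal (K1 / sqrt (?a n)) + ennreal K2 * (G n / ennreal (sqrt (?a n)))) \<longlonglongrightarrow> 0"
        using tendsto_add by fastforce
    qed auto
    then have "(\<lambda>n. ennreal ((?D n) / sqrt (?a n))) \<longlonglongrightarrow> ennreal 0" by simp
    moreover have "eventually (\<lambda>n. 0 \<le> (?D n) / sqrt (?a n)) sequentially"
      using filterlim_at_top_dense[THEN iffD1, OF a_top, rule_format, of 0] by eventually_elim simp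
    ultimately show "(\<lambda>n. (?D n) / sqrt (?a n)) \<longlonglongrightarrow> 0"
      by (rule tendsto_ennrealD) simp
  qed
  then show ?thesis unfolding v_def .
qed

end
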